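(* Let $p\ge 1$ be a constant and let $\varepsilon\in(0,1)$. There exists a one-pass insertion-only streaming algorithm that makes $\widetilde{\mathcal{O}}(n^{1-1/p})$ internal state changes and, on an insertion-only stream over $[n]$ with frequency vector $f$, outputs $\widehat{F_p}$ such that \[\Pr\left[\left|\widehat{F_p}-F_p\right|\le\varepsilon\cdot F_p\right]\ge\frac{2}{3},\] where $F_p=\sum_{i=1}^n f_i^p$. For $p\in[1,2]$ the algorithm uses $\mathcal{O}\left(\frac{1}{\varepsilon^{4+4p}}\right)\cdot\mathrm{polylog}(mn)$ bits of space, and for $p>2$ it uses $\widetilde{\mathcal{O}}\left(\frac{1}{\varepsilon^{4+4p}}n^{1-2/p}\right)$ bits of space, where $m$ is the stream length.
   Context: An insertion-only stream is a sequence of updates $u_1,\ldots,u_m$ with each $u_t\in[n]$; it defines the frequency vector $f\in\mathbb{R}^n$ by $f_i=|\{t:u_t=i\}|$. A streaming algorithm maintains a memory state $\sigma_t$ after processing update $t$ (with $\sigma_0=\emptyset$); the number of internal state changes is the number of $t$ with $\sigma_t\ne\sigma_{t-1}$. The notation $\widetilde{\mathcal{O}}(\cdot)$ hides polylogarithmic factors (and here also factors polynomial in $1/\varepsilon$ in the state-change bound). *)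

theory Defs
  imports "HOL-Probability.Probability"
begin

text \<open>
  A memory state is a bit string, so its size in bits is its length. The update kernel sees only
  the current memory and the arriving item: the time is not available for free, coins are fresh in
  each step, and any randomness that is to be reused later has to be stored in the memory. The
  work space used inside a single transition is not counted.
\<close>

type_synonym memory = "bool list"

record streaming_alg =
  update_kernel :: "memory \<Rightarrow> nat \<Rightarrow> memory pmf"
  estimate :: "memory \<Rightarrow> real"

primrec run_pmf_from :: "streaming_alg \<Rightarrow> memory \<Rightarrow> nat list \<Rightarrow> memory list pmf" where
  "run_pmf_from A \<sigma> [] = return_pmf [\<sigma>]"
| "run_pmf_from A \<sigma> (u # us) =
     bind_pmf (update_kernel A \<sigma> u) (\<lambda>\<sigma>'. map_pmf ((#) \<sigma>) (run_pmf_from A \<sigma>' us))"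

text \<open>The trajectory \<open>[\<sigma>\<^sub>0, \<dots>, \<sigma>\<^sub>m]\<close> on a stream of length \<open>m\<close>; the initial memory is empty.\<close>

definition run_pmf :: "streaming_alg \<Rightarrow> nat list \<Rightarrow> memory list pmf" where
  "run_pmf A us = run_pmf_from A [] us"

definition output_pmf :: "streaming_alg \<Rightarrow> nat list \<Rightarrow> real pmf" where
  "output_pmf A us = map_pmf (\<lambda>\<sigma>s. estimate A (last \<sigma>s)) (run_pmf A us)"

definition state_changes :: "memory list \<Rightarrow> nat" where
  "state_changes \<sigma>s = card {t. 1 \<le> t \<and> t < length \<sigma>s \<and> \<sigma>s ! t \<noteq> \<sigma>s ! (t - 1)}"

text \<open>
  Only an upper bound \<open>m\<close> on the stream length is known in advance. Resource bounds that hold on every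
  run and depend on the length alone are impossible without such a bound, already for counting
  (\<open>n = 1\<close>, \<open>p = 1\<close>).
\<close>

definition streams_upto :: "nat \<Rightarrow> nat \<Rightarrow> nat list set" where
  "streams_upto n m = {us. set us \<subseteq> {1..n} \<and> length us \<le> m}"

text \<open>The resource bounds are worst-case: they hold on every run of positive probability.\<close>

definition state_changes_bounded :: "streaming_alg \<Rightarrow> nat list set \<Rightarrow> real \<Rightarrow> bool" where
  "state_changes_bounded A S b \<longleftrightarrow>
     (\<forall>us\<in>S. \<forall>\<sigma>s\<in>set_pmf (run_pmf A us). real (state_changes \<sigma>s) \<le> b)"

definition space_bounded :: "streaming_alg \<Rightarrow> nat list set \<Rightarrow> real \<Rightarrow> bool" where
  "space_bounded A S b \<longleftrightarrow>
     (\<forall>us\<in>S. \<forall>\<sigma>s\<in>set_pmf (run_pmf A us). \<forall>\<sigma>\<in>set \<sigma>s. real (length \<sigma>) \<le> b)"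

definition freq_moment :: "real \<Rightarrow> nat \<Rightarrow> nat list \<Rightarrow> real" where
  "freq_moment p n us = (\<Sum>i=1..n. real (count_list us i) powr p)"

text \<open>The shift by 1 keeps the logarithm at least 1 when \<open>m = n = 1\<close>.\<close>

definition lg_mn :: "nat \<Rightarrow> nat \<Rightarrow> real" where
  "lg_mn m n = log 2 (real m * real n + 1)"

end

theory Submission
  imports Defs
begin

text \<open>
  For a pairwise independent uniform \<open>U\<^sub>i\<close>, the sum of \<open>max (f\<^sub>i\<^sup>p) v\<close> over the items with
  \<open>f\<^sub>i\<^sup>p \<ge> v U\<^sub>i\<close> has mean \<open>F\<^sub>p\<close> and variance at most \<open>v F\<^sub>p\<close>. It is monotone in the frequencies, so
  approximate counts sandwich it. The items that contribute are heavy for the rescaled frequencies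
  \<open>f\<^sub>i w\<^sub>i\<close> with \<open>w\<^sub>i = U\<^sub>i\<^bsup>-1/p\<^esup>\<close>, and are found by sampling every update with probability
  proportional to \<open>w\<^sub>i\<close> and counting the sampled updates of the items held so far. With high probability the
  rescaled frequencies satisfy \<open>\<Sum>\<^sub>i (f\<^sub>i w\<^sub>i)\<^sup>p = O(F\<^sub>p log n)\<close>, so by Hoelder about \<open>n\<^bsup>1-1/p\<^esup>\<close> updates are
  sampled.

  Fewer items may be stored than are sampled. A clock ticks at random with the sampling rate, and
  at the end of each dyadic interval of clock values only those items first held in it survive
  that were flagged again at a level with few rivals. The expected number of rivals of a heavy item
  is controlled by \<open>\<Sum>\<^sub>i (f\<^sub>i w\<^sub>i)\<^sup>2\<close>, which by Hoelder costs the factor \<open>n\<^bsup>1-2/p\<^esup>\<close> for \<open>p > 2\<close> only.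

  One instance succeeds with probability at least 1/2, so logarithmically many run in parallel for
  every guess of \<open>F\<^sub>p\<close> by a power of two. If \<open>\<epsilon> \<le> 1 / (m n)\<close>, storing the whole stream is affordable.
\<close>

section \<open>Realizing finite-state algorithms as streaming algorithms\<close>

text \<open>Both resource bounds must hold on every run, whereas sampling controls them only in
  expectation. Each cell therefore freezes after \<open>B\<close> samples or \<open>B\<close> ticks,
  and an overrun is charged to the failure probability. Space is obtained by counting states instead
  of designing a memory layout, state changes by a potential that grows by at least 1 with every
  change. A clock moved by every update would alone cost m changes. Ticking at the sampling rate is
  affordable, and the start of an item still sees in expectation at most one earlier sample with the
  same clock value. The powers of 1/\<epsilon>: counts need relative error \<eta> of order
  \<epsilon>/p, hence about \<eta>^-2 samples at the cutoff, and the threshold v is \<epsilon>^2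
  times the moment up to logarithms, so their ratio costs \<epsilon>^-2 once more. The sampling
  budget is of order \<epsilon>^-4.\<close>

primrec fold_pmf :: "('s \<Rightarrow> 'a \<Rightarrow> 's pmf) \<Rightarrow> 's \<Rightarrow> 'a list \<Rightarrow> 's pmf" where
  "fold_pmf K x [] = return_pmf x"
| "fold_pmf K x (u # us) = bind_pmf (K x u) (\<lambda>y. fold_pmf K y us)"

lemma fold_pmf_append:
  "fold_pmf K x (us @ vs) = bind_pmf (fold_pmf K x us) (\<lambda>y. fold_pmf K y vs)"
proof (induction us arbitrary: x)
  case (Cons u us)
  show ?case by (simp only: append_Cons fold_pmf.simps Cons.IH bind_assoc_pmf)
qed (simp add: bind_return_pmf)

lemma state_changes_singleton: "state_changes [\<sigma>] = 0"
  by (simp add: state_changes_def)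

lemma state_changes_Cons_Cons:
  "state_changes (\<sigma> # \<tau> # \<sigma>s) = (if \<sigma> = \<tau> then 0 else 1) + state_changes (\<tau> # \<sigma>s)"
proof -
  let ?P = "\<lambda>l t. 1 \<le> t \<and> t < length l \<and> l ! t \<noteq> l ! (t - 1)"
  let ?l = "\<sigma> # \<tau> # \<sigma>s" and ?r = "\<tau> # \<sigma>s"
  have fin: "finite {t. ?P ?r t}" by simp
  have "{t. ?P ?l t} = (if \<sigma> = \<tau> then {} else {1}) \<union> Suc ` {t. ?P ?r t}" (is "_ = ?A \<union> ?B")
  proof (rule set_eqI)
    fix t
    show "t \<in> {t. ?P ?l t} \<longleftrightarrow> t \<in> ?A \<union> ?B"
    proof (cases t)
      case (Suc s)
      then show ?thesis by (cases s) (auto simp: image_iff)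
    qed auto
  qed
  then have "card {t. ?P ?l t} = card ?A + card ?B"
    by (simp only:) (rule card_Un_disjoint, use fin in auto)
  also have "card ?B = card {t. ?P ?r t}" by (rule card_image) simp
  finally show ?thesis by (simp add: state_changes_def)
qed

lemma run_pmf_from_not_Nil: "\<sigma>s \<in> set_pmf (run_pmf_from A \<sigma> us) \<Longrightarrow> \<sigma>s \<noteq> [] \<and> hd \<sigma>s = \<sigma>"
  by (cases us) (auto simp: set_map_pmf)

text \<open>Strings of length exactly \<open>b\<close> name all states, and \<open>x0\<close> trades
  its name for \<open>[]\<close>. No other state uses \<open>[]\<close>, because two different
  states force \<open>b > 0\<close>.\<close>

lemma exists_memory_encoding:
  fixes X :: "'s set"
  assumes "finite X" "x0 \<in> X" "card X \<le> 2 ^ b"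
  shows "\<exists>enc :: 's \<Rightarrow> memory. inj_on enc X \<and> enc x0 = [] \<and> (\<forall>x\<in>X. length (enc x) \<le> b)"
proof -
  let ?Y = "{l::memory. set l \<subseteq> UNIV \<and> length l = b}"
  have cY: "card ?Y = 2 ^ b" using card_lists_length_eq[of "UNIV::bool set" b] by simp
  have fY: "finite ?Y" by (rule finite_lists_length_eq) simp
  obtain f where f: "f ` X \<subseteq> ?Y" "inj_on f X"
    using card_le_inj[of X ?Y] assms fY cY by auto
  have len: "length (f x) = b" if "x \<in> X" for x
    using f(1) that by (simp add: image_subset_iff)
  have small: "X = {x0}" if "b = 0"
    using assms that card_le_Suc0_iff_eq[OF assms(1)] by auto
  have "inj_on (\<lambda>x. if x = x0 then [] else f x) X"
  proof (cases "b = 0")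
    case True then show ?thesis using small by simp
  next
    case False
    then have "f x \<noteq> []" if "x \<in> X" for x using len[OF that] by auto
    then show ?thesis using f(2) unfolding inj_on_def by (metis (full_types))
  qed
  moreover have "length (if x = x0 then [] else f x) \<le> b" if "x \<in> X" for x
    using len[OF that] by simp
  ultimately show ?thesis by (intro exI[of _ "\<lambda>x. if x = x0 then [] else f x"]) auto
qed

text \<open>The bridge from a finite Markov chain to the memory model. Space comes from the number
  of states alone, state changes from a potential of range \<open>D\<close>, and both hold on every
  run. What remains for a concrete algorithm is to count its states, to find a potential, and to
  analyse \<open>fold_pmf\<close>.\<close>

lemma finite_state_realization:
  fixes K :: "'s \<Rightarrow> nat \<Rightarrow> 's pmf" and \<mu> :: "'s \<Rightarrow> real" and est :: "'s \<Rightarrow> real"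
  assumes X: "finite X" "x0 \<in> X" "card X \<le> 2 ^ b"
    and closed: "\<And>x u. x \<in> X \<Longrightarrow> u \<in> V \<Longrightarrow> set_pmf (K x u) \<subseteq> X"
    and mono: "\<And>x u y. x \<in> X \<Longrightarrow> u \<in> V \<Longrightarrow> y \<in> set_pmf (K x u) \<Longrightarrow> y \<noteq> x \<Longrightarrow> \<mu> x + 1 \<le> \<mu> y"
    and range: "\<And>x. x \<in> X \<Longrightarrow> \<mu> x \<le> \<mu> x0 + D"
  obtains A where
    "\<And>us \<sigma>s. set us \<subseteq> V \<Longrightarrow> \<sigma>s \<in> set_pmf (run_pmf A us) \<Longrightarrow> real (state_changes \<sigma>s) \<le> D"
    "\<And>us \<sigma>s \<sigma>. set us \<subseteq> V \<Longrightarrow> \<sigma>s \<in> set_pmf (run_pmf A us) \<Longrightarrow> \<sigma> \<in> set \<sigma>s \<Longrightarrow> length \<sigma> \<le> b"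
    "\<And>us. set us \<subseteq> V \<Longrightarrow> output_pmf A us = map_pmf est (fold_pmf K x0 us)"
proof -
  obtain enc :: "'s \<Rightarrow> memory" where enc: "inj_on enc X" "enc x0 = []" "\<And>x. x \<in> X \<Longrightarrow> length (enc x) \<le> b"
    using exists_memory_encoding[OF X] by metis
  define dec where "dec = the_inv_into X enc"
  have dec: "dec (enc x) = x" if "x \<in> X" for x
    using the_inv_into_f_f[OF enc(1) that] by (simp add: dec_def)
  define A where "A = \<lparr>update_kernel = (\<lambda>\<sigma> u. map_pmf enc (K (dec \<sigma>) u)), estimate = est \<circ> dec\<rparr>"
  have enc_eq: "enc x = enc y \<longleftrightarrow> x = y" if "x \<in> X" "y \<in> X" for x y
    using enc(1) that by (auto simp: inj_on_def)
  have upd: "update_kernel A (enc x) u = map_pmf enc (K x u)" if "x \<in> X" for x u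
    using that by (simp add: A_def dec)
  \<comment> \<open>The induction needs an arbitrary start \<open>x\<close>; the bound is then the
    potential still available above \<open>x\<close>.\<close>
  have 1: "real (state_changes \<sigma>s) \<le> \<mu> x0 + D - \<mu> x \<and> (\<forall>\<sigma>\<in>set \<sigma>s. length \<sigma> \<le> b)"
    if "set us \<subseteq> V" "x \<in> X" "\<sigma>s \<in> set_pmf (run_pmf_from A (enc x) us)" for us x \<sigma>s
    using that
  proof (induction us arbitrary: x \<sigma>s)
    case Nil
    then show ?case using range[of x] enc(3) by (simp add: state_changes_singleton)
  next
    case (Cons u us)
    obtain y \<tau>s where y: "y \<in> set_pmf (K x u)" "\<tau>s \<in> set_pmf (run_pmf_from A (enc y) us)"
      "\<sigma>s = enc x # \<tau>s"
      using Cons.prems(3) by (auto simp: upd[OF Cons.prems(2)])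
    have yX: "y \<in> X" using closed Cons.prems y by auto
    have IH: "real (state_changes \<tau>s) \<le> \<mu> x0 + D - \<mu> y" "\<forall>\<sigma>\<in>set \<tau>s. length \<sigma> \<le> b"
      using Cons.IH[OF _ yX y(2)] Cons.prems by auto
    obtain rs where rs: "\<tau>s = enc y # rs"
      using run_pmf_from_not_Nil[OF y(2)] by (cases \<tau>s) auto
    have "\<mu> x + (if enc x = enc y then 0 else 1) \<le> \<mu> y"
      using mono[OF Cons.prems(2) _ y(1)] Cons.prems(1) enc_eq[OF Cons.prems(2) yX]
      by (cases "x = y") auto
    then show ?case
      using IH enc(3)[OF Cons.prems(2)] unfolding y(3) rs state_changes_Cons_Cons by auto
  qed
  have 2: "map_pmf (\<lambda>\<sigma>s. estimate A (last \<sigma>s)) (run_pmf_from A (enc x) us) = map_pmf est (fold_pmf K x us)"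
    if "set us \<subseteq> V" "x \<in> X" for us x
    using that
  proof (induction us arbitrary: x)
    case Nil then show ?case by (simp add: A_def dec)
  next
    case (Cons u us)
    have "map_pmf (\<lambda>\<sigma>s. estimate A (last \<sigma>s)) (run_pmf_from A (enc x) (u # us)) =
      bind_pmf (K x u) (\<lambda>y. map_pmf (\<lambda>\<tau>s. estimate A (last (enc x # \<tau>s))) (run_pmf_from A (enc y) us))"
      by (simp add: upd[OF Cons.prems(2)] map_bind_pmf bind_map_pmf pmf.map_comp o_def)
    also have "\<dots> = bind_pmf (K x u) (\<lambda>y. map_pmf est (fold_pmf K y us))"
    proof (rule bind_pmf_cong[OF refl])
      fix y assume "y \<in> set_pmf (K x u)"
      then have yX: "y \<in> X" using closed Cons.prems by auto
      have "map_pmf (\<lambda>\<tau>s. estimate A (last (enc x # \<tau>s))) (run_pmf_from A (enc y) us) =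
        map_pmf (\<lambda>\<tau>s. estimate A (last \<tau>s)) (run_pmf_from A (enc y) us)"
        using run_pmf_from_not_Nil by (intro map_pmf_cong) auto
      then show "map_pmf (\<lambda>\<tau>s. estimate A (last (enc x # \<tau>s))) (run_pmf_from A (enc y) us) =
        map_pmf est (fold_pmf K y us)"
        using Cons.IH[OF _ yX] Cons.prems by simp
    qed
    also have "\<dots> = map_pmf est (fold_pmf K x (u # us))"
      by (simp add: map_bind_pmf)
    finally show ?case .
  qed
  show ?thesis
  proof (rule that[of A])
    show "real (state_changes \<sigma>s) \<le> D" if "set us \<subseteq> V" "\<sigma>s \<in> set_pmf (run_pmf A us)" for us \<sigma>s
      using 1[OF that(1) X(2)] that(2) enc(2) by (auto simp: run_pmf_def)
    show "length \<sigma> \<le> b" if "set us \<subseteq> V" "\<sigma>s \<in> set_pmf (run_pmf A us)" "\<sigma> \<in> set \<sigma>s" for us \<sigma>s \<sigma>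
      using 1[OF that(1) X(2)] that(2,3) enc(2) by (auto simp: run_pmf_def)
    show "output_pmf A us = map_pmf est (fold_pmf K x0 us)" if "set us \<subseteq> V" for us
      using 2[OF that X(2)] enc(2) by (simp add: output_pmf_def run_pmf_def)
  qed
qed

section \<open>Sample and hold\<close>

text \<open>
  An item is mapped to the clock value at which it was first held, the set of its flags, and the
  number of its sampled updates from then on.
\<close>

type_synonym held = "nat \<Rightarrow> (nat \<times> nat set \<times> nat) option"

type_synonym cell = "nat \<times> nat \<times> held"

text \<open>\<open>None\<close> is the state before the first update. The initial memory is a fixed
  string and coins exist only inside a transition, so the hash seed is drawn with the first update
  and stored from then on.\<close>

type_synonym sketch_state = "((nat \<Rightarrow> nat) \<times> (nat \<times> nat \<Rightarrow> cell)) option"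

text \<open>\<open>Lf\<close> is the number of flag levels, \<open>\<kappa>\<close> the largest
  number of items that may share a flag at a cleanup, \<open>cap\<close> the number of items that
  may start at the same clock value, and \<open>B\<close> the budget for samples and for
  ticks.\<close>

locale sample_hold =
  fixes Lf \<kappa> cap B :: nat
begin

definition held_if :: "held \<Rightarrow> (nat \<Rightarrow> bool) \<Rightarrow> nat set" where
  "held_if E P = {j. \<exists>h F c. E j = Some (h, F, c) \<and> P h}"

definition rivals :: "held \<Rightarrow> nat \<Rightarrow> nat \<Rightarrow> nat \<Rightarrow> nat set" where
  "rivals E T z l = {j. \<exists>h F c. E j = Some (h, F, c) \<and> T \<le> h + 2 ^ z \<and> l \<in> F}"

text \<open>
  Every dyadic interval of length \<open>2 ^ z\<close> that ends at clock value \<open>T\<close> is cleaned up. A survivor has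
  a flag \<open>l\<close> shared by at most \<open>\<kappa>\<close> items, so at most \<open>Lf * \<kappa>\<close> items survive in each completed interval.
\<close>

definition prune :: "nat \<Rightarrow> held \<Rightarrow> held" where
  "prune T E = E |` {j. \<forall>h F c z. E j = Some (h, F, c) \<longrightarrow> 2 ^ z dvd T \<longrightarrow> T \<le> h + 2 ^ z \<longrightarrow>
      (\<exists>l\<in>F. card (rivals E T z l) \<le> \<kappa>)}"

text \<open>Items that start at the running clock value have not yet met a cleanup, so a hard limit
  has to keep them few.\<close>

definition hold :: "nat \<Rightarrow> nat \<Rightarrow> held \<Rightarrow> held" where
  "hold T u E = (case E u of
      None \<Rightarrow> if card (held_if E (\<lambda>h. h = T)) < cap then E(u \<mapsto> (T, {}, 1)) else E
    | Some (h, F, c) \<Rightarrow> E(u \<mapsto> (h, F, Suc c)))"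

definition mark :: "nat \<Rightarrow> nat set \<Rightarrow> held \<Rightarrow> held" where
  "mark u G E = (case E u of None \<Rightarrow> E | Some (h, F, c) \<Rightarrow> E(u \<mapsto> (h, F \<union> G, c)))"

text \<open>Holding precedes marking, so the update that starts an item can also flag it.\<close>

definition process :: "nat \<Rightarrow> nat \<Rightarrow> bool \<Rightarrow> nat set \<Rightarrow> held \<Rightarrow> held" where
  "process T u smp G E = mark u G (if smp then hold T u E else E)"

text \<open>Freezing at \<open>B\<close> turns a bound in expectation into one for every run. The
  tick takes effect after the item has been processed: a ticking update still belongs to the old
  clock value, and the cleanup sees it.\<close>

fun step :: "cell \<Rightarrow> nat \<Rightarrow> bool \<Rightarrow> bool \<Rightarrow> nat set \<Rightarrow> cell" where
  "step (S, T, E) u tick smp G =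
     (if B \<le> S \<or> B \<le> T then (S, T, E)
      else ((if smp then Suc S else S), (if tick then Suc T else T),
            (if tick then prune (Suc T) else id) (process T u smp G E)))"

text \<open>The last clause speaks of completed dyadic intervals only, the clause on
  \<open>cap\<close> of the running clock value. Together they bound the number of held items,
  because the clock values below \<open>T\<close> split into few completed dyadic intervals.\<close>

fun valid :: "nat \<Rightarrow> cell \<Rightarrow> bool" where
  "valid n (S, T, E) \<longleftrightarrow> S \<le> B \<and> T \<le> B \<and> dom E \<subseteq> {1..n} \<and>
     (\<forall>j h F c. E j = Some (h, F, c) \<longrightarrow> h \<le> T \<and> F \<subseteq> {..<Lf} \<and> c \<le> S) \<and>
     card (held_if E (\<lambda>h. h = T)) \<le> cap \<and>
     (\<forall>z a. (a + 1) * 2 ^ z \<le> T \<longrightarrow> card (held_if E (\<lambda>h. a * 2 ^ z \<le> h \<and> h < (a + 1) * 2 ^ z)) \<le> Lf * \<kappa>)"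

lemma held_if_subset_dom: "held_if E P \<subseteq> dom E"
  by (auto simp: held_if_def)

lemma prune_Some: "prune T E j = Some e \<Longrightarrow> E j = Some e"
  by (auto simp: prune_def restrict_map_def split: if_splits)

lemma dom_prune: "dom (prune T E) \<subseteq> dom E"
  by (auto dest: prune_Some)

lemma held_if_prune: "held_if (prune T E) P \<subseteq> held_if E P"
  by (auto simp: held_if_def dest: prune_Some)

lemma held_if_mark: "held_if (mark u G E) P = held_if E P"
  by (auto simp: held_if_def mark_def split: option.splits)

lemma held_if_hold_subset: "held_if (hold T u E) P \<subseteq> (if P T then insert u (held_if E P) else held_if E P)"
  by (auto simp: held_if_def hold_def split: option.splits if_splits)

lemma held_if_hold_card:
  assumes "card (held_if E (\<lambda>h. h = T)) \<le> cap" "finite (dom E)"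
  shows "card (held_if (hold T u E) (\<lambda>h. h = T)) \<le> cap"
proof (cases "E u = None \<and> card (held_if E (\<lambda>h. h = T)) < cap")
  case True
  have "card (held_if (hold T u E) (\<lambda>h. h = T)) \<le> card (insert u (held_if E (\<lambda>h. h = T)))"
    using held_if_hold_subset[of T u E "\<lambda>h. h = T"] finite_subset[OF held_if_subset_dom assms(2)]
    by (intro card_mono) auto
  also have "\<dots> \<le> Suc (card (held_if E (\<lambda>h. h = T)))"
    by (rule card_insert_le_m1) auto
  finally show ?thesis using True by simp
next
  case False
  then have "held_if (hold T u E) (\<lambda>h. h = T) = held_if E (\<lambda>h. h = T)"
    by (auto simp: held_if_def hold_def split: option.splits if_splits)
  then show ?thesis using assms by simp
qed

lemma dom_process: "dom (process T u smp G E) \<subseteq> insert u (dom E)"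
  by (auto simp: process_def mark_def hold_def split: option.splits if_splits)

lemma card_held_prune:
  assumes "finite (dom E)" "2 ^ z dvd T"
    and "\<And>j h F c. E j = Some (h, F, c) \<Longrightarrow> F \<subseteq> {..<Lf}"
  shows "card (held_if (prune T E) (\<lambda>h. T \<le> h + 2 ^ z)) \<le> Lf * \<kappa>"
proof -
  let ?R = "\<lambda>l. if card (rivals E T z l) \<le> \<kappa> then rivals E T z l else {}"
  have fin: "finite (rivals E T z l)" for l
    by (rule finite_subset[OF _ assms(1)]) (auto simp: rivals_def)
  have "held_if (prune T E) (\<lambda>h. T \<le> h + 2 ^ z) \<subseteq> (\<Union>l<Lf. ?R l)"
  proof
    fix j assume "j \<in> held_if (prune T E) (\<lambda>h. T \<le> h + 2 ^ z)"
    then obtain h F c where e: "prune T E j = Some (h, F, c)" "T \<le> h + 2 ^ z"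
      by (auto simp: held_if_def)
    have E: "E j = Some (h, F, c)" using prune_Some[OF e(1)] .
    obtain l where l: "l \<in> F" "card (rivals E T z l) \<le> \<kappa>"
      using e E assms(2) by (fastforce simp: prune_def restrict_map_def split: if_splits)
    then show "j \<in> (\<Union>l<Lf. ?R l)"
      using assms(3)[OF E] E e(2) by (auto simp: rivals_def intro!: bexI[of _ l])
  qed
  then have "card (held_if (prune T E) (\<lambda>h. T \<le> h + 2 ^ z)) \<le> card (\<Union>l<Lf. ?R l)"
    using fin by (intro card_mono) auto
  also have "\<dots> \<le> (\<Sum>l<Lf. card (?R l))" by (rule card_UN_le) simp
  also have "\<dots> \<le> (\<Sum>l<Lf. \<kappa>)" by (intro sum_mono) auto
  finally show ?thesis by simp
qed

lemma process_Some:
  assumes "process T u smp G E j = Some (h, F, c)"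
  shows "(\<exists>F' c'. E j = Some (h, F', c') \<and> F \<subseteq> F' \<union> G \<and> c \<le> (if smp then Suc c' else c'))
    \<or> smp \<and> j = u \<and> h = T \<and> F \<subseteq> G \<and> c = 1"
  using assms
  by (auto simp: process_def mark_def hold_def split: option.splits if_splits prod.splits)

lemma held_if_process:
  "\<not> P T \<Longrightarrow> held_if (process T u smp G E) P = held_if E P"
  by (auto simp: held_if_def process_def mark_def hold_def split: option.splits if_splits)

text \<open>New items start at \<open>T\<close>, so nothing joins a completed interval. A tick
  completes exactly the dyadic intervals that end at \<open>Suc T\<close>, and those have just been
  pruned.\<close>

lemma valid_step:
  assumes "valid n \<sigma>" "u \<in> {1..n}" "G \<subseteq> {..<Lf}"
  shows "valid n (step \<sigma> u tick smp G)"
proof -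
  obtain S T E where \<sigma>: "\<sigma> = (S, T, E)" by (cases \<sigma>)
  show ?thesis
  proof (cases "B \<le> S \<or> B \<le> T")
    case True then show ?thesis using assms(1) by (simp add: \<sigma>)
  next
    case False
    let ?E = "process T u smp G E"
    let ?S = "if smp then Suc S else S"
    note v = assms(1)[unfolded \<sigma> valid.simps]
    have fin: "finite (dom E)" using v finite_subset by blast
    have dom: "dom ?E \<subseteq> {1..n}" using dom_process[of T u smp G E] v assms(2) by blast
    then have finE: "finite (dom ?E)" using finite_subset by blast
    have ent: "h \<le> T \<and> F \<subseteq> {..<Lf} \<and> c \<le> ?S" if "?E j = Some (h, F, c)" for j h F c
    proof -
      from process_Some[OF that] consider F' c' where "E j = Some (h, F', c')" "F \<subseteq> F' \<union> G"
          "c \<le> (if smp then Suc c' else c')" | "smp" "h = T" "F \<subseteq> G" "c = 1" by auto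
      then show ?thesis
      proof cases
        case 1
        then have "h \<le> T" "F' \<subseteq> {..<Lf}" "c' \<le> S" using v by blast+
        then show ?thesis using 1 assms(3) by (auto split: if_splits)
      qed (use assms(3) in auto)
    qed
    have leaf: "card (held_if ?E (\<lambda>h. h = T)) \<le> cap"
      using v held_if_hold_card[OF _ fin] by (simp add: process_def held_if_mark)
    have old: "card (held_if ?E (\<lambda>h. a * 2 ^ z \<le> h \<and> h < (a + 1) * 2 ^ z)) \<le> Lf * \<kappa>"
      if "(a + 1) * 2 ^ z \<le> T" for a z
    proof -
      have "\<not> (a * 2 ^ z \<le> T \<and> T < (a + 1) * 2 ^ z)" using that by simp
      then show ?thesis using v that by (subst held_if_process) auto
    qed
    show ?thesis
    proof (cases tick)
      case tick: False
      then have "step \<sigma> u tick smp G = (?S, T, ?E)" using False by (simp add: \<sigma>)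
      moreover have "?S \<le> B" "T \<le> B" using False by auto
      ultimately show ?thesis using dom ent leaf old by simp
    next
      case tick: True
      let ?P = "prune (Suc T) ?E"
      have eq: "step \<sigma> u tick smp G = (?S, Suc T, ?P)" using False tick by (simp add: \<sigma>)
      have entP: "h \<le> T \<and> F \<subseteq> {..<Lf} \<and> c \<le> ?S" if "?P j = Some (h, F, c)" for j h F c
        using ent[OF prune_Some[OF that]] .
      \<comment> \<open>Nothing can have started at the new clock value yet, so the limit
        \<open>cap\<close> begins afresh.\<close>
      have "held_if ?P (\<lambda>h. h = Suc T) = {}"
        using entP by (fastforce simp: held_if_def)
      moreover have "card (held_if ?P (\<lambda>h. a * 2 ^ z \<le> h \<and> h < (a + 1) * 2 ^ z)) \<le> Lf * \<kappa>"
        if "(a + 1) * 2 ^ z \<le> Suc T" for a z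
      proof (cases "(a + 1) * 2 ^ z \<le> T")
        case True
        have "card (held_if ?P (\<lambda>h. a * 2 ^ z \<le> h \<and> h < (a + 1) * 2 ^ z))
          \<le> card (held_if ?E (\<lambda>h. a * 2 ^ z \<le> h \<and> h < (a + 1) * 2 ^ z))"
          using held_if_prune finite_subset[OF held_if_subset_dom finE] by (intro card_mono) auto
        then show ?thesis using old[OF True] by simp
      next
        case False
        \<comment> \<open>The interval was incomplete before this tick and is complete after it, so
          it ends exactly at the new clock value.\<close>
        then have T: "Suc T = (a + 1) * 2 ^ z" using that by simp
        have "card (held_if ?P (\<lambda>h. a * 2 ^ z \<le> h \<and> h < (a + 1) * 2 ^ z))
          \<le> card (held_if ?P (\<lambda>h. Suc T \<le> h + 2 ^ z))"
        proof (rule card_mono)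
          show "finite (held_if ?P (\<lambda>h. Suc T \<le> h + 2 ^ z))"
            using finite_subset[OF held_if_subset_dom] finite_subset[OF dom_prune finE] by blast
          show "held_if ?P (\<lambda>h. a * 2 ^ z \<le> h \<and> h < (a + 1) * 2 ^ z) \<subseteq> held_if ?P (\<lambda>h. Suc T \<le> h + 2 ^ z)"
            unfolding T by (auto simp: held_if_def)
        qed
        also have "\<dots> \<le> Lf * \<kappa>"
          using ent by (intro card_held_prune finE) (auto simp: T)
        finally show ?thesis .
      qed
      moreover have "dom ?P \<subseteq> {1..n}" using dom_prune dom by blast
      moreover have "?S \<le> B" "Suc T \<le> B" using False by auto
      ultimately show ?thesis unfolding eq using entP by (auto intro: le_SucI)
    qed
  qed
qed

text \<open>Binary expansion of \<open>T\<close>. Keeping one more leading bit leaves the truncated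
  value unchanged if the bit is 0 and adds one completed dyadic interval if it is 1. After
  \<open>Z\<close> bits the truncation is \<open>T\<close> itself.\<close>

lemma card_held_dyadic:
  assumes fin: "finite (dom E)"
    and dy: "\<And>z a. (a + 1) * 2 ^ z \<le> T \<Longrightarrow>
      card (held_if E (\<lambda>h. a * 2 ^ z \<le> h \<and> h < (a + 1) * 2 ^ z)) \<le> D"
    and T: "T < 2 ^ Z"
  shows "card (held_if E (\<lambda>h. h < T)) \<le> Z * D"
proof -
  have "d \<le> Z \<Longrightarrow> card (held_if E (\<lambda>h. h < T div 2 ^ (Z - d) * 2 ^ (Z - d))) \<le> d * D" for d
  proof (induction d)
    case 0 then show ?case using T by (simp add: held_if_def)
  next
    case (Suc d)
    define z where "z = Z - Suc d"
    have z: "Z - d = Suc z" using Suc.prems by (simp add: z_def)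
    let ?a = "T div 2 ^ Suc z"
    have IH: "card (held_if E (\<lambda>h. h < ?a * 2 ^ Suc z)) \<le> d * D" using Suc by (simp add: z)
    have div: "T div 2 ^ z div 2 = ?a" by (metis div_mult2_eq power_Suc2)
    show ?case
    proof (cases "even (T div 2 ^ z)")
      case True
      then have "T div 2 ^ z = 2 * ?a" using div by (metis dvd_mult_div_cancel)
      then show ?thesis using IH by (simp add: z_def[symmetric] mult.assoc mult.left_commute)
    next
      case False
      then have e: "T div 2 ^ z = 2 * ?a + 1" using div by (metis odd_two_times_div_two_succ)
      have le: "(2 * ?a + 1) * 2 ^ z \<le> T" unfolding e[symmetric] by simp
      have "held_if E (\<lambda>h. h < T div 2 ^ z * 2 ^ z) \<subseteq> held_if E (\<lambda>h. h < ?a * 2 ^ Suc z) \<union>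
        held_if E (\<lambda>h. 2 * ?a * 2 ^ z \<le> h \<and> h < (2 * ?a + 1) * 2 ^ z)"
        unfolding e by (auto simp: held_if_def mult.assoc mult.left_commute)
      then have "card (held_if E (\<lambda>h. h < T div 2 ^ z * 2 ^ z)) \<le>
        card (held_if E (\<lambda>h. h < ?a * 2 ^ Suc z)) +
        card (held_if E (\<lambda>h. 2 * ?a * 2 ^ z \<le> h \<and> h < (2 * ?a + 1) * 2 ^ z))"
        using finite_subset[OF held_if_subset_dom fin]
        by (meson card_Un_le card_mono finite_UnI order_trans)
      also have "\<dots> \<le> d * D + D" using IH dy[OF le] by simp
      finally show ?thesis by (simp add: z_def[symmetric])
    qed
  qed
  from this[of Z] show ?thesis by simp
qed

lemma card_dom_valid:
  assumes "valid n (S, T, E)" "B < 2 ^ Z"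
  shows "card (dom E) \<le> Z * (Lf * \<kappa>) + cap"
proof -
  note v = assms(1)[unfolded valid.simps]
  have fin: "finite (dom E)" using v finite_subset by blast
  have "dom E \<subseteq> held_if E (\<lambda>h. h < T) \<union> held_if E (\<lambda>h. h = T)"
  proof
    fix j assume "j \<in> dom E"
    then obtain h F c where e: "E j = Some (h, F, c)" by auto
    then have "h \<le> T" using v by blast
    then show "j \<in> held_if E (\<lambda>h. h < T) \<union> held_if E (\<lambda>h. h = T)"
      using e by (auto simp: held_if_def)
  qed
  then have "card (dom E) \<le> card (held_if E (\<lambda>h. h < T)) + card (held_if E (\<lambda>h. h = T))"
    using finite_subset[OF held_if_subset_dom fin]
    by (meson card_Un_le card_mono finite_UnI order_trans)
  also have "\<dots> \<le> Z * (Lf * \<kappa>) + cap"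
    using v assms(2) by (intro add_mono card_held_dyadic fin) auto
  finally show ?thesis .
qed

end

section \<open>Counting the states of a cell\<close>

text \<open>A set of at most \<open>H\<close> elements is read off from a list of length exactly
  \<open>H\<close> whose free places hold \<open>None\<close>; hence the base
  \<open>card U + 1\<close>.\<close>

lemma card_bounded_subsets:
  assumes "finite U"
  shows "card {A. A \<subseteq> U \<and> card A \<le> H} \<le> (card U + 1) ^ H" "finite {A. A \<subseteq> U \<and> card A \<le> H}"
proof -
  let ?L = "{xs. set xs \<subseteq> insert None (Some ` U) \<and> length xs = H}"
  have fin: "finite ?L" using assms by (intro finite_lists_length_eq) auto
  have sub: "{A. A \<subseteq> U \<and> card A \<le> H} \<subseteq> (\<lambda>xs. {x. Some x \<in> set xs}) ` ?L"
  proof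
    fix A assume "A \<in> {A. A \<subseteq> U \<and> card A \<le> H}"
    then have A: "A \<subseteq> U" "card A \<le> H" by auto
    obtain ys where ys: "set ys = A" "distinct ys"
      using finite_distinct_list[of A] finite_subset[OF A(1) assms] by blast
    then have len: "length ys = card A" using distinct_card by metis
    let ?xs = "map Some ys @ replicate (H - card A) None"
    have mem: "?xs \<in> ?L" using A len ys by auto
    have eq: "A = {x. Some x \<in> set ?xs}" using ys by auto
    show "A \<in> (\<lambda>xs. {x. Some x \<in> set xs}) ` ?L" using eq mem by (intro image_eqI[where x = ?xs])
  qed
  have "card {A. A \<subseteq> U \<and> card A \<le> H} \<le> card ((\<lambda>xs. {x. Some x \<in> set xs}) ` ?L)"
    using fin sub by (intro card_mono) auto
  also have "\<dots> \<le> card ?L" by (rule card_image_le[OF fin])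
  also have "\<dots> = card (insert None (Some ` U)) ^ H"
    using assms by (intro card_lists_length_eq) auto
  also have "card (insert None (Some ` U)) = card U + 1"
    using assms by (subst card_insert_disjoint) (auto simp: card_image)
  finally show "card {A. A \<subseteq> U \<and> card A \<le> H} \<le> (card U + 1) ^ H" .
  show "finite {A. A \<subseteq> U \<and> card A \<le> H}" using assms by simp
qed

lemma map_graph_inj:
  assumes "Map.graph E = Map.graph E'"
  shows "E = E'"
proof (rule ext)
  fix j
  show "E j = E' j"
    using assms by (metis in_graphD in_graphI option.exhaust)
qed

context sample_hold
begin

text \<open>The logarithm of this bound is the space of one cell: two counters and at most
  \<open>H\<close> entries. A held map is counted through its graph, a set of at most
  \<open>H\<close> tuples.\<close>

lemma valid_finite_card:
  assumes "B < 2 ^ Z"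
  defines "H \<equiv> Z * (Lf * \<kappa>) + cap"
  shows "finite {\<sigma>. valid n \<sigma>}"
    "card {\<sigma>. valid n \<sigma>} \<le> (B + 1)\<^sup>2 * (n * (B + 1)\<^sup>2 * 2 ^ Lf + 1) ^ H"
proof -
  let ?U = "{1..n} \<times> {..B} \<times> Pow {..<Lf} \<times> {..B}"
  let ?Y = "{..B} \<times> {..B} \<times> {A. A \<subseteq> ?U \<and> card A \<le> H}"
  let ?f = "\<lambda>(S::nat, T::nat, E::held). (S, T, Map.graph E)"
  have cU: "card ?U = n * (B + 1)\<^sup>2 * 2 ^ Lf"
    by (simp add: card_cartesian_product card_Pow power2_eq_square algebra_simps)
  have fU: "finite ?U" by simp
  have inj: "inj_on ?f {\<sigma>. valid n \<sigma>}"
    by (auto simp: inj_on_def dest: map_graph_inj)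
  have sub: "?f ` {\<sigma>. valid n \<sigma>} \<subseteq> ?Y"
  proof
    fix y assume "y \<in> ?f ` {\<sigma>. valid n \<sigma>}"
    then obtain S T E where v: "valid n (S, T, E)" and y: "y = (S, T, Map.graph E)" by auto
    have "Map.graph E \<subseteq> ?U"
    proof
      fix e assume "e \<in> Map.graph E"
      then obtain j h F c where e: "e = (j, h, F, c)" "E j = Some (h, F, c)"
        by (cases e) (auto dest: in_graphD)
      have "j \<in> dom E" using e by auto
      moreover have "h \<le> T" "F \<subseteq> {..<Lf}" "c \<le> S" using v e(2) by auto
      moreover have "S \<le> B" "T \<le> B" "dom E \<subseteq> {1..n}" using v by auto
      ultimately have "j \<in> {1..n}" "h \<le> B" "F \<subseteq> {..<Lf}" "c \<le> B" by auto
      then show "e \<in> ?U" using e by auto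
    qed
    moreover have "card (Map.graph E) = card (dom E)"
      by (simp add: graph_eq_to_snd_dom card_image inj_on_def)
    ultimately show "y \<in> ?Y" using v y card_dom_valid[OF v assms(1)] by (auto simp: H_def)
  qed
  have finY: "finite ?Y" using card_bounded_subsets(2)[OF fU] by simp
  show "finite {\<sigma>. valid n \<sigma>}" using finite_imageD[OF finite_subset[OF sub finY] inj] .
  have "card {\<sigma>. valid n \<sigma>} = card (?f ` {\<sigma>. valid n \<sigma>})" by (simp add: card_image[OF inj])
  also have "\<dots> \<le> card ?Y" by (rule card_mono[OF finY sub])
  also have "\<dots> = (B + 1)\<^sup>2 * card {A. A \<subseteq> ?U \<and> card A \<le> H}"
    by (simp add: card_cartesian_product power2_eq_square algebra_simps)
  also have "\<dots> \<le> (B + 1)\<^sup>2 * (card ?U + 1) ^ H"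
    using card_bounded_subsets(1)[OF fU] by (intro mult_left_mono) auto
  finally show "card {\<sigma>. valid n \<sigma>} \<le> (B + 1)\<^sup>2 * (n * (B + 1)\<^sup>2 * 2 ^ Lf + 1) ^ H"
    by (simp only: cU)
qed

end

section \<open>A potential for the state changes\<close>

context sample_hold
begin

text \<open>
  The map \<open>progress\<close> below strictly increases with every change of state: a sample adds
  \<open>Lf + 2\<close>, of which a newly held item uses at most \<open>Lf\<close>, and new flags, ticks and evictions only help.
\<close>

definition weight :: "held \<Rightarrow> real" where
  "weight E = (\<Sum>j\<in>dom E. real Lf - real (card (fst (snd (the (E j))))))"

fun progress :: "cell \<Rightarrow> real" where
  "progress (S, T, E) = (real Lf + 2) * real S + real T - weight E"

definition small_flags :: "held \<Rightarrow> bool" where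
  "small_flags E \<longleftrightarrow> finite (dom E) \<and> (\<forall>j h F c. E j = Some (h, F, c) \<longrightarrow> F \<subseteq> {..<Lf})"

lemma small_flags_card: "small_flags E \<Longrightarrow> E j = Some (h, F, c) \<Longrightarrow> card F \<le> Lf"
  using card_mono[of "{..<Lf}" F] by (force simp: small_flags_def)

lemma weight_upd:
  assumes "finite (dom E)"
  shows "weight (E(u \<mapsto> (h, F, c))) = weight E + (real Lf - real (card F))
    - (case E u of None \<Rightarrow> 0 | Some (h', F', c') \<Rightarrow> real Lf - real (card F'))"
proof -
  let ?g = "\<lambda>E j. real Lf - real (card (fst (snd (the (E j)))))"
  have "weight (E(u \<mapsto> (h, F, c))) = (real Lf - real (card F)) + (\<Sum>j\<in>dom E - {u}. ?g E j)"
    using assms unfolding weight_def by (simp add: sum.insert_remove)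
  moreover have "weight E = (\<Sum>j\<in>dom E - {u}. ?g E j) + (case E u of None \<Rightarrow> 0 | Some (h', F', c') \<Rightarrow> real Lf - real (card F'))"
  proof (cases "E u")
    case None
    then have "u \<notin> dom E" by auto
    then show ?thesis using None by (simp add: weight_def)
  next
    case (Some e)
    then have "u \<in> dom E" by auto
    from sum.remove[OF assms this, of "?g E"] show ?thesis
      using Some by (cases e) (simp add: weight_def)
  qed
  ultimately show ?thesis by simp
qed

lemma weight_nonneg: "small_flags E \<Longrightarrow> 0 \<le> weight E"
  unfolding weight_def by (rule sum_nonneg) (auto dest: small_flags_card)

lemma weight_hold:
  assumes "small_flags E"
  shows "weight (hold T u E) \<le> weight E + real Lf" "small_flags (hold T u E)"
  using assms by (auto simp: hold_def weight_upd small_flags_def split: option.splits if_splits)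

lemma weight_mark:
  assumes "small_flags E" "G \<subseteq> {..<Lf}"
  shows "small_flags (mark u G E)" "mark u G E \<noteq> E \<Longrightarrow> weight (mark u G E) + 1 \<le> weight E"
proof -
  show "small_flags (mark u G E)"
    using assms by (auto simp: mark_def small_flags_def split: option.splits if_splits)
  assume ne: "mark u G E \<noteq> E"
  then obtain h F c where e: "E u = Some (h, F, c)" by (auto simp: mark_def split: option.splits)
  then have "F \<union> G \<noteq> F" using ne by (auto simp: mark_def fun_upd_idem_iff)
  moreover have "F \<subseteq> {..<Lf}" using assms(1) e unfolding small_flags_def by blast
  then have "finite (F \<union> G)" using assms(2) finite_subset[of "F \<union> G" "{..<Lf}"] by simp
  ultimately have "card F < card (F \<union> G)" by (intro psubset_card_mono) auto
  then show "weight (mark u G E) + 1 \<le> weight E"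
    using assms e by (simp add: mark_def weight_upd small_flags_def)
qed

lemma weight_prune: "small_flags E \<Longrightarrow> weight (prune T E) \<le> weight E"
proof -
  assume *: "small_flags E"
  have "weight (prune T E) = (\<Sum>j\<in>dom (prune T E). real Lf - real (card (fst (snd (the (E j))))))"
    unfolding weight_def
  proof (rule sum.cong[OF refl])
    fix j assume "j \<in> dom (prune T E)"
    then obtain e where "prune T E j = Some e" by auto
    with prune_Some[OF this] show "real Lf - real (card (fst (snd (the (prune T E j))))) =
      real Lf - real (card (fst (snd (the (E j)))))" by simp
  qed
  also have "\<dots> \<le> weight E"
    unfolding weight_def using * dom_prune
    by (intro sum_mono2) (auto simp: small_flags_card small_flags_def)
  finally show ?thesis .
qed

lemma valid_small_flags: "valid n (S, T, E) \<Longrightarrow> small_flags E"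
  using finite_subset by (fastforce simp: small_flags_def)

lemma progress_step:
  assumes "valid n \<sigma>" "G \<subseteq> {..<Lf}" "step \<sigma> u tick smp G \<noteq> \<sigma>"
  shows "progress \<sigma> + 1 \<le> progress (step \<sigma> u tick smp G)"
proof -
  obtain S T E where \<sigma>: "\<sigma> = (S, T, E)" by (cases \<sigma>)
  have nf: "\<not> (B \<le> S \<or> B \<le> T)" using assms(3) by (auto simp: \<sigma>)
  let ?E1 = "if smp then hold T u E else E"
  let ?E = "process T u smp G E"
  have sf: "small_flags E" using assms(1) by (simp add: \<sigma> valid_small_flags del: valid.simps)
  have sf1: "small_flags ?E1" using weight_hold(2)[OF sf] sf by simp
  have w1: "weight ?E1 \<le> weight E + (if smp then real Lf else 0)" using weight_hold(1)[OF sf] by simp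
  have "?E = ?E1 \<or> weight ?E + 1 \<le> weight ?E1"
    using weight_mark(2)[OF sf1 assms(2), of u] unfolding process_def by blast
  then have w2: "weight ?E \<le> weight ?E1" "smp \<or> ?E = E \<or> weight ?E + 1 \<le> weight E"
    by (auto split: if_splits)
  have sf2: "small_flags ?E" unfolding process_def by (rule weight_mark(1)[OF sf1 assms(2)])
  have w3: "weight (if tick then prune (Suc T) ?E else ?E) \<le> weight ?E"
    using weight_prune[OF sf2] by simp
  have eq: "step \<sigma> u tick smp G = ((if smp then Suc S else S), (if tick then Suc T else T),
      (if tick then prune (Suc T) ?E else ?E))" using nf by (simp add: \<sigma>)
  have pe: "progress (step \<sigma> u tick smp G) = (real Lf + 2) * real S + (if smp then real Lf + 2 else 0)
     + real T + (if tick then 1 else 0) - weight (if tick then prune (Suc T) ?E else ?E)"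
    unfolding eq by (simp add: algebra_simps)
  have "smp \<or> tick \<or> ?E \<noteq> E" using assms(3)[unfolded eq] \<sigma> by auto
  then have "weight (if tick then prune (Suc T) ?E else ?E) + 1 \<le>
    weight E + (if smp then real Lf + 2 else 0) + (if tick then 1 else 0)"
    using w1 w2 w3 by (cases smp; cases tick) (auto simp: process_def)
  then show ?thesis unfolding pe by (simp add: \<sigma>)
qed

lemma progress_le: "valid n \<sigma> \<Longrightarrow> progress \<sigma> \<le> (real Lf + 3) * real B"
proof -
  assume v: "valid n \<sigma>"
  obtain S T E where \<sigma>: "\<sigma> = (S, T, E)" by (cases \<sigma>)
  have "0 \<le> weight E" using v weight_nonneg valid_small_flags unfolding \<sigma> by blast
  moreover have "real S \<le> real B" "real T \<le> real B" using v by (auto simp: \<sigma>)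
  moreover have "(real Lf + 2) * real S \<le> (real Lf + 2) * real B"
    using v by (intro mult_left_mono) (auto simp: \<sigma>)
  ultimately show ?thesis by (simp add: \<sigma> algebra_simps)
qed

section \<open>Runs as functions of the coins\<close>

text \<open>All randomness sits in two tables: \<open>k t\<close> decides the tick,
  \<open>\<omega> t 0\<close> the sampling and \<open>\<omega> t (Suc l)\<close> the flag
  \<open>l\<close> of update \<open>t\<close>. The analysis thereby splits into deterministic
  statements about runs and probabilities of coin events.\<close>

primrec run :: "nat list \<Rightarrow> (nat \<Rightarrow> bool) \<Rightarrow> (nat \<Rightarrow> nat \<Rightarrow> bool) \<Rightarrow> nat \<Rightarrow> cell" where
  "run us k \<omega> 0 = (0, 0, Map.empty)"
| "run us k \<omega> (Suc t) = step (run us k \<omega> t) (us ! t) (k t) (\<omega> t 0) {l. l < Lf \<and> \<omega> t (Suc l)}"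

text \<open>The clock as it would run without freezing. Only ticks strictly before \<open>t\<close>
  count, in accordance with \<open>step\<close>.\<close>

definition clock :: "(nat \<Rightarrow> bool) \<Rightarrow> nat \<Rightarrow> nat" where
  "clock k t = card {x. x < t \<and> k x}"

definition samples :: "(nat \<Rightarrow> nat \<Rightarrow> bool) \<Rightarrow> nat \<Rightarrow> nat" where
  "samples \<omega> t = card {x. x < t \<and> \<omega> x 0}"

definition hits :: "nat list \<Rightarrow> (nat \<Rightarrow> nat \<Rightarrow> bool) \<Rightarrow> nat \<Rightarrow> nat \<Rightarrow> nat" where
  "hits us \<omega> j t = card {x. x < t \<and> us ! x = j \<and> \<omega> x 0}"

lemma card_less_Suc_Collect:
  "card {x. x < Suc t \<and> P x} = card {x. x < t \<and> P x} + (if P t then 1 else 0)"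
proof -
  have "{x. x < Suc t \<and> P x} = (if P t then insert t {x. x < t \<and> P x} else {x. x < t \<and> P x})"
    by (auto simp: less_Suc_eq)
  then show ?thesis by simp
qed

lemma clock_Suc: "clock k (Suc t) = clock k t + (if k t then 1 else 0)"
  and samples_Suc: "samples \<omega> (Suc t) = samples \<omega> t + (if \<omega> t 0 then 1 else 0)"
  and hits_Suc: "hits us \<omega> j (Suc t) = hits us \<omega> j t + (if us ! t = j \<and> \<omega> t 0 then 1 else 0)"
  unfolding clock_def samples_def hits_def by (rule card_less_Suc_Collect)+

lemma clock_mono: "t \<le> t' \<Longrightarrow> clock k t \<le> clock k t'"
  unfolding clock_def by (rule card_mono) auto

text \<open>A certificate that reads an entry back into the coins: a sampled update at which the
  item started, with all its flags thrown at that update or later.\<close>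

definition origin :: "nat list \<Rightarrow> (nat \<Rightarrow> bool) \<Rightarrow> (nat \<Rightarrow> nat \<Rightarrow> bool) \<Rightarrow> nat \<Rightarrow> nat \<Rightarrow> nat \<Rightarrow> nat set \<Rightarrow> bool" where
  "origin us k \<omega> t j h F \<longleftrightarrow> (\<exists>\<tau><t. us ! \<tau> = j \<and> \<omega> \<tau> 0 \<and> clock k \<tau> = h \<and>
     F \<subseteq> {l. \<exists>\<tau>'. \<tau> \<le> \<tau>' \<and> \<tau>' < t \<and> us ! \<tau>' = j \<and> \<omega> \<tau>' (Suc l)})"

text \<open>Freezing can only make the stored counters lag behind. As long as the ideal counters are
  below \<open>B\<close>, no freezing has happened and the stored ones are exact.\<close>

lemma run_counters:
  assumes "run us k \<omega> t = (S, T, E)"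
  shows "S \<le> samples \<omega> t" "T \<le> clock k t"
    "samples \<omega> t < B \<Longrightarrow> clock k t < B \<Longrightarrow> S = samples \<omega> t \<and> T = clock k t"
proof -
  have "S \<le> samples \<omega> t \<and> T \<le> clock k t \<and> (samples \<omega> t < B \<longrightarrow> clock k t < B \<longrightarrow> S = samples \<omega> t \<and> T = clock k t)"
    using assms
  proof (induction t arbitrary: S T E)
    case 0 then show ?case by (simp add: samples_def clock_def)
  next
    case (Suc t)
    obtain S' T' E' where r: "run us k \<omega> t = (S', T', E')" by (cases "run us k \<omega> t")
    from Suc.IH[OF r] Suc.prems show ?case
      by (auto simp: r samples_Suc clock_Suc split: if_splits)
  qed
  then show "S \<le> samples \<omega> t" "T \<le> clock k t"
    "samples \<omega> t < B \<Longrightarrow> clock k t < B \<Longrightarrow> S = samples \<omega> t \<and> T = clock k t" by auto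
qed

text \<open>Freezing, eviction and the limit \<open>cap\<close> all lose samples and never invent
  any, so this also holds beyond the budget.\<close>

lemma run_hits:
  assumes "run us k \<omega> t = (S, T, E)" "E j = Some (h, F, c)"
  shows "c \<le> hits us \<omega> j t"
  using assms
proof (induction t arbitrary: S T E h F c)
  case 0 then show ?case by auto
next
  case (Suc t)
  obtain S' T' E' where r: "run us k \<omega> t = (S', T', E')" by (cases "run us k \<omega> t")
  show ?case
  proof (cases "B \<le> S' \<or> B \<le> T'")
    case True
    then show ?thesis using Suc.prems Suc.IH[OF r, of h F c] by (auto simp: r hits_Suc)
  next
    case False
    let ?G = "{l. l < Lf \<and> \<omega> t (Suc l)}"
    have "process T' (us ! t) (\<omega> t 0) ?G E' j = Some (h, F, c)"
      using Suc.prems False by (auto simp: r split: if_splits dest: prune_Some)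
    then show ?thesis
      using Suc.IH[OF r]
      by (fastforce simp: process_def mark_def hold_def hits_Suc split: option.splits if_splits prod.splits)
  qed
qed

text \<open>The rivals of an item can only be bounded if everything that is held is explained by
  coins. Staying within the budget makes the recorded start value the true clock value of the
  starting update.\<close>

lemma run_origin:
  assumes "run us k \<omega> t = (S, T, E)" "E j = Some (h, F, c)" "samples \<omega> t < B" "clock k t < B"
  shows "origin us k \<omega> t j h F"
  using assms
proof (induction t arbitrary: S T E h F c)
  case 0 then show ?case by auto
next
  case (Suc t)
  obtain S' T' E' where r: "run us k \<omega> t = (S', T', E')" by (cases "run us k \<omega> t")
  have b: "samples \<omega> t < B" "clock k t < B"
    using Suc.prems by (simp_all add: samples_Suc clock_Suc split: if_splits)
  have ST: "S' = samples \<omega> t" "T' = clock k t" using run_counters(3)[OF r b] by auto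
  let ?G = "{l. l < Lf \<and> \<omega> t (Suc l)}"
  have e: "process T' (us ! t) (\<omega> t 0) ?G E' j = Some (h, F, c)"
    using Suc.prems b by (auto simp: r ST split: if_splits dest: prune_Some)
  have cases': "(\<exists>F' c'. E' j = Some (h, F', c') \<and> F \<subseteq> F' \<union> (if j = us ! t then ?G else {}))
    \<or> \<omega> t 0 \<and> j = us ! t \<and> h = T' \<and> F \<subseteq> ?G"
    using e by (auto simp: process_def mark_def hold_def split: option.splits if_splits prod.splits)
  then show ?case
  proof (elim disjE exE conjE)
    fix F' c' assume *: "E' j = Some (h, F', c')" "F \<subseteq> F' \<union> (if j = us ! t then ?G else {})"
    from Suc.IH[OF r *(1) b] obtain \<tau> where \<tau>: "\<tau> < t" "us ! \<tau> = j" "\<omega> \<tau> 0" "clock k \<tau> = h"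
      "F' \<subseteq> {l. \<exists>\<tau>'. \<tau> \<le> \<tau>' \<and> \<tau>' < t \<and> us ! \<tau>' = j \<and> \<omega> \<tau>' (Suc l)}"
      by (auto simp: origin_def)
    have "F \<subseteq> {l. \<exists>\<tau>'. \<tau> \<le> \<tau>' \<and> \<tau>' < Suc t \<and> us ! \<tau>' = j \<and> \<omega> \<tau>' (Suc l)}"
    proof
      fix l assume "l \<in> F"
      then consider "l \<in> F'" | "us ! t = j" "\<omega> t (Suc l)" using *(2) by (auto split: if_splits)
      then show "l \<in> {l. \<exists>\<tau>'. \<tau> \<le> \<tau>' \<and> \<tau>' < Suc t \<and> us ! \<tau>' = j \<and> \<omega> \<tau>' (Suc l)}"
      proof cases
        case 1
        with \<tau>(5) obtain \<tau>' where "\<tau> \<le> \<tau>'" "\<tau>' < t" "us ! \<tau>' = j" "\<omega> \<tau>' (Suc l)" by blast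
        then show ?thesis by (intro CollectI exI[of _ \<tau>']) simp
      next
        case 2
        then show ?thesis using \<tau>(1) by (intro CollectI exI[of _ t]) simp
      qed
    qed
    then show ?thesis unfolding origin_def using \<tau> less_SucI by blast
  next
    assume "\<omega> t 0" "j = us ! t" "h = T'" "F \<subseteq> ?G"
    then show ?thesis unfolding origin_def by (intro exI[of _ t]) (auto simp: ST)
  qed
qed

text \<open>For fixed \<open>z\<close> the blocks partition the stream, and they are determined by
  the ticks alone.\<close>

definition block :: "(nat \<Rightarrow> bool) \<Rightarrow> nat \<Rightarrow> nat \<Rightarrow> nat \<Rightarrow> nat set" where
  "block k m z t = {\<tau>. \<tau> < m \<and> clock k \<tau> div 2 ^ z = clock k t div 2 ^ z}"

definition first_hit :: "nat list \<Rightarrow> (nat \<Rightarrow> nat \<Rightarrow> bool) \<Rightarrow> nat \<Rightarrow> nat \<Rightarrow> bool" where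
  "first_hit us \<omega> i t \<longleftrightarrow> us ! t = i \<and> \<omega> t 0 \<and> (\<forall>x<t. us ! x = i \<longrightarrow> \<not> \<omega> x 0)"

text \<open>An over-approximation of the rivals that refers neither to the state nor to the order of
  the two updates, so that its size is bounded by a sum over pairs of coin events.\<close>

definition competitors :: "nat list \<Rightarrow> (nat \<Rightarrow> nat \<Rightarrow> bool) \<Rightarrow> nat set \<Rightarrow> nat \<Rightarrow> nat \<Rightarrow> nat set" where
  "competitors us \<omega> W i l = {j. j \<noteq> i \<and> (\<exists>\<tau>\<in>W. \<exists>\<tau>'\<in>W. us ! \<tau> = j \<and> us ! \<tau>' = j \<and> \<omega> \<tau> 0 \<and> \<omega> \<tau>' (Suc l))}"

definition flagged :: "nat list \<Rightarrow> (nat \<Rightarrow> nat \<Rightarrow> bool) \<Rightarrow> nat set \<Rightarrow> nat \<Rightarrow> nat \<Rightarrow> nat \<Rightarrow> bool" where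
  "flagged us \<omega> W i t l \<longleftrightarrow> (\<exists>\<tau>\<in>W. t \<le> \<tau> \<and> us ! \<tau> = i \<and> \<omega> \<tau> (Suc l))"

text \<open>The deterministic half of the analysis: coin events under which \<open>i\<close> is held
  from its first sample to the end, with an exact count. At \<open>t0\<close> there is room for it.
  A cleanup can concern it only at the end of a dyadic interval that contains its start value, and
  by then the whole block has passed, so the flag promised by \<open>scales\<close> is already
  recorded.\<close>

lemma run_survives:
  fixes us :: "nat list"
  defines "m \<equiv> length us"
  assumes budget: "samples \<omega> m < B" "clock k m < B"
    and first: "t0 < m" "first_hit us \<omega> i t0"
    and leaf: "card {\<tau>. \<tau> < t0 \<and> us ! \<tau> \<noteq> i \<and> \<omega> \<tau> 0 \<and> clock k \<tau> = clock k t0} < cap"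
    and scales: "\<And>z. 2 ^ z \<le> B \<Longrightarrow> \<exists>l<Lf. flagged us \<omega> (block k m z t0) i t0 l \<and>
      card (competitors us \<omega> (block k m z t0) i l) < \<kappa>"
    and run: "run us k \<omega> m = (S, T, E)"
  shows "\<exists>F. E i = Some (clock k t0, F, hits us \<omega> i m)"
proof -
  have bud: "samples \<omega> t < B" "clock k t < B" if "t \<le> m" for t
  proof -
    have "samples \<omega> t \<le> samples \<omega> m" unfolding samples_def by (rule card_mono) (use that in auto)
    then show "samples \<omega> t < B" using budget by simp
    show "clock k t < B" using clock_mono[OF that, of k] budget by simp
  qed
  define Fl where "Fl t = {l. l < Lf \<and> (\<exists>\<tau>. t0 \<le> \<tau> \<and> \<tau> < t \<and> us ! \<tau> = i \<and> \<omega> \<tau> (Suc l))}" for t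
  have hits0: "hits us \<omega> i t = 0" if "t \<le> t0" for t
    using first(2) that by (auto simp: hits_def first_hit_def)
  have FlSuc: "Fl (Suc t) = Fl t \<union> (if us ! t = i then {l. l < Lf \<and> \<omega> t (Suc l)} else {})" if "t0 \<le> t" for t
    using that by (auto simp: Fl_def less_Suc_eq)
  have Fl0: "Fl t0 = {}" by (auto simp: Fl_def)
  have main: "t \<le> m \<Longrightarrow> run us k \<omega> t = (S, T, E) \<Longrightarrow>
     (if t \<le> t0 then E i = None else E i = Some (clock k t0, Fl t, hits us \<omega> i t))" for t S T E
  proof (induction t arbitrary: S T E)
    case 0 then show ?case by auto
  next
    case (Suc t)
    obtain S' T' E' where r: "run us k \<omega> t = (S', T', E')" by (cases "run us k \<omega> t")
    have tm: "t \<le> m" "t < m" using Suc.prems by auto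
    have ST: "S' = samples \<omega> t" "T' = clock k t" using run_counters(3)[OF r bud[OF tm(1)]] by auto
    let ?G = "{l. l < Lf \<and> \<omega> t (Suc l)}"
    let ?P = "process T' (us ! t) (\<omega> t 0) ?G E'"
    have step: "run us k \<omega> (Suc t) = ((if \<omega> t 0 then Suc S' else S'), (if k t then Suc T' else T'),
            (if k t then prune (Suc T') else id) ?P)"
      using bud[OF tm(1)] by (simp add: r ST)
    have E: "E = (if k t then prune (Suc T') ?P else ?P)"
      using trans[OF step[symmetric] Suc.prems(2)] by (cases "k t") auto
    note IH = Suc.IH[OF tm(1) r]
    show ?case
    proof (cases "Suc t \<le> t0")
      case True
      then have "us ! t = i \<longrightarrow> \<not> \<omega> t 0" using first(2) by (auto simp: first_hit_def)
      moreover have "E' i = None" using IH True by simp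
      ultimately have "?P i = None"
        by (auto simp: process_def mark_def hold_def split: option.splits)
      then have "E i = None" unfolding E by (auto simp: prune_def restrict_map_def)
      then show ?thesis using True by simp
    next
      case False
      then have t0: "t0 \<le> t" by simp
      have P: "?P i = Some (clock k t0, Fl (Suc t), hits us \<omega> i (Suc t))"
      proof (cases "t = t0")
        case True
        have i: "us ! t = i" "\<omega> t 0" using first(2) True by (auto simp: first_hit_def)
        have none: "E' i = None" using IH True by simp
        have fin: "finite {\<tau>. \<tau> < t0 \<and> us ! \<tau> \<noteq> i \<and> \<omega> \<tau> 0 \<and> clock k \<tau> = clock k t0}" by simp
        \<comment> \<open>Different items that started at this clock value stem from different
          sampled updates, and these are what \<open>leaf\<close> counts.\<close>
        have "held_if E' (\<lambda>h. h = T') \<subseteq> (\<lambda>\<tau>. us ! \<tau>) ` {\<tau>. \<tau> < t0 \<and> us ! \<tau> \<noteq> i \<and> \<omega> \<tau> 0 \<and> clock k \<tau> = clock k t0}"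
        proof
          fix j assume "j \<in> held_if E' (\<lambda>h. h = T')"
          then obtain F c where e: "E' j = Some (T', F, c)" by (auto simp: held_if_def)
          from run_origin[OF r e bud[OF tm(1)]] obtain \<tau> where \<tau>: "\<tau> < t" "us ! \<tau> = j" "\<omega> \<tau> 0" "clock k \<tau> = T'"
            by (auto simp: origin_def)
          have "j \<noteq> i" using e none by auto
          then show "j \<in> (\<lambda>\<tau>. us ! \<tau>) ` {\<tau>. \<tau> < t0 \<and> us ! \<tau> \<noteq> i \<and> \<omega> \<tau> 0 \<and> clock k \<tau> = clock k t0}"
            using \<tau> True ST by (intro image_eqI[of _ _ \<tau>]) auto
        qed
        then have "card (held_if E' (\<lambda>h. h = T')) < cap"
          by (rule le_less_trans[OF surj_card_le[OF fin] leaf])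
        then show ?thesis
          using i none hits0[of t] Fl0 FlSuc[OF t0] True
          by (simp add: process_def hold_def mark_def hits_Suc ST)
      next
        case False
        then have e: "E' i = Some (clock k t0, Fl t, hits us \<omega> i t)" using IH t0 by simp
        then show ?thesis using FlSuc[OF t0]
          by (auto simp: process_def hold_def mark_def hits_Suc split: option.splits)
      qed
      show ?thesis
      proof (cases "k t")
        case False
        then show ?thesis using P t0 unfolding E by simp
      next
        case True
        have "prune (Suc T') ?P i = ?P i"
        proof -
          \<comment> \<open>Only cleanups of intervals that contain the start value of
            \<open>i\<close> can evict it.\<close>
          have "\<exists>l\<in>Fl (Suc t). card (rivals ?P (Suc T') z l) \<le> \<kappa>"
            if z: "2 ^ z dvd Suc T'" "Suc T' \<le> clock k t0 + 2 ^ z" for z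
          proof -
            obtain a where a: "Suc T' = a * 2 ^ z" using z(1) by (metis dvdE mult.commute)
            have cl: "clock k (Suc t) = Suc T'" using True ST by (simp add: clock_Suc)
            have "Suc T' \<le> B" using bud[of "Suc t"] Suc.prems(1) cl by simp
            then have "2 ^ z \<le> B" using dvd_imp_le[OF z(1)] by simp
            from scales[OF this] obtain l where l: "l < Lf" "flagged us \<omega> (block k m z t0) i t0 l"
              "card (competitors us \<omega> (block k m z t0) i l) < \<kappa>" by auto
            obtain b where "a = Suc b" using a by (cases a) auto
            then have aS: "Suc T' = b * 2 ^ z + 2 ^ z" using a by simp
            have ct0: "clock k t0 \<le> T'" using clock_mono[OF t0, of k] ST by simp
            have dv: "x div 2 ^ z = b" if "Suc T' \<le> x + 2 ^ z" "x \<le> T'" for x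
            proof (rule div_nat_eqI)
              show "2 ^ z * b \<le> x" using that(1) aS by (simp add: mult.commute)
              show "x < 2 ^ z * Suc b" using that(2) aS by (simp add: mult.commute)
            qed
            \<comment> \<open>The block is defined with all ticks of the stream. The tick at
              \<open>t\<close> closes its interval, so it nevertheless consists of past updates
              only.\<close>
            have blk: "\<tau> \<in> block k m z t0 \<longleftrightarrow> \<tau> \<le> t \<and> Suc T' \<le> clock k \<tau> + 2 ^ z" if "\<tau> < m" for \<tau>
            proof
              assume *: "\<tau> \<le> t \<and> Suc T' \<le> clock k \<tau> + 2 ^ z"
              then have "clock k \<tau> \<le> T'" using clock_mono[of \<tau> t k] ST by simp
              then show "\<tau> \<in> block k m z t0" using dv[of "clock k \<tau>"] dv[of "clock k t0"] * z(2) ct0 that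
                by (simp add: block_def)
            next
              assume "\<tau> \<in> block k m z t0"
              then have d: "clock k \<tau> div 2 ^ z = b" using dv[of "clock k t0"] z(2) ct0 by (simp add: block_def)
              have lo: "b * 2 ^ z \<le> clock k \<tau>" using d by (metis div_times_less_eq_dividend)
              have "clock k \<tau> < b * 2 ^ z + 2 ^ z" using d dividend_less_div_times[of "2 ^ z" "clock k \<tau>"] by simp
              also have "\<dots> = Suc T'" using aS by simp
              finally have "clock k \<tau> < clock k (Suc t)" using cl by simp
              then have "\<tau> \<le> t" using clock_mono[of "Suc t" \<tau> k] by (meson leD not_less_eq_eq)
              moreover have "Suc T' \<le> clock k \<tau> + 2 ^ z"
                using lo aS by simp
              ultimately show "\<tau> \<le> t \<and> Suc T' \<le> clock k \<tau> + 2 ^ z" by simp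
            qed
            have "l \<in> Fl (Suc t)"
            proof -
              obtain \<tau> where \<tau>: "\<tau> \<in> block k m z t0" "t0 \<le> \<tau>" "us ! \<tau> = i" "\<omega> \<tau> (Suc l)"
                using l(2) by (auto simp: flagged_def)
              then have "\<tau> \<le> t" using blk[of \<tau>] by (simp add: block_def)
              then show ?thesis using \<tau> l(1) by (auto simp: Fl_def)
            qed
            moreover have "card (rivals ?P (Suc T') z l) \<le> \<kappa>"
            proof -
              \<comment> \<open>\<open>i\<close> is a rival of itself; the strict inequality in
                \<open>scales\<close> leaves room for it.\<close>
              have "rivals ?P (Suc T') z l \<subseteq> insert i (competitors us \<omega> (block k m z t0) i l)"
              proof
                fix j assume "j \<in> rivals ?P (Suc T') z l"
                then obtain h F c where e: "?P j = Some (h, F, c)" "Suc T' \<le> h + 2 ^ z" "l \<in> F"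
                  by (auto simp: rivals_def)
                have "origin us k \<omega> (Suc t) j h F"
                proof -
                  \<comment> \<open>\<open>?P\<close> is the state after processing and before the
                    cleanup. It is the outcome of a run whose tick at \<open>t\<close> is switched
                    off, so \<open>run_origin\<close> can be applied to that run; the clock up to
                    \<open>t\<close> is the same.\<close>
                  let ?k = "k(t := False)"
                  have "run us ?k \<omega> t' = run us k \<omega> t'" if "t' \<le> t" for t' using that by (induction t') auto
                  then have "run us ?k \<omega> (Suc t) = ((if \<omega> t 0 then Suc S' else S'), T', ?P)"
                    using bud[OF tm(1)] by (simp add: r ST)
                  moreover have ck: "clock ?k x = clock k x" if "x \<le> t" for x
                    unfolding clock_def using that by (intro arg_cong[where f = card]) auto
                  then have "clock ?k (Suc t) < B" using bud[OF tm(1)] by (simp add: clock_Suc)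
                  ultimately have "origin us ?k \<omega> (Suc t) j h F"
                    using run_origin[of us ?k \<omega> "Suc t"] e(1) bud[of "Suc t"] Suc.prems(1) by blast
                  then show ?thesis using ck by (auto simp: origin_def less_Suc_eq_le)
                qed
                then obtain \<tau> \<tau>' where \<tau>: "\<tau> < Suc t" "us ! \<tau> = j" "\<omega> \<tau> 0" "clock k \<tau> = h"
                  "\<tau> \<le> \<tau>'" "\<tau>' < Suc t" "us ! \<tau>' = j" "\<omega> \<tau>' (Suc l)"
                  using e(3) by (auto simp: origin_def)
                have "clock k \<tau> \<le> clock k \<tau>'" using clock_mono \<tau> by blast
                then have "\<tau> \<in> block k m z t0" "\<tau>' \<in> block k m z t0"
                  using \<tau> e(2) blk tm(2) by auto
                then show "j \<in> insert i (competitors us \<omega> (block k m z t0) i l)"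
                  using \<tau> by (auto simp: competitors_def)
              qed
              moreover have "finite (competitors us \<omega> (block k m z t0) i l)"
              proof (rule finite_subset)
                show "competitors us \<omega> (block k m z t0) i l \<subseteq> (\<lambda>\<tau>. us ! \<tau>) ` {..<m}"
                  by (auto simp: competitors_def block_def)
              qed simp
              ultimately have "card (rivals ?P (Suc T') z l) \<le> card (insert i (competitors us \<omega> (block k m z t0) i l))"
                by (intro card_mono) auto
              also have "\<dots> \<le> Suc (card (competitors us \<omega> (block k m z t0) i l))"
                by (rule card_insert_le_m1) auto
              finally show ?thesis using l(3) by simp
            qed
            ultimately show ?thesis by blast
          qed
          then have "i \<in> {j. \<forall>h F c z. ?P j = Some (h, F, c) \<longrightarrow> 2 ^ z dvd Suc T' \<longrightarrow> Suc T' \<le> h + 2 ^ z \<longrightarrow>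
            (\<exists>l\<in>F. card (rivals ?P (Suc T') z l) \<le> \<kappa>)}"
            unfolding mem_Collect_eq P by blast
          then show ?thesis unfolding prune_def by (rule restrict_in)
        qed
        then show ?thesis using P t0 True unfolding E by simp
      qed
    qed
  qed
  from main[OF order_refl run] first(1) show ?thesis by auto
qed

end

section \<open>Bounds on probabilities\<close>

lemma prob_bind_le:
  assumes "\<And>x. x \<in> set_pmf p \<Longrightarrow> measure_pmf.prob (f x) S \<le> c" "0 \<le> c"
  shows "measure_pmf.prob (bind_pmf p f) S \<le> c"
proof -
  have "emeasure (bind_pmf p f) S = (\<integral>\<^sup>+x. emeasure (f x) S \<partial>p)" by simp
  also have "\<dots> \<le> (\<integral>\<^sup>+x. ennreal c \<partial>p)"
    using assms by (intro nn_integral_mono_AE AE_pmfI) (simp add: measure_pmf.emeasure_eq_measure)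
  also have "\<dots> = ennreal c" by simp
  finally show ?thesis using assms(2) by (simp add: measure_pmf.emeasure_eq_measure)
qed

lemma prob_pair_le:
  assumes "\<And>x. x \<in> set_pmf p \<Longrightarrow> measure_pmf.prob q {y. P x y} \<le> c" "0 \<le> c"
  shows "measure_pmf.prob (pair_pmf p q) {(x, y). P x y} \<le> c"
proof -
  have eq: "pair_pmf p q = bind_pmf p (\<lambda>x. map_pmf (Pair x) q)"
    by (simp add: pair_pmf_def map_pmf_def)
  show ?thesis unfolding eq using assms by (intro prob_bind_le) (auto simp: vimage_def)
qed

lemma prob_pair_Times:
  "measure_pmf.prob (pair_pmf p q) (A \<times> C) = measure_pmf.prob p A * measure_pmf.prob q C"
proof -
  have "measure_pmf.prob (pair_pmf p q) (A \<times> C) =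
    measure_pmf.prob (pair_pmf p q) ((A \<inter> set_pmf p) \<times> (C \<inter> set_pmf q))"
    by (rule measure_pmf.finite_measure_eq_AE) (auto simp: AE_measure_pmf_iff)
  also have "\<dots> = measure_pmf.prob p (A \<inter> set_pmf p) * measure_pmf.prob q (C \<inter> set_pmf q)"
    by (rule measure_pmf_prob_product) auto
  finally show ?thesis by (simp add: measure_Int_set_pmf)
qed

lemma prob_mono: "(\<And>x. x \<in> set_pmf p \<Longrightarrow> P x \<Longrightarrow> Q x) \<Longrightarrow>
  measure_pmf.prob p {x. P x} \<le> measure_pmf.prob p {x. Q x}"
  by (rule measure_pmf.finite_measure_mono_AE) (auto simp: AE_measure_pmf_iff)

lemma prob_Ex_le:
  assumes "finite X"
  shows "measure_pmf.prob p {\<omega>. \<exists>x\<in>X. R x \<omega>} \<le> (\<Sum>x\<in>X. measure_pmf.prob p {\<omega>. R x \<omega>})"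
proof -
  have "{\<omega>. \<exists>x\<in>X. R x \<omega>} = (\<Union>x\<in>X. {\<omega>. R x \<omega>})" by auto
  then show ?thesis using measure_pmf.finite_measure_subadditive_finite[OF assms, of "\<lambda>x. {\<omega>. R x \<omega>}" p] by auto
qed

lemma prob_or_le: "measure_pmf.prob p {\<omega>. P \<omega> \<or> Q \<omega>} \<le> measure_pmf.prob p {\<omega>. P \<omega>} + measure_pmf.prob p {\<omega>. Q \<omega>}"
proof -
  have "{\<omega>. P \<omega> \<or> Q \<omega>} = {\<omega>. P \<omega>} \<union> {\<omega>. Q \<omega>}" by auto
  then show ?thesis using measure_Un_le[of "{\<omega>. P \<omega>}" p "{\<omega>. Q \<omega>}"] by simp
qed

text \<open>Markov's inequality inside the event \<open>Q\<close>. Keeping \<open>Q\<close> in the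
  joint probabilities is what later allows a summation over all possible first hits of an
  item.\<close>

lemma prob_count_le:
  fixes c :: real
  assumes "finite X" "c > 0"
  shows "measure_pmf.prob p {\<omega>. Q \<omega> \<and> c \<le> real (card {x\<in>X. R x \<omega>})}
    \<le> (\<Sum>x\<in>X. measure_pmf.prob p {\<omega>. Q \<omega> \<and> R x \<omega>}) / c"
proof -
  let ?I = "\<lambda>P \<omega>. indicator {\<omega>. P \<omega>} \<omega> :: real"
  have int: "integrable (measure_pmf p) (?I P)" for P
    by (rule measure_pmf.integrable_const_bound[where B=1]) auto
  have "c * measure_pmf.prob p {\<omega>. Q \<omega> \<and> c \<le> real (card {x\<in>X. R x \<omega>})} =
    measure_pmf.expectation p (\<lambda>\<omega>. c * ?I (\<lambda>\<omega>. Q \<omega> \<and> c \<le> real (card {x\<in>X. R x \<omega>})) \<omega>)"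
    by simp
  also have "\<dots> \<le> measure_pmf.expectation p (\<lambda>\<omega>. \<Sum>x\<in>X. ?I (\<lambda>\<omega>. Q \<omega> \<and> R x \<omega>) \<omega>)"
  proof (rule integral_mono)
    show "integrable (measure_pmf p) (\<lambda>\<omega>. c * ?I (\<lambda>\<omega>. Q \<omega> \<and> c \<le> real (card {x\<in>X. R x \<omega>})) \<omega>)"
      using int by (intro integrable_mult_right) auto
    show "integrable (measure_pmf p) (\<lambda>\<omega>. \<Sum>x\<in>X. ?I (\<lambda>\<omega>. Q \<omega> \<and> R x \<omega>) \<omega>)"
      using int by (intro Bochner_Integration.integrable_sum) auto
    fix \<omega>
    have "real (card {x\<in>X. R x \<omega>}) = (\<Sum>x\<in>X. if R x \<omega> then 1 else 0)"
      using assms(1) by (simp add: sum.If_cases Int_def)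
    then show "c * ?I (\<lambda>\<omega>. Q \<omega> \<and> c \<le> real (card {x\<in>X. R x \<omega>})) \<omega> \<le> (\<Sum>x\<in>X. ?I (\<lambda>\<omega>. Q \<omega> \<and> R x \<omega>) \<omega>)"
      by (cases "Q \<omega>") (auto simp: indicator_def of_bool_def)
  qed
  also have "\<dots> = (\<Sum>x\<in>X. measure_pmf.prob p {\<omega>. Q \<omega> \<and> R x \<omega>})"
    using int by (subst Bochner_Integration.integral_sum) auto
  finally show ?thesis using assms(2) by (simp add: field_simps)
qed

lemma prob_markov:
  fixes f :: "'a \<Rightarrow> real"
  assumes "integrable (measure_pmf p) f" "\<And>x. x \<in> set_pmf p \<Longrightarrow> 0 \<le> f x" "c > 0"
  shows "measure_pmf.prob p {x. c \<le> f x} \<le> measure_pmf.expectation p f / c"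
proof -
  have "c * measure_pmf.prob p {x. c \<le> f x} = measure_pmf.expectation p (\<lambda>x. c * indicator {x. c \<le> f x} x)"
    by simp
  also have "\<dots> \<le> measure_pmf.expectation p f"
  proof (rule integral_mono_AE)
    show "integrable (measure_pmf p) (\<lambda>x. c * indicator {x. c \<le> f x} x)"
      by (intro integrable_mult_right measure_pmf.integrable_const_bound[where B=1]) auto
  qed (use assms in \<open>auto simp: indicator_def AE_measure_pmf_iff\<close>)
  finally show ?thesis using assms(3) by (simp add: field_simps)
qed

section \<open>Tables of independent coins\<close>

definition bit_table :: "nat \<Rightarrow> nat \<Rightarrow> (nat \<Rightarrow> nat \<Rightarrow> real) \<Rightarrow> (nat \<Rightarrow> nat \<Rightarrow> bool) pmf" where
  "bit_table m K r = Pi_pmf {..<m} (\<lambda>_. False) (\<lambda>t. Pi_pmf {..K} False (\<lambda>x. bernoulli_pmf (r t x)))"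

lemma prod_if_sub:
  fixes g h :: "'a \<Rightarrow> real"
  assumes "finite I" "A \<subseteq> I" "N \<subseteq> I" "A \<inter> N = {}"
  shows "(\<Prod>x\<in>I. if x \<in> A then g x else if x \<in> N then h x else 1) = (\<Prod>x\<in>A. g x) * (\<Prod>x\<in>N. h x)"
proof -
  have "(\<Prod>x\<in>I. if x \<in> A then g x else if x \<in> N then h x else 1) =
    (\<Prod>x\<in>A \<union> N. if x \<in> A then g x else if x \<in> N then h x else 1)"
    using assms by (intro prod.mono_neutral_right) auto
  also have "\<dots> = (\<Prod>x\<in>A. if x \<in> A then g x else if x \<in> N then h x else 1) *
    (\<Prod>x\<in>N. if x \<in> A then g x else if x \<in> N then h x else 1)"
    using assms finite_subset by (intro prod.union_disjoint) auto
  also have "\<dots> = (\<Prod>x\<in>A. g x) * (\<Prod>x\<in>N. h x)"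
    using assms by (intro arg_cong2[where f="(*)"] prod.cong) auto
  finally show ?thesis .
qed

lemma prob_bit_table:
  assumes "A \<subseteq> {..<m} \<times> {..K}" "N \<subseteq> {..<m} \<times> {..K}" "A \<inter> N = {}"
    and r: "\<And>t x. 0 \<le> r t x" "\<And>t x. r t x \<le> 1"
  shows "measure_pmf.prob (bit_table m K r) {\<omega>. (\<forall>(t, x)\<in>A. \<omega> t x) \<and> (\<forall>(t, x)\<in>N. \<not> \<omega> t x)} =
    (\<Prod>(t, x)\<in>A. r t x) * (\<Prod>(t, x)\<in>N. 1 - r t x)"
proof -
  define Q where "Q t x = (if (t, x) \<in> A then {True} else if (t, x) \<in> N then {False} else UNIV)" for t x
  have Q: "{\<omega>. (\<forall>(t, x)\<in>A. \<omega> t x) \<and> (\<forall>(t, x)\<in>N. \<not> \<omega> t x)} = Pi {..<m} (\<lambda>t. Pi {..K} (Q t))"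
  proof (intro equalityI subsetI)
    fix \<omega> assume "\<omega> \<in> {\<omega>. (\<forall>(t, x)\<in>A. \<omega> t x) \<and> (\<forall>(t, x)\<in>N. \<not> \<omega> t x)}"
    then show "\<omega> \<in> Pi {..<m} (\<lambda>t. Pi {..K} (Q t))" by (auto simp: Q_def)
  next
    fix \<omega> assume *: "\<omega> \<in> Pi {..<m} (\<lambda>t. Pi {..K} (Q t))"
    have **: "\<omega> t x \<in> Q t x" if "(t, x) \<in> A \<union> N" for t x
      using * that assms(1,2) by (auto simp: Pi_def)
    have "\<omega> t x" if "(t, x) \<in> A" for t x using **[of t x] that by (simp add: Q_def)
    moreover have "\<not> \<omega> t x" if "(t, x) \<in> N" for t x
      using **[of t x] that assms(3) by (auto simp: Q_def split: if_splits)
    ultimately show "\<omega> \<in> {\<omega>. (\<forall>(t, x)\<in>A. \<omega> t x) \<and> (\<forall>(t, x)\<in>N. \<not> \<omega> t x)}" by auto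
  qed
  have single: "measure_pmf.prob (bernoulli_pmf (r t x)) (Q t x) =
    (if (t, x) \<in> A then r t x else if (t, x) \<in> N then 1 - r t x else 1)" for t x
    using r by (simp add: Q_def measure_pmf_single)
  have "measure_pmf.prob (bit_table m K r) (Pi {..<m} (\<lambda>t. Pi {..K} (Q t))) =
     (\<Prod>t<m. \<Prod>x\<le>K. if (t, x) \<in> A then r t x else if (t, x) \<in> N then 1 - r t x else 1)"
    unfolding bit_table_def by (simp add: measure_Pi_pmf_Pi single)
  also have "\<dots> = (\<Prod>z\<in>{..<m} \<times> {..K}. if z \<in> A then (case z of (t, x) \<Rightarrow> r t x)
      else if z \<in> N then (case z of (t, x) \<Rightarrow> 1 - r t x) else 1)"
    by (subst prod.cartesian_product) (auto intro!: prod.cong)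
  also have "\<dots> = (\<Prod>(t, x)\<in>A. r t x) * (\<Prod>(t, x)\<in>N. 1 - r t x)"
    by (rule prod_if_sub) (use assms in auto)
  finally show ?thesis by (simp only: Q)
qed

lemma prob_bits_off:
  fixes m :: nat
  assumes "N \<subseteq> {..<m}" and r: "\<And>t. 0 \<le> r t" "\<And>t. r t \<le> 1"
  shows "measure_pmf.prob (Pi_pmf {..<m} False (\<lambda>t. bernoulli_pmf (r t))) {k. \<forall>t\<in>N. \<not> k t} = (\<Prod>t\<in>N. 1 - r t)"
proof -
  have "{k. \<forall>t\<in>N. \<not> k t} = Pi {..<m} (\<lambda>t. if t \<in> N then {False} else UNIV)"
    using assms(1) by (auto simp: Pi_def split: if_splits)
  moreover have "measure_pmf.prob (bernoulli_pmf (r t)) (if t \<in> N then {False} else UNIV) =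
    (if t \<in> N then 1 - r t else 1)" for t
    using r by (simp add: measure_pmf_single)
  ultimately have "measure_pmf.prob (Pi_pmf {..<m} False (\<lambda>t. bernoulli_pmf (r t))) {k. \<forall>t\<in>N. \<not> k t} =
    (\<Prod>t<m. if t \<in> N then 1 - r t else 1)"
    by (simp add: measure_Pi_pmf_Pi)
  also have "\<dots> = (\<Prod>t\<in>N. 1 - r t)"
    using assms(1) by (subst prod.inter_restrict[symmetric]) (auto simp: Int_absorb1)
  finally show ?thesis .
qed

lemma prob_bit_on:
  fixes m :: nat
  assumes "t < m" and r: "\<And>t. 0 \<le> r t" "\<And>t. r t \<le> 1"
  shows "measure_pmf.prob (Pi_pmf {..<m} False (\<lambda>t. bernoulli_pmf (r t))) {k. k t} = r t"
proof -
  have "measure_pmf.prob (Pi_pmf {..<m} False (\<lambda>t. bernoulli_pmf (r t))) {k. k t} =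
    measure_pmf.prob (map_pmf (\<lambda>k. k t) (Pi_pmf {..<m} False (\<lambda>t. bernoulli_pmf (r t)))) {True}"
    by (simp add: vimage_def)
  also have "\<dots> = r t" using assms by (subst Pi_pmf_component) (auto simp: measure_pmf_single)
  finally show ?thesis .
qed

text \<open>The moment generating function, with base \<open>y\<close> in place of an exponential.
  The choices \<open>y = 1 - \<eta>\<close> and \<open>y = 1 + \<eta>\<close> give the two Chernoff
  bounds for the number of hits.\<close>

lemma expectation_pow_hits:
  assumes "y \<ge> 0" and r: "\<And>t x. 0 \<le> r t x" "\<And>t x. r t x \<le> 1" and "X \<subseteq> {..<m}"
  shows "measure_pmf.expectation (bit_table m K r) (\<lambda>\<omega>. y ^ card {t\<in>X. \<omega> t 0}) = (\<Prod>t\<in>X. 1 - r t 0 + r t 0 * y)"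
    "integrable (measure_pmf (bit_table m K r)) (\<lambda>\<omega>. y ^ card {t\<in>X. \<omega> t 0})"
proof -
  define f where "f t c = (if t \<in> X then if c (0::nat) then y else 1 else 1)" for t :: nat and c
  have finX: "finite X" using assms(4) finite_subset by auto
  have pow: "y ^ card {t\<in>X. \<omega> t 0} = (\<Prod>t<m. f t (\<omega> t))" for \<omega>
  proof -
    have "(\<Prod>t<m. f t (\<omega> t)) = (\<Prod>t\<in>X. if \<omega> t 0 then y else 1)"
      using assms(4) unfolding f_def by (subst prod.inter_restrict[symmetric]) (auto simp: Int_absorb1)
    also have "\<dots> = y ^ card {t\<in>X. \<omega> t 0}" using finX by (simp add: prod.If_cases Int_def)
    finally show ?thesis by simp
  qed
  have int: "integrable (measure_pmf p) (f t)" for p t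
    by (rule measure_pmf.integrable_const_bound[where B="max y 1"]) (use assms in \<open>auto simp: f_def\<close>)
  show "integrable (measure_pmf (bit_table m K r)) (\<lambda>\<omega>. y ^ card {t\<in>X. \<omega> t 0})"
    unfolding pow bit_table_def using int by (intro integrable_prod_Pi_pmf) auto
  have E: "measure_pmf.expectation (Pi_pmf {..K} False (\<lambda>x. bernoulli_pmf (r t x))) (f t) =
    (if t \<in> X then 1 - r t 0 + r t 0 * y else 1)" for t
  proof (cases "t \<in> X")
    case True
    then have "f t = (\<lambda>b. if b then y else 1) \<circ> (\<lambda>c. c 0)" by (auto simp: f_def)
    then have "measure_pmf.expectation (Pi_pmf {..K} False (\<lambda>x. bernoulli_pmf (r t x))) (f t) =
      measure_pmf.expectation (map_pmf (\<lambda>c. c 0) (Pi_pmf {..K} False (\<lambda>x. bernoulli_pmf (r t x)))) (\<lambda>b. if b then y else 1)"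
      by (simp add: o_def)
    also have "\<dots> = 1 - r t 0 + r t 0 * y"
      using r by (subst Pi_pmf_component) (auto simp: algebra_simps)
    finally show ?thesis using True by simp
  next
    case False
    then have "f t = (\<lambda>c. 1)" by (auto simp: f_def)
    then show ?thesis using False by simp
  qed
  have "measure_pmf.expectation (bit_table m K r) (\<lambda>\<omega>. y ^ card {t\<in>X. \<omega> t 0}) =
    (\<Prod>t<m. if t \<in> X then 1 - r t 0 + r t 0 * y else 1)"
    unfolding pow bit_table_def using int assms(1)
    by (subst expectation_prod_Pi_pmf) (auto simp: E, auto simp: f_def)
  also have "\<dots> = (\<Prod>t\<in>X. 1 - r t 0 + r t 0 * y)"
    using assms(4) by (subst prod.inter_restrict[symmetric]) (auto simp: Int_absorb1)
  finally show "measure_pmf.expectation (bit_table m K r) (\<lambda>\<omega>. y ^ card {t\<in>X. \<omega> t 0}) = (\<Prod>t\<in>X. 1 - r t 0 + r t 0 * y)" .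
qed

section \<open>Random coins of sample and hold\<close>

lemma pow2_bracket:
  fixes x :: real
  assumes "1 \<le> x"
  shows "\<exists>l. 2 ^ l \<le> x \<and> x < 2 ^ Suc l"
proof -
  obtain L where L: "x < 2 ^ L" using real_arch_pow[of 2 x] by auto
  define l where "l = (LEAST l. x < 2 ^ Suc l)"
  have "x < 2 ^ Suc L" using L by (simp add: field_simps) (smt (verit) assms)
  then have 1: "x < 2 ^ Suc l" unfolding l_def by (rule LeastI)
  have "2 ^ l \<le> x"
  proof (cases l)
    case 0 then show ?thesis using assms by simp
  next
    case (Suc j)
    then have "\<not> x < 2 ^ Suc j" using not_less_Least[of j "\<lambda>l. x < 2 ^ Suc l"] by (simp add: l_def)
    then show ?thesis using Suc by simp
  qed
  then show ?thesis using 1 by blast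
qed

section \<open>Sums over blocks and over last successes\<close>

text \<open>Counted from the end, the elements have the ranks 1 to \<open>card A\<close>. Later the
  rank is the number of updates of an item that remain in its block.\<close>

lemma sum_inverse_rank:
  fixes A :: "nat set"
  assumes "finite A"
  shows "(\<Sum>t\<in>A. 1 / real (card {\<tau>\<in>A. t \<le> \<tau>})) = harm (card A)"
  using assms
proof (induction A rule: finite_linorder_min_induct)
  case empty then show ?case by (simp add: harm_def)
next
  case (insert b A)
  have 1: "{\<tau> \<in> insert b A. b \<le> \<tau>} = insert b A" using insert.hyps(2) by auto
  have 2: "{\<tau> \<in> insert b A. t \<le> \<tau>} = {\<tau>\<in>A. t \<le> \<tau>}" if "t \<in> A" for t
    using insert.hyps(2) that by auto
  have b: "b \<notin> A" using insert.hyps(2) by auto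
  have "(\<Sum>t\<in>insert b A. 1 / real (card {\<tau>\<in>insert b A. t \<le> \<tau>})) =
    1 / real (card (insert b A)) + (\<Sum>t\<in>A. 1 / real (card {\<tau>\<in>A. t \<le> \<tau>}))"
    using b insert.hyps(1) 1 2 by simp
  also have "\<dots> = harm (card (insert b A))"
    using b insert by (simp add: harm_Suc inverse_eq_divide)
  finally show ?case .
qed

text \<open>Within one block the inverse ranks sum to a harmonic number, and the pairs inside
  different blocks are disjoint. Thus a sum over all occurrences of an item costs a logarithm
  instead of their number.\<close>

lemma sum_blocks_le:
  fixes \<beta> :: "nat \<Rightarrow> nat" and g :: "nat \<Rightarrow> nat \<Rightarrow> real"
  assumes "Oc \<subseteq> {..<m}" and Y: "finite Y" and g: "\<And>\<tau> \<tau>'. 0 \<le> g \<tau> \<tau>'"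
  shows "(\<Sum>t\<in>Oc. 1 / real (card {\<tau>\<in>Oc. \<beta> \<tau> = \<beta> t \<and> t \<le> \<tau>}) *
      (\<Sum>(\<tau>, \<tau>')\<in>{(\<tau>, \<tau>')\<in>Y. \<beta> \<tau> = \<beta> t \<and> \<beta> \<tau>' = \<beta> t}. g \<tau> \<tau>')) \<le> harm m * (\<Sum>(\<tau>, \<tau>')\<in>Y. g \<tau> \<tau>')"
proof -
  define G where "G b = (\<Sum>(\<tau>, \<tau>')\<in>{(\<tau>, \<tau>')\<in>Y. \<beta> \<tau> = b \<and> \<beta> \<tau>' = b}. g \<tau> \<tau>')" for b
  have finO: "finite Oc" using assms(1) finite_subset by auto
  have G0: "0 \<le> G b" for b unfolding G_def using g by (intro sum_nonneg) auto
  have hm: "harm j \<le> (harm m :: real)" if "j \<le> m" for j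
    unfolding harm_def using that by (intro sum_mono2) auto
  have "(\<Sum>t\<in>Oc. 1 / real (card {\<tau>\<in>Oc. \<beta> \<tau> = \<beta> t \<and> t \<le> \<tau>}) * G (\<beta> t)) =
    (\<Sum>b\<in>\<beta> ` Oc. \<Sum>t\<in>{t\<in>Oc. \<beta> t = b}. 1 / real (card {\<tau>\<in>Oc. \<beta> \<tau> = \<beta> t \<and> t \<le> \<tau>}) * G (\<beta> t))"
    using finO by (rule sum.image_gen)
  also have "\<dots> = (\<Sum>b\<in>\<beta> ` Oc. harm (card {t\<in>Oc. \<beta> t = b}) * G b)"
  proof (rule sum.cong[OF refl])
    fix b
    have "(\<Sum>t\<in>{t\<in>Oc. \<beta> t = b}. 1 / real (card {\<tau>\<in>Oc. \<beta> \<tau> = \<beta> t \<and> t \<le> \<tau>}) * G (\<beta> t)) =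
      (\<Sum>t\<in>{t\<in>Oc. \<beta> t = b}. 1 / real (card {\<tau>\<in>{t\<in>Oc. \<beta> t = b}. t \<le> \<tau>})) * G b"
      unfolding sum_distrib_right by (intro sum.cong) (auto simp: conj_assoc)
    also have "\<dots> = harm (card {t\<in>Oc. \<beta> t = b}) * G b"
      using finO by (subst sum_inverse_rank) auto
    finally show "(\<Sum>t\<in>{t\<in>Oc. \<beta> t = b}. 1 / real (card {\<tau>\<in>Oc. \<beta> \<tau> = \<beta> t \<and> t \<le> \<tau>}) * G (\<beta> t)) =
      harm (card {t\<in>Oc. \<beta> t = b}) * G b" .
  qed
  also have "\<dots> \<le> (\<Sum>b\<in>\<beta> ` Oc. harm m * G b)"
  proof (intro sum_mono mult_right_mono G0 hm)
    fix b
    have "card {t\<in>Oc. \<beta> t = b} \<le> card {..<m}" using assms(1) by (intro card_mono) auto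
    then show "card {t\<in>Oc. \<beta> t = b} \<le> m" by simp
  qed
  also have "\<dots> = harm m * (\<Sum>b\<in>\<beta> ` Oc. G b)" by (simp add: sum_distrib_left)
  also have "\<dots> \<le> harm m * (\<Sum>(\<tau>, \<tau>')\<in>Y. g \<tau> \<tau>')"
  proof (rule mult_left_mono[OF _ harm_nonneg])
    have "(\<Sum>b\<in>\<beta> ` Oc. G b) = sum (\<lambda>(\<tau>, \<tau>'). g \<tau> \<tau>') (\<Union>b\<in>\<beta> ` Oc. {(\<tau>, \<tau>')\<in>Y. \<beta> \<tau> = b \<and> \<beta> \<tau>' = b})"
      unfolding G_def
    proof (rule sum.UNION_disjoint[symmetric])
      show "\<forall>b\<in>\<beta> ` Oc. finite {(\<tau>, \<tau>')\<in>Y. \<beta> \<tau> = b \<and> \<beta> \<tau>' = b}"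
        by (auto intro!: finite_subset[OF _ Y])
    qed (use finO in auto)
    also have "\<dots> \<le> (\<Sum>(\<tau>, \<tau>')\<in>Y. g \<tau> \<tau>')" using Y g by (intro sum_mono2) auto
    finally show "(\<Sum>b\<in>\<beta> ` Oc. G b) \<le> (\<Sum>(\<tau>, \<tau>')\<in>Y. g \<tau> \<tau>')" .
  qed
  finally show ?thesis unfolding G_def .
qed

text \<open>Without the factor at \<open>x = \<tau>\<close> the summand is the probability that
  \<open>\<tau>\<close> is the last success before \<open>t\<close>, and these events are disjoint.
  With it, the sum is the expected number of samples since the last tick, because samples and ticks
  have the same rate.\<close>

lemma sum_last_success_le:
  fixes a :: "nat \<Rightarrow> real"
  assumes "\<And>t. 0 \<le> a t" "\<And>t. a t \<le> 1"
  shows "(\<Sum>\<tau><t. a \<tau> * (\<Prod>x\<in>{\<tau>..<t}. 1 - a x)) \<le> 1"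
proof (induction t)
  case (Suc t)
  have "(\<Sum>\<tau><Suc t. a \<tau> * (\<Prod>x\<in>{\<tau>..<Suc t}. 1 - a x)) =
     ((\<Sum>\<tau><t. a \<tau> * (\<Prod>x\<in>{\<tau>..<t}. 1 - a x)) + a t) * (1 - a t)"
    by (simp add: algebra_simps sum_distrib_left sum_distrib_right)
  also have "\<dots> \<le> (1 + a t) * (1 - a t)" using Suc assms by (intro mult_right_mono) auto
  also have "\<dots> \<le> 1" using assms[of t] by (simp add: algebra_simps)
  finally show ?case .
qed simp

section \<open>Drawing the coins in advance\<close>

context sample_hold
begin

definition rates :: "(nat \<Rightarrow> real) \<Rightarrow> (nat \<Rightarrow> nat \<Rightarrow> real) \<Rightarrow> nat \<Rightarrow> nat \<Rightarrow> real" where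
  "rates a b u x = (case x of 0 \<Rightarrow> a u | Suc l \<Rightarrow> b u l)"

text \<open>The tick has the sampling rate but a coin of its own. Equal rates keep the expected
  number of samples per clock value bounded; independence lets the ticks, and with them the blocks,
  be fixed before the tape is analysed.\<close>

definition kern :: "(nat \<Rightarrow> real) \<Rightarrow> (nat \<Rightarrow> nat \<Rightarrow> real) \<Rightarrow> cell \<Rightarrow> nat \<Rightarrow> cell pmf" where
  "kern a b \<sigma> u = bind_pmf (bernoulli_pmf (a u)) (\<lambda>k.
     bind_pmf (Pi_pmf {..Lf} False (\<lambda>x. bernoulli_pmf (rates a b u x))) (\<lambda>c.
       return_pmf (step \<sigma> u k (c 0) {l. l < Lf \<and> c (Suc l)})))"

definition ticks :: "(nat \<Rightarrow> real) \<Rightarrow> nat list \<Rightarrow> (nat \<Rightarrow> bool) pmf" where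
  "ticks a us = Pi_pmf {..<length us} False (\<lambda>t. bernoulli_pmf (a (us ! t)))"

definition tape :: "(nat \<Rightarrow> real) \<Rightarrow> (nat \<Rightarrow> nat \<Rightarrow> real) \<Rightarrow> nat list \<Rightarrow> (nat \<Rightarrow> nat \<Rightarrow> bool) pmf" where
  "tape a b us = bit_table (length us) Lf (\<lambda>t. rates a b (us ! t))"

lemma run_cong:
  assumes "\<And>x. x < t \<Longrightarrow> us ! x = vs ! x \<and> k x = k' x \<and> \<omega> x = \<omega>' x"
  shows "run us k \<omega> t = run vs k' \<omega>' t"
  using assms by (induction t) auto

text \<open>Coins drawn update by update have the law of coins drawn in advance. Induction from the
  right, since the last update only appends a row to each table.\<close>

lemma fold_kern:
  "fold_pmf (kern a b) (0, 0, Map.empty) us =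
    map_pmf (\<lambda>(k, \<omega>). run us k \<omega> (length us)) (pair_pmf (ticks a us) (tape a b us))"
proof (induction us rule: rev_induct)
  case Nil
  show ?case by (simp add: map_pmf_def pair_pmf_def bind_return_pmf')
next
  case (snoc u us)
  let ?m = "length us"
  have t: "ticks a (us @ [u]) = bind_pmf (bernoulli_pmf (a u)) (\<lambda>y. bind_pmf (ticks a us) (\<lambda>k. return_pmf (k(?m := y))))"
  proof -
    have "Pi_pmf {..<?m} False (\<lambda>t. bernoulli_pmf (a ((us @ [u]) ! t))) = ticks a us"
      unfolding ticks_def by (rule Pi_pmf_cong) (auto simp: nth_append)
    then show ?thesis unfolding ticks_def[of a "us @ [u]"]
      by (simp add: lessThan_Suc Pi_pmf_insert' del: fun_upd_apply)
  qed
  have w: "tape a b (us @ [u]) = bind_pmf (Pi_pmf {..Lf} False (\<lambda>x. bernoulli_pmf (rates a b u x)))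
     (\<lambda>c. bind_pmf (tape a b us) (\<lambda>\<omega>. return_pmf (fun_upd \<omega> ?m c)))"
  proof -
    have "Pi_pmf {..<?m} (\<lambda>_. False) (\<lambda>t. Pi_pmf {..Lf} False (\<lambda>x. bernoulli_pmf (rates a b ((us @ [u]) ! t) x))) = tape a b us"
      unfolding tape_def bit_table_def by (rule Pi_pmf_cong) (auto simp: nth_append)
    then show ?thesis unfolding tape_def[of a b "us @ [u]"] bit_table_def
      by (simp add: lessThan_Suc Pi_pmf_insert' del: fun_upd_apply)
  qed
  have r: "run (us @ [u]) (k(?m := y)) (fun_upd \<omega> ?m c) (length (us @ [u])) =
     step (run us k \<omega> ?m) u y (c 0) {l. l < Lf \<and> c (Suc l)}" for k y \<omega> c
    using run_cong[of ?m "us @ [u]" us "k(?m := y)" k "fun_upd \<omega> ?m c" \<omega>] by (simp add: nth_append)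
  let ?C = "Pi_pmf {..Lf} False (\<lambda>x. bernoulli_pmf (rates a b u x))"
  let ?f = "\<lambda>k y \<omega> c. return_pmf (step (run us k \<omega> ?m) u y (c 0) {l. l < Lf \<and> c (Suc l)})"
  have "map_pmf (\<lambda>(k, \<omega>). run (us @ [u]) k \<omega> (length (us @ [u]))) (pair_pmf (ticks a (us @ [u])) (tape a b (us @ [u]))) =
    bind_pmf (bernoulli_pmf (a u)) (\<lambda>y. bind_pmf (ticks a us) (\<lambda>k. bind_pmf ?C (\<lambda>c. bind_pmf (tape a b us) (\<lambda>\<omega>. ?f k y \<omega> c))))"
    unfolding t w pair_pmf_def map_pmf_def
    by (simp add: bind_assoc_pmf bind_return_pmf r del: run.simps step.simps fun_upd_apply length_append)
  \<comment> \<open>Independent draws commute; this moves the coins of the last update behind those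
    of the earlier ones.\<close>
  also have "\<dots> = bind_pmf (ticks a us) (\<lambda>k. bind_pmf (bernoulli_pmf (a u)) (\<lambda>y. bind_pmf (tape a b us) (\<lambda>\<omega>. bind_pmf ?C (\<lambda>c. ?f k y \<omega> c))))"
    by (subst bind_commute_pmf, subst (3) bind_commute_pmf) simp
  also have "\<dots> = bind_pmf (ticks a us) (\<lambda>k. bind_pmf (tape a b us) (\<lambda>\<omega>. bind_pmf (bernoulli_pmf (a u)) (\<lambda>y. bind_pmf ?C (\<lambda>c. ?f k y \<omega> c))))"
    by (subst (2) bind_commute_pmf) simp
  also have "\<dots> = fold_pmf (kern a b) (0, 0, Map.empty) (us @ [u])"
    by (simp add: fold_pmf_append snoc.IH kern_def pair_pmf_def map_pmf_def bind_assoc_pmf bind_return_pmf bind_return_pmf'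
        del: step.simps)
  finally show ?case ..
qed

end

context sample_hold
begin

lemma rates_simps [simp]: "rates a b u 0 = a u" "rates a b u (Suc l) = b u l"
  by (simp_all add: rates_def)

section \<open>Budget, hit counts and room at the start\<close>

context
  fixes a :: "nat \<Rightarrow> real" and b :: "nat \<Rightarrow> nat \<Rightarrow> real" and us :: "nat list"
  assumes a: "\<And>u. 0 \<le> a u" "\<And>u. a u \<le> 1" and b: "\<And>u l. 0 \<le> b u l" "\<And>u l. b u l \<le> 1"
begin

lemma rates_bounds: "0 \<le> rates a b u x" "rates a b u x \<le> 1"
  using a b by (simp_all add: rates_def split: nat.splits)

lemma prob_tape:
  assumes "A \<subseteq> {..<length us} \<times> {..Lf}" "N \<subseteq> {..<length us} \<times> {..Lf}" "A \<inter> N = {}"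
  shows "measure_pmf.prob (tape a b us) {\<omega>. (\<forall>(t, x)\<in>A. \<omega> t x) \<and> (\<forall>(t, x)\<in>N. \<not> \<omega> t x)} =
    (\<Prod>(t, x)\<in>A. rates a b (us ! t) x) * (\<Prod>(t, x)\<in>N. 1 - rates a b (us ! t) x)"
  unfolding tape_def by (rule prob_bit_table[OF assms]) (simp_all add: rates_bounds)

lemma prob_tape_on:
  assumes "A \<subseteq> {..<length us} \<times> {..Lf}"
  shows "measure_pmf.prob (tape a b us) {\<omega>. \<forall>(t, x)\<in>A. \<omega> t x} = (\<Prod>(t, x)\<in>A. rates a b (us ! t) x)"
  using prob_tape[OF assms, of "{}"] by simp

lemma prob_samples_ge:
  assumes "0 < B"
  shows "measure_pmf.prob (tape a b us) {\<omega>. B \<le> samples \<omega> (length us)} \<le> (\<Sum>t<length us. a (us ! t)) / B"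
proof -
  have eq: "{x \<in> {..<length us}. \<omega> x 0} = {x. x < length us \<and> \<omega> x 0}" for \<omega> :: "nat \<Rightarrow> nat \<Rightarrow> bool" by auto
  have "measure_pmf.prob (tape a b us) {\<omega>. True \<and> real B \<le> real (card {x \<in> {..<length us}. \<omega> x 0})}
    \<le> (\<Sum>x<length us. measure_pmf.prob (tape a b us) {\<omega>. True \<and> \<omega> x 0}) / B"
    using assms by (intro prob_count_le) auto
  also have "(\<Sum>x<length us. measure_pmf.prob (tape a b us) {\<omega>. True \<and> \<omega> x 0}) = (\<Sum>t<length us. a (us ! t))"
  proof (rule sum.cong[OF refl])
    fix x assume "x \<in> {..<length us}"
    then show "measure_pmf.prob (tape a b us) {\<omega>. True \<and> \<omega> x 0} = a (us ! x)"
      using prob_tape_on[of "{(x, 0)}"] by simp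
  qed
  finally show ?thesis by (simp add: samples_def eq)
qed

lemma prob_clock_ge:
  assumes "0 < B"
  shows "measure_pmf.prob (ticks a us) {k. B \<le> clock k (length us)} \<le> (\<Sum>t<length us. a (us ! t)) / B"
proof -
  have eq: "{x \<in> {..<length us}. k x} = {x. x < length us \<and> k x}" for k :: "nat \<Rightarrow> bool" by auto
  have "measure_pmf.prob (ticks a us) {k. True \<and> real B \<le> real (card {x \<in> {..<length us}. k x})}
    \<le> (\<Sum>x<length us. measure_pmf.prob (ticks a us) {k. True \<and> k x}) / B"
    using assms by (intro prob_count_le) auto
  also have "(\<Sum>x<length us. measure_pmf.prob (ticks a us) {k. True \<and> k x}) = (\<Sum>t<length us. a (us ! t))"
    unfolding ticks_def using a by (intro sum.cong) (auto simp: prob_bit_on)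
  finally show ?thesis by (simp add: clock_def eq)
qed

text \<open>Chernoff bound with base \<open>1 - \<eta>\<close>. The deviation
  \<open>3 * \<eta>\<close> absorbs the second order term in
  \<open>- \<eta> - 2 * \<eta>\<^sup>2 \<le> ln (1 - \<eta>)\<close> and leaves the exponent
  \<open>- \<eta>\<^sup>2 * \<mu>\<close>.\<close>

lemma prob_hits_le:
  assumes \<eta>: "0 < \<eta>" "\<eta> \<le> 1/4" and \<mu>: "\<mu> = a i * real (count_list us i)"
  shows "measure_pmf.prob (tape a b us) {\<omega>. real (hits us \<omega> i (length us)) \<le> (1 - 3 * \<eta>) * \<mu>} \<le> exp (- \<eta>\<^sup>2 * \<mu>)"
proof -
  define X where "X = {t. t < length us \<and> us ! t = i}"
  have finX: "finite X" by (simp add: X_def)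
  have cX: "card X = count_list us i" by (simp add: X_def count_list_eq_length_filter length_filter_conv_card conj_commute eq_commute)
  have h: "hits us \<omega> i (length us) = card {t\<in>X. \<omega> t 0}" for \<omega>
    unfolding hits_def X_def by (rule arg_cong[where f=card]) auto
  have \<mu>0: "0 \<le> \<mu>" using a by (simp add: \<mu>)
  define y where "y = 1 - \<eta>"
  have y: "0 < y" "y \<le> 1" using \<eta> by (simp_all add: y_def)
  define x where "x = (1 - 3 * \<eta>) * \<mu>"
  have x0: "0 \<le> x" using \<eta> \<mu>0 by (simp add: x_def)
  have E: "measure_pmf.expectation (tape a b us) (\<lambda>\<omega>. y ^ card {t\<in>X. \<omega> t 0}) = (\<Prod>t\<in>X. 1 - rates a b (us ! t) 0 + rates a b (us ! t) 0 * y)"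
    and I: "integrable (measure_pmf (tape a b us)) (\<lambda>\<omega>. y ^ card {t\<in>X. \<omega> t 0})"
    using expectation_pow_hits[of y "\<lambda>t. rates a b (us ! t)" X "length us" Lf] y rates_bounds unfolding tape_def by (auto simp: X_def)
  have "(\<Prod>t\<in>X. 1 - rates a b (us ! t) 0 + rates a b (us ! t) 0 * y) = (\<Prod>t\<in>X. 1 - \<eta> * a i)"
    by (rule prod.cong) (auto simp: X_def y_def algebra_simps)
  also have "\<dots> \<le> (\<Prod>t\<in>X. exp (- \<eta> * a i))"
  proof (rule prod_mono)
    fix t
    have "\<eta> * a i \<le> 1 * 1" using \<eta> a by (intro mult_mono) auto
    then show "0 \<le> 1 - \<eta> * a i \<and> 1 - \<eta> * a i \<le> exp (- \<eta> * a i)"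
      using exp_ge_add_one_self[of "- \<eta> * a i"] by simp
  qed
  also have "\<dots> = exp (- \<eta> * \<mu>)" by (simp add: cX \<mu> exp_of_nat_mult[symmetric] mult_ac)
  finally have E2: "measure_pmf.expectation (tape a b us) (\<lambda>\<omega>. y ^ card {t\<in>X. \<omega> t 0}) \<le> exp (- \<eta> * \<mu>)"
    unfolding E .
  have "measure_pmf.prob (tape a b us) {\<omega>. real (hits us \<omega> i (length us)) \<le> x} \<le>
    measure_pmf.prob (tape a b us) {\<omega>. y powr x \<le> y ^ card {t\<in>X. \<omega> t 0}}"
  proof (rule prob_mono)
    fix \<omega> :: "nat \<Rightarrow> nat \<Rightarrow> bool" assume "real (hits us \<omega> i (length us)) \<le> x"
    then have "y powr x \<le> y powr real (card {t\<in>X. \<omega> t 0})"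
      unfolding h using y by (intro powr_mono') auto
    then show "y powr x \<le> y ^ card {t\<in>X. \<omega> t 0}" using y by (simp add: powr_realpow)
  qed
  also have "\<dots> \<le> exp (- \<eta> * \<mu>) / y powr x"
    using prob_markov[OF I, of "y powr x"] E2 y
    by (smt (verit) divide_right_mono powr_gt_zero zero_le_power)
  also have "\<dots> = exp (- \<eta> * \<mu> - x * ln y)" using y by (simp add: powr_def exp_diff)
  also have "\<dots> \<le> exp (- \<eta>\<^sup>2 * \<mu>)"
  proof -
    have "- \<eta> - 2 * \<eta>\<^sup>2 \<le> ln y" unfolding y_def using ln_one_minus_pos_lower_bound[of \<eta>] \<eta> by simp
    then have "x * (- \<eta> - 2 * \<eta>\<^sup>2) \<le> x * ln y" using x0 by (rule mult_left_mono)
    moreover have "x * (- \<eta> - 2 * \<eta>\<^sup>2) = - \<eta> * \<mu> + \<eta>\<^sup>2 * \<mu> + 6 * \<eta> ^ 3 * \<mu>"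
      by (simp add: x_def algebra_simps power2_eq_square power3_eq_cube)
    moreover have "0 \<le> 6 * \<eta> ^ 3 * \<mu>" using \<eta> \<mu>0 by simp
    ultimately show ?thesis unfolding exp_le_cancel_iff by linarith
  qed
  finally show ?thesis by (simp add: x_def)
qed

text \<open>\<open>M\<close> may exceed the mean: for light items it will be a floor that keeps the
  failure probability small. The deviation \<open>2 * \<eta>\<close> against
  \<open>\<eta> - \<eta>\<^sup>2 \<le> ln (1 + \<eta>)\<close> leaves
  \<open>\<eta>\<^sup>2 * M\<close> minus a cubic term, which for \<open>\<eta> \<le> 1/4\<close>
  eats at most half of it.\<close>

lemma prob_hits_ge:
  assumes \<eta>: "0 < \<eta>" "\<eta> \<le> 1/4" and M: "a i * real (count_list us i) \<le> M"
  shows "measure_pmf.prob (tape a b us) {\<omega>. (1 + 2 * \<eta>) * M \<le> real (hits us \<omega> i (length us))} \<le> exp (- \<eta>\<^sup>2 * M / 2)"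
proof -
  define X where "X = {t. t < length us \<and> us ! t = i}"
  have finX: "finite X" by (simp add: X_def)
  have cX: "card X = count_list us i" by (simp add: X_def count_list_eq_length_filter length_filter_conv_card conj_commute eq_commute)
  have h: "hits us \<omega> i (length us) = card {t\<in>X. \<omega> t 0}" for \<omega>
    unfolding hits_def X_def by (rule arg_cong[where f=card]) auto
  have M0: "0 \<le> M" using M a by (meson mult_nonneg_nonneg of_nat_0_le_iff order_trans)
  define y where "y = 1 + \<eta>"
  have y: "1 \<le> y" using \<eta> by (simp_all add: y_def)
  define x where "x = (1 + 2 * \<eta>) * M"
  have x0: "0 \<le> x" using \<eta> M0 by (simp add: x_def)
  have E: "measure_pmf.expectation (tape a b us) (\<lambda>\<omega>. y ^ card {t\<in>X. \<omega> t 0}) = (\<Prod>t\<in>X. 1 - rates a b (us ! t) 0 + rates a b (us ! t) 0 * y)"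
    and I: "integrable (measure_pmf (tape a b us)) (\<lambda>\<omega>. y ^ card {t\<in>X. \<omega> t 0})"
    using expectation_pow_hits[of y "\<lambda>t. rates a b (us ! t)" X "length us" Lf] y rates_bounds unfolding tape_def by (auto simp: X_def)
  have "(\<Prod>t\<in>X. 1 - rates a b (us ! t) 0 + rates a b (us ! t) 0 * y) = (\<Prod>t\<in>X. 1 + \<eta> * a i)"
    by (rule prod.cong) (auto simp: X_def y_def algebra_simps)
  also have "\<dots> \<le> (\<Prod>t\<in>X. exp (\<eta> * a i))"
    using \<eta> a by (intro prod_mono) (auto simp: exp_ge_add_one_self)
  also have "\<dots> = exp (\<eta> * (a i * real (count_list us i)))" by (simp add: cX exp_of_nat_mult[symmetric] mult_ac)
  also have "\<dots> \<le> exp (\<eta> * M)" using M \<eta> by simp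
  finally have E2: "measure_pmf.expectation (tape a b us) (\<lambda>\<omega>. y ^ card {t\<in>X. \<omega> t 0}) \<le> exp (\<eta> * M)"
    unfolding E .
  have "measure_pmf.prob (tape a b us) {\<omega>. x \<le> real (hits us \<omega> i (length us))} \<le>
    measure_pmf.prob (tape a b us) {\<omega>. y powr x \<le> y ^ card {t\<in>X. \<omega> t 0}}"
  proof (rule prob_mono)
    fix \<omega> :: "nat \<Rightarrow> nat \<Rightarrow> bool" assume "x \<le> real (hits us \<omega> i (length us))"
    then have "y powr x \<le> y powr real (card {t\<in>X. \<omega> t 0})"
      unfolding h using y by (intro powr_mono) auto
    then show "y powr x \<le> y ^ card {t\<in>X. \<omega> t 0}" using y by (simp add: powr_realpow)
  qed
  also have "\<dots> \<le> exp (\<eta> * M) / y powr x"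
    using prob_markov[OF I, of "y powr x"] E2 y
    by (smt (verit) divide_right_mono powr_gt_zero zero_le_power)
  also have "\<dots> = exp (\<eta> * M - x * ln y)" using y by (simp add: powr_def exp_diff)
  also have "\<dots> \<le> exp (- \<eta>\<^sup>2 * M / 2)"
  proof -
    have "\<eta> - \<eta>\<^sup>2 \<le> ln y" unfolding y_def using ln_one_plus_pos_lower_bound[of \<eta>] \<eta> by simp
    then have "x * (\<eta> - \<eta>\<^sup>2) \<le> x * ln y" using x0 by (rule mult_left_mono)
    moreover have "x * (\<eta> - \<eta>\<^sup>2) = \<eta> * M + \<eta>\<^sup>2 * M - 2 * \<eta> * (\<eta>\<^sup>2 * M)"
      by (simp add: x_def algebra_simps power2_eq_square power3_eq_cube)
    moreover have "2 * \<eta> * (\<eta>\<^sup>2 * M) \<le> 1/2 * (\<eta>\<^sup>2 * M)" using \<eta> M0 by (intro mult_right_mono) auto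
    ultimately show ?thesis by simp
  qed
  finally show ?thesis by (simp add: x_def)
qed

lemma prob_first_hit_sum: "(\<Sum>t<length us. measure_pmf.prob (tape a b us) {\<omega>. first_hit us \<omega> i t}) \<le> 1"
proof -
  have "(\<Sum>t<length us. measure_pmf.prob (tape a b us) {\<omega>. first_hit us \<omega> i t}) =
    measure_pmf.prob (tape a b us) (\<Union>t<length us. {\<omega>. first_hit us \<omega> i t})"
  proof (rule measure_pmf.finite_measure_finite_Union[symmetric])
    show "disjoint_family_on (\<lambda>t. {\<omega>. first_hit us \<omega> i t}) {..<length us}"
      unfolding disjoint_family_on_def
    proof (intro ballI impI)
      fix t t' :: nat assume "t \<noteq> t'"
      then have "t < t' \<or> t' < t" by auto
      then show "{\<omega>. first_hit us \<omega> i t} \<inter> {\<omega>. first_hit us \<omega> i t'} = {}"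
        unfolding first_hit_def by blast
    qed
  qed auto
  then show ?thesis by simp
qed

lemma first_hit_iff:
  assumes "us ! t = i"
  shows "first_hit us \<omega> i t \<longleftrightarrow> (\<forall>(x, y)\<in>{(t, 0)}. \<omega> x y) \<and> (\<forall>(x, y)\<in>{x. x < t \<and> us ! x = i} \<times> {0}. \<not> \<omega> x y)"
  using assms by (auto simp: first_hit_def)

text \<open>A first hit of \<open>i\<close> is decided by coins of updates of \<open>i\<close>
  alone, hence is independent of a sample of another item.\<close>

lemma prob_first_hit_and:
  assumes "us ! t = i" "t < length us" "\<tau> < length us" "us ! \<tau> \<noteq> i"
  shows "measure_pmf.prob (tape a b us) {\<omega>. first_hit us \<omega> i t \<and> \<omega> \<tau> 0} =
    measure_pmf.prob (tape a b us) {\<omega>. first_hit us \<omega> i t} * a (us ! \<tau>)"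
proof -
  let ?N = "{x. x < t \<and> us ! x = i} \<times> {0::nat}"
  have ne: "\<tau> \<noteq> t" using assms by auto
  have e1: "{\<omega>. first_hit us \<omega> i t} = {\<omega>. (\<forall>(x, y)\<in>{(t, 0)}. \<omega> x y) \<and> (\<forall>(x, y)\<in>?N. \<not> \<omega> x y)}"
    using first_hit_iff[OF assms(1)] by simp
  have e2: "{\<omega>. first_hit us \<omega> i t \<and> \<omega> \<tau> 0} = {\<omega>. (\<forall>(x, y)\<in>{(t, 0), (\<tau>, 0)}. \<omega> x y) \<and> (\<forall>(x, y)\<in>?N. \<not> \<omega> x y)}"
    using first_hit_iff[OF assms(1)] by auto
  have "measure_pmf.prob (tape a b us) {\<omega>. first_hit us \<omega> i t} = a (us ! t) * (\<Prod>(t, x)\<in>?N. 1 - rates a b (us ! t) x)"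
    unfolding e1 by (subst prob_tape) (use assms in auto)
  moreover have "measure_pmf.prob (tape a b us) {\<omega>. first_hit us \<omega> i t \<and> \<omega> \<tau> 0} =
     (\<Prod>(t, x)\<in>{(t, 0), (\<tau>, 0)}. rates a b (us ! t) x) * (\<Prod>(t, x)\<in>?N. 1 - rates a b (us ! t) x)"
    unfolding e2 by (rule prob_tape) (use assms in auto)
  ultimately show ?thesis using ne by simp
qed

lemma clock_eq_iff: "\<tau> \<le> t \<Longrightarrow> clock k \<tau> = clock k t \<longleftrightarrow> (\<forall>x\<in>{\<tau>..<t}. \<not> k x)"
proof -
  assume le: "\<tau> \<le> t"
  have eq: "{x. x < t \<and> k x} = {x. x < \<tau> \<and> k x} \<union> {x\<in>{\<tau>..<t}. k x}" using le by auto
  have "card ({x. x < \<tau> \<and> k x} \<union> {x\<in>{\<tau>..<t}. k x}) = card {x. x < \<tau> \<and> k x} + card {x\<in>{\<tau>..<t}. k x}"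
    by (rule card_Un_disjoint) auto
  then have "clock k t = clock k \<tau> + card {x\<in>{\<tau>..<t}. k x}" unfolding clock_def eq .
  then show ?thesis by auto
qed

text \<open>Given a first hit at \<open>t\<close>, the expected number of other samples with the
  same clock value is at most 1 by \<open>sum_last_success_le\<close>. The probabilities of first
  hits sum to at most 1, so the union over \<open>t\<close> costs nothing.\<close>

lemma prob_leaf_full:
  assumes "0 < cap"
  shows "measure_pmf.prob (pair_pmf (ticks a us) (tape a b us))
    {(k, \<omega>). \<exists>t<length us. first_hit us \<omega> i t \<and>
      cap \<le> card {\<tau>. \<tau> < t \<and> us ! \<tau> \<noteq> i \<and> \<omega> \<tau> 0 \<and> clock k \<tau> = clock k t}} \<le> 1 / cap"
proof -
  let ?P = "pair_pmf (ticks a us) (tape a b us)"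
  let ?F = "\<lambda>t. measure_pmf.prob (tape a b us) {\<omega>. first_hit us \<omega> i t}"
  have single: "measure_pmf.prob ?P {x. first_hit us (snd x) i t \<and>
      cap \<le> card {\<tau>. \<tau> < t \<and> us ! \<tau> \<noteq> i \<and> snd x \<tau> 0 \<and> clock (fst x) \<tau> = clock (fst x) t}} \<le> ?F t / cap"
    if t: "t < length us" for t
  proof (cases "us ! t = i")
    case False
    then show ?thesis by (simp add: first_hit_def)
  next
    case True
    let ?X = "{\<tau>. \<tau> < t \<and> us ! \<tau> \<noteq> i}"
    have eq: "{\<tau>. \<tau> < t \<and> us ! \<tau> \<noteq> i \<and> \<omega> \<tau> 0 \<and> clock k \<tau> = clock k t} = {\<tau>\<in>?X. \<omega> \<tau> 0 \<and> clock k \<tau> = clock k t}"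
      for \<omega> :: "nat \<Rightarrow> nat \<Rightarrow> bool" and k by auto
    have "measure_pmf.prob ?P {x. first_hit us (snd x) i t \<and>
      real cap \<le> real (card {\<tau>\<in>?X. snd x \<tau> 0 \<and> clock (fst x) \<tau> = clock (fst x) t})} \<le>
      (\<Sum>\<tau>\<in>?X. measure_pmf.prob ?P {x. first_hit us (snd x) i t \<and> snd x \<tau> 0 \<and> clock (fst x) \<tau> = clock (fst x) t}) / cap"
      using assms by (intro prob_count_le) auto
    also have "\<dots> \<le> ?F t / cap"
    proof (rule divide_right_mono)
    have "(\<Sum>\<tau>\<in>?X. measure_pmf.prob ?P {x. first_hit us (snd x) i t \<and> snd x \<tau> 0 \<and> clock (fst x) \<tau> = clock (fst x) t}) =
      (\<Sum>\<tau>\<in>?X. ?F t * (a (us ! \<tau>) * (\<Prod>x\<in>{\<tau>..<t}. 1 - a (us ! x))))"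
    proof (rule sum.cong[OF refl])
      fix \<tau> assume \<tau>: "\<tau> \<in> ?X"
      \<comment> \<open>Equality of clock values is an event of the ticks, everything else one of
        the tape, so the probability factors.\<close>
      have "{x. first_hit us (snd x) i t \<and> snd x \<tau> 0 \<and> clock (fst x) \<tau> = clock (fst x) t} =
        {k. \<forall>x\<in>{\<tau>..<t}. \<not> k x} \<times> {\<omega>. first_hit us \<omega> i t \<and> \<omega> \<tau> 0}"
        using \<tau> by (auto simp: clock_eq_iff)
      moreover have "measure_pmf.prob (ticks a us) {k. \<forall>x\<in>{\<tau>..<t}. \<not> k x} = (\<Prod>x\<in>{\<tau>..<t}. 1 - a (us ! x))"
        unfolding ticks_def using a t by (intro prob_bits_off) auto
      ultimately show "measure_pmf.prob ?P {x. first_hit us (snd x) i t \<and> snd x \<tau> 0 \<and> clock (fst x) \<tau> = clock (fst x) t} =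
        ?F t * (a (us ! \<tau>) * (\<Prod>x\<in>{\<tau>..<t}. 1 - a (us ! x)))"
        using prob_first_hit_and[OF True t, of \<tau>] \<tau> t by (simp add: prob_pair_Times)
    qed
    also have "\<dots> \<le> (\<Sum>\<tau><t. ?F t * (a (us ! \<tau>) * (\<Prod>x\<in>{\<tau>..<t}. 1 - a (us ! x))))"
      using a by (intro sum_mono2) (auto intro!: mult_nonneg_nonneg prod_nonneg)
    also have "\<dots> \<le> ?F t"
      using mult_left_mono[OF sum_last_success_le[of "\<lambda>x. a (us ! x)" t], of "?F t"] a
      by (simp add: sum_distrib_left)
    finally show "(\<Sum>\<tau>\<in>?X. measure_pmf.prob ?P {x. first_hit us (snd x) i t \<and> snd x \<tau> 0 \<and> clock (fst x) \<tau> = clock (fst x) t}) \<le> ?F t" .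
    qed simp
    finally show ?thesis by (simp only: eq of_nat_le_iff)
  qed
  have "measure_pmf.prob ?P {(k, \<omega>). \<exists>t<length us. first_hit us \<omega> i t \<and>
      cap \<le> card {\<tau>. \<tau> < t \<and> us ! \<tau> \<noteq> i \<and> \<omega> \<tau> 0 \<and> clock k \<tau> = clock k t}} =
    measure_pmf.prob ?P {x. \<exists>t\<in>{..<length us}. first_hit us (snd x) i t \<and>
      cap \<le> card {\<tau>. \<tau> < t \<and> us ! \<tau> \<noteq> i \<and> snd x \<tau> 0 \<and> clock (fst x) \<tau> = clock (fst x) t}}"
    by (intro arg_cong[where f="measure_pmf.prob ?P"]) auto
  also have "\<dots> \<le> (\<Sum>t<length us. measure_pmf.prob ?P {x. first_hit us (snd x) i t \<and>
      cap \<le> card {\<tau>. \<tau> < t \<and> us ! \<tau> \<noteq> i \<and> snd x \<tau> 0 \<and> clock (fst x) \<tau> = clock (fst x) t}})"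
    by (rule prob_Ex_le) simp
  also have "\<dots> \<le> (\<Sum>t<length us. ?F t / cap)" by (intro sum_mono single) simp
  also have "\<dots> \<le> 1 / cap" using prob_first_hit_sum[of i] assms
    by (simp add: sum_divide_distrib[symmetric] divide_right_mono)
  finally show ?thesis .
qed

end

end

section \<open>Survival of a heavy item\<close>

lemma one_minus_min_power_le:
  fixes x \<rho> :: real
  assumes "0 \<le> x" "\<rho> \<le> real c * x" "0 < c"
  shows "(1 - min 1 x) ^ c \<le> exp (- \<rho>)"
proof (cases "1 \<le> x")
  case True
  then show ?thesis using assms(3) by (cases c) auto
next
  case False
  have "(1 - x) ^ c \<le> exp (- x) ^ c"
    using False exp_ge_add_one_self[of "- x"] by (intro power_mono) auto
  also have "\<dots> = exp (- (real c * x))" by (simp add: exp_of_nat_mult[symmetric])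
  also have "\<dots> \<le> exp (- \<rho>)" using assms(2) by simp
  finally show ?thesis using False by (simp add: min_def)
qed

lemma Collect_snd_Times: "UNIV \<times> {y. R y} = {x. R (snd x)}"
  and Collect_fst_Times: "{y. R y} \<times> UNIV = {x. R (fst x)}"
  by auto

text \<open>The sum of the squares of \<open>f\<^sub>i w\<^sub>i\<close>, written over ordered pairs
  of updates because a competitor needs one update that is sampled and one that is flagged.\<close>

definition pair_mass :: "nat list \<Rightarrow> (nat \<Rightarrow> real) \<Rightarrow> real" where
  "pair_mass us w = (\<Sum>(\<tau>, \<tau>')\<in>{(\<tau>, \<tau>'). \<tau> < length us \<and> \<tau>' < length us \<and> us ! \<tau> = us ! \<tau>'}. (w (us ! \<tau>))\<^sup>2)"

context sample_hold
begin

context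
  fixes a :: "nat \<Rightarrow> real" and b :: "nat \<Rightarrow> nat \<Rightarrow> real" and us :: "nat list"
    and w :: "nat \<Rightarrow> real" and q \<rho> :: real
  assumes a: "\<And>u. 0 \<le> a u" "\<And>u. a u \<le> 1" "\<And>u. a u \<le> q * w u"
    and b: "\<And>u l. b u l = min 1 (\<rho> * w u / 2 ^ l)"
    and w: "\<And>u. 1 \<le> w u" and \<rho>: "0 < \<rho>" and q: "0 \<le> q" and \<kappa>: "0 < \<kappa>"
begin

lemma b_bounds: "0 \<le> b u l" "b u l \<le> 1"
proof -
  have "0 \<le> w u" using w[of u] by simp
  then show "0 \<le> b u l" "b u l \<le> 1" using \<rho> by (simp_all add: b)
qed

text \<open>For a first hit at \<open>t\<close>, take the level \<open>l\<close> whose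
  \<open>2 ^ l\<close> matches the number of remaining updates of \<open>i\<close> in the block
  times \<open>w i\<close>. Then \<open>i\<close> misses the flag with probability at most
  \<open>exp (- \<rho>)\<close>. A pair of updates of \<open>j\<close> competes, jointly with the
  sample at \<open>t\<close>, with probability \<open>a i * a j * b j l\<close>; dividing
  \<open>w i\<close> by \<open>2 ^ l\<close> leaves the inverse number of remaining updates. The sum
  of these inverses over \<open>t\<close> is only harmonic.\<close>

lemma prob_outcompeted:
  assumes Lf: "real (length us) * w i < 2 ^ Lf"
  shows "measure_pmf.prob (tape a b us) {\<omega>. \<exists>t<length us. first_hit us \<omega> i t \<and>
      \<not> (\<exists>l<Lf. flagged us \<omega> (block k (length us) z t) i t l \<and>
        card (competitors us \<omega> (block k (length us) z t) i l) < \<kappa>)}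
    \<le> real (length us) * exp (- \<rho>) + 2 * \<rho> * q\<^sup>2 * harm (length us) * pair_mass us w / \<kappa>"
proof -
  define m where "m = length us"
  define \<beta> where "\<beta> \<tau> = clock k \<tau> div 2 ^ z" for \<tau>
  define Oc where "Oc = {t. t < m \<and> us ! t = i}"
  define Y where "Y = {(\<tau>, \<tau>'). \<tau> < m \<and> \<tau>' < m \<and> us ! \<tau> = us ! \<tau>' \<and> us ! \<tau> \<noteq> i}"
  \<comment> \<open>\<open>C t\<close> collects the remaining chances of \<open>i\<close> to be
    flagged in its block, \<open>X t\<close> the pairs of updates in the block that can turn another
    item into a competitor.\<close>
  define C where "C t = {\<tau>\<in>Oc. \<beta> \<tau> = \<beta> t \<and> t \<le> \<tau>}" for t
  define X where "X t = {(\<tau>, \<tau>')\<in>Y. \<beta> \<tau> = \<beta> t \<and> \<beta> \<tau>' = \<beta> t}" for t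
  have finY: "finite Y"
    by (rule finite_subset[of _ "{..<m} \<times> {..<m}"]) (auto simp: Y_def)
  have finX: "finite (X t)" for t by (rule finite_subset[OF _ finY]) (auto simp: X_def)
  have finC: "finite (C t)" for t by (simp add: C_def Oc_def)
  have w0: "0 < w u" for u using w[of u] by simp
  let ?p = "tape a b us"
  let ?bad = "\<lambda>\<omega> t. first_hit us \<omega> i t \<and> \<not> (\<exists>l<Lf. flagged us \<omega> (block k m z t) i t l \<and>
        card (competitors us \<omega> (block k m z t) i l) < \<kappa>)"
  have single: "measure_pmf.prob ?p {\<omega>. ?bad \<omega> t} \<le> exp (- \<rho>) +
      2 * \<rho> * q\<^sup>2 / \<kappa> * (1 / real (card (C t)) * (\<Sum>(\<tau>, \<tau>')\<in>X t. (w (us ! \<tau>))\<^sup>2))"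
    if t: "t \<in> Oc" for t
  proof -
    have tC: "t \<in> C t" using t by (simp add: C_def)
    then have c1: "1 \<le> card (C t)" using finC card_gt_0_iff[of "C t"] by (auto simp: Suc_le_eq)
    have "card (C t) \<le> card {..<m}" by (rule card_mono) (auto simp: C_def Oc_def)
    then have cm: "card (C t) \<le> m" by simp
    have "1 * 1 \<le> real (card (C t)) * w i" using c1 w by (intro mult_mono) auto
    then obtain l where l: "2 ^ l \<le> real (card (C t)) * w i" "real (card (C t)) * w i < 2 ^ Suc l"
      using pow2_bracket[of "real (card (C t)) * w i"] by auto
    have "(2::real) ^ l < 2 ^ Lf"
    proof -
      have "real (card (C t)) * w i \<le> real m * w i" using cm w0[of i] by (intro mult_right_mono) auto
      then show ?thesis using l Lf unfolding m_def by linarith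
    qed
    then have lLf: "l < Lf" by (rule power_less_imp_less_exp[rotated]) simp
    have C: "C t \<times> {Suc l} \<subseteq> {..<length us} \<times> {..Lf}" using lLf by (auto simp: C_def Oc_def m_def)
    have "measure_pmf.prob ?p {\<omega>. ?bad \<omega> t} \<le> measure_pmf.prob ?p {\<omega>. (\<forall>(x, y)\<in>C t \<times> {Suc l}. \<not> \<omega> x y) \<or>
       (\<omega> t 0 \<and> real \<kappa> \<le> real (card {x\<in>X t. \<omega> (fst x) 0 \<and> \<omega> (snd x) (Suc l)}))}"
    proof (rule prob_mono)
      fix \<omega> :: "nat \<Rightarrow> nat \<Rightarrow> bool" assume bad: "?bad \<omega> t"
      show "(\<forall>(x, y)\<in>C t \<times> {Suc l}. \<not> \<omega> x y) \<or>
       (\<omega> t 0 \<and> real \<kappa> \<le> real (card {x\<in>X t. \<omega> (fst x) 0 \<and> \<omega> (snd x) (Suc l)}))"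
      proof (cases "flagged us \<omega> (block k m z t) i t l")
        case False
        then show ?thesis by (auto simp: flagged_def C_def Oc_def block_def \<beta>_def)
      next
        case True
        then have ge: "\<kappa> \<le> card (competitors us \<omega> (block k m z t) i l)" using bad lLf by (meson not_le)
        have "competitors us \<omega> (block k m z t) i l \<subseteq>
          (\<lambda>x. us ! fst x) ` {x\<in>X t. \<omega> (fst x) 0 \<and> \<omega> (snd x) (Suc l)}"
        proof
          fix j assume "j \<in> competitors us \<omega> (block k m z t) i l"
          then obtain \<tau> \<tau>' where *: "j \<noteq> i" "\<tau> \<in> block k m z t" "\<tau>' \<in> block k m z t" "us ! \<tau> = j" "us ! \<tau>' = j"
             "\<omega> \<tau> 0" "\<omega> \<tau>' (Suc l)" by (auto simp: competitors_def)
          then show "j \<in> (\<lambda>x. us ! fst x) ` {x\<in>X t. \<omega> (fst x) 0 \<and> \<omega> (snd x) (Suc l)}"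
            by (intro image_eqI[of _ _ "(\<tau>, \<tau>')"]) (auto simp: X_def Y_def block_def \<beta>_def)
        qed
        then have "card (competitors us \<omega> (block k m z t) i l) \<le> card {x\<in>X t. \<omega> (fst x) 0 \<and> \<omega> (snd x) (Suc l)}"
          using finX by (intro surj_card_le) auto
        then show ?thesis using ge bad by (auto simp: first_hit_def)
      qed
    qed
    also have "\<dots> \<le> measure_pmf.prob ?p {\<omega>. \<forall>(x, y)\<in>C t \<times> {Suc l}. \<not> \<omega> x y} +
      measure_pmf.prob ?p {\<omega>. \<omega> t 0 \<and> real \<kappa> \<le> real (card {x\<in>X t. \<omega> (fst x) 0 \<and> \<omega> (snd x) (Suc l)})}"
      by (rule prob_or_le)
    also have "\<dots> \<le> exp (- \<rho>) +
      2 * \<rho> * q\<^sup>2 / \<kappa> * (1 / real (card (C t)) * (\<Sum>(\<tau>, \<tau>')\<in>X t. (w (us ! \<tau>))\<^sup>2))"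
    proof (rule add_mono)
      have "measure_pmf.prob ?p {\<omega>. \<forall>(x, y)\<in>C t \<times> {Suc l}. \<not> \<omega> x y} =
        (\<Prod>(t, x)\<in>C t \<times> {Suc l}. 1 - rates a b (us ! t) x)"
        using prob_tape[where a=a and b=b and us=us and A="{}" and N="C t \<times> {Suc l}", OF a(1,2) b_bounds] C by simp
      also have "\<dots> = (\<Prod>z\<in>C t \<times> {Suc l}. 1 - b i l)"
        by (rule prod.cong) (auto simp: C_def Oc_def)
      also have "\<dots> = (1 - min 1 (\<rho> * w i / 2 ^ l)) ^ card (C t)"
        by (simp add: b card_cartesian_product)
      also have "\<dots> \<le> exp (- \<rho>)"
      proof (rule one_minus_min_power_le)
        show "0 \<le> \<rho> * w i / 2 ^ l" using \<rho> w0[of i] by simp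
        have "\<rho> * 2 ^ l \<le> \<rho> * (real (card (C t)) * w i)" using l \<rho> by simp
        then show "\<rho> \<le> real (card (C t)) * (\<rho> * w i / 2 ^ l)" by (simp add: field_simps)
        show "0 < card (C t)" using c1 by simp
      qed
      finally show "measure_pmf.prob ?p {\<omega>. \<forall>(x, y)\<in>C t \<times> {Suc l}. \<not> \<omega> x y} \<le> exp (- \<rho>)" .
    next
      have each: "measure_pmf.prob ?p {\<omega>. \<omega> t 0 \<and> \<omega> (fst x) 0 \<and> \<omega> (snd x) (Suc l)} \<le>
        2 * \<rho> * q\<^sup>2 * (1 / real (card (C t)) * (w (us ! fst x))\<^sup>2)" if x: "x \<in> X t" for x
      proof -
        obtain \<tau> \<tau>' where xe: "x = (\<tau>, \<tau>')" by (cases x)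
        have \<tau>: "\<tau> < m" "\<tau>' < m" "us ! \<tau> = us ! \<tau>'" "us ! \<tau> \<noteq> i" using x by (auto simp: xe X_def Y_def)
        have ne: "t \<noteq> \<tau>" using \<tau> t by (auto simp: Oc_def)
        let ?A = "{(t, 0), (\<tau>, 0), (\<tau>', Suc l)}"
        have "measure_pmf.prob ?p {\<omega>. \<omega> t 0 \<and> \<omega> (fst x) 0 \<and> \<omega> (snd x) (Suc l)} =
          measure_pmf.prob ?p {\<omega>. \<forall>(x, y)\<in>?A. \<omega> x y}" by (simp add: xe)
        also have "\<dots> = (\<Prod>(t, x)\<in>?A. rates a b (us ! t) x)"
          using \<tau> t lLf by (intro prob_tape_on[where a=a and b=b and us=us, OF a(1,2) b_bounds]) (auto simp: Oc_def m_def)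
        \<comment> \<open>The three bits are distinct: the item at \<open>\<tau>\<close> is not
          \<open>i\<close>, and columns 0 and \<open>Suc l\<close> differ even if
          \<open>\<tau> = \<tau>'\<close>.\<close>
        also have "\<dots> = a i * (a (us ! \<tau>) * b (us ! \<tau>) l)"
          using ne \<tau> t by (simp add: Oc_def)
        also have "\<dots> \<le> (q * w i) * ((q * w (us ! \<tau>)) * (\<rho> * w (us ! \<tau>) / 2 ^ l))"
          using a b_bounds w0[of i] w0[of "us ! \<tau>"] q \<rho>
          by (intro mult_mono) (auto simp: b intro!: mult_nonneg_nonneg divide_nonneg_nonneg less_imp_le[OF w0])
        also have "\<dots> = (\<rho> * q\<^sup>2 * (w (us ! \<tau>))\<^sup>2) * (w i / 2 ^ l)" by (simp add: power2_eq_square)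
        also have "\<dots> \<le> (\<rho> * q\<^sup>2 * (w (us ! \<tau>))\<^sup>2) * (2 / real (card (C t)))"
        proof (rule mult_left_mono)
          show "w i / 2 ^ l \<le> 2 / real (card (C t))" using l(2) c1 by (simp add: field_simps)
        qed (use \<rho> in auto)
        finally show ?thesis by (simp add: xe mult_ac)
      qed
      have "measure_pmf.prob ?p {\<omega>. \<omega> t 0 \<and> real \<kappa> \<le> real (card {x\<in>X t. \<omega> (fst x) 0 \<and> \<omega> (snd x) (Suc l)})} \<le>
        (\<Sum>x\<in>X t. measure_pmf.prob ?p {\<omega>. \<omega> t 0 \<and> \<omega> (fst x) 0 \<and> \<omega> (snd x) (Suc l)}) / \<kappa>"
        using finX \<kappa> by (intro prob_count_le) auto
      also have "\<dots> \<le> (\<Sum>x\<in>X t. 2 * \<rho> * q\<^sup>2 * (1 / real (card (C t)) * (w (us ! fst x))\<^sup>2)) / \<kappa>"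
        using each by (intro divide_right_mono sum_mono) auto
      also have "\<dots> = 2 * \<rho> * q\<^sup>2 / \<kappa> * (1 / real (card (C t)) * (\<Sum>(\<tau>, \<tau>')\<in>X t. (w (us ! \<tau>))\<^sup>2))"
        by (simp add: sum_distrib_left sum_divide_distrib case_prod_unfold mult.commute)
      finally show "measure_pmf.prob ?p {\<omega>. \<omega> t 0 \<and> real \<kappa> \<le> real (card {x\<in>X t. \<omega> (fst x) 0 \<and> \<omega> (snd x) (Suc l)})} \<le>
        2 * \<rho> * q\<^sup>2 / \<kappa> * (1 / real (card (C t)) * (\<Sum>(\<tau>, \<tau>')\<in>X t. (w (us ! \<tau>))\<^sup>2))" .
    qed
    finally show ?thesis .
  qed
  have finO: "finite Oc" by (simp add: Oc_def)
  have "measure_pmf.prob ?p {\<omega>. \<exists>t<m. ?bad \<omega> t} = measure_pmf.prob ?p {\<omega>. \<exists>t\<in>Oc. ?bad \<omega> t}"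
    by (intro arg_cong[where f="measure_pmf.prob ?p"]) (auto simp: Oc_def first_hit_def)
  also have "\<dots> \<le> (\<Sum>t\<in>Oc. measure_pmf.prob ?p {\<omega>. ?bad \<omega> t})" by (rule prob_Ex_le[OF finO])
  also have "\<dots> \<le> (\<Sum>t\<in>Oc. exp (- \<rho>) +
      2 * \<rho> * q\<^sup>2 / \<kappa> * (1 / real (card (C t)) * (\<Sum>(\<tau>, \<tau>')\<in>X t. (w (us ! \<tau>))\<^sup>2)))"
    by (intro sum_mono single)
  also have "\<dots> = real (card Oc) * exp (- \<rho>) + 2 * \<rho> * q\<^sup>2 / \<kappa> *
     (\<Sum>t\<in>Oc. 1 / real (card (C t)) * (\<Sum>(\<tau>, \<tau>')\<in>X t. (w (us ! \<tau>))\<^sup>2))"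
    by (simp add: sum.distrib sum_distrib_left)
  \<comment> \<open>In the first term the first hit has been dropped, so it is paid for every
    occurrence of \<open>i\<close>; a logarithmic \<open>\<rho>\<close> affords that. The second
    term is summed block by block.\<close>
  also have "\<dots> \<le> real m * exp (- \<rho>) + 2 * \<rho> * q\<^sup>2 / \<kappa> * (harm m * pair_mass us w)"
  proof (rule add_mono)
    have "card Oc \<le> card {..<m}" by (rule card_mono) (auto simp: Oc_def)
    then show "real (card Oc) * exp (- \<rho>) \<le> real m * exp (- \<rho>)" by simp
    have "(\<Sum>t\<in>Oc. 1 / real (card (C t)) * (\<Sum>(\<tau>, \<tau>')\<in>X t. (w (us ! \<tau>))\<^sup>2)) \<le>
      harm m * (\<Sum>(\<tau>, \<tau>')\<in>Y. (w (us ! \<tau>))\<^sup>2)"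
      unfolding C_def X_def by (rule sum_blocks_le) (auto simp: Oc_def finY)
    also have "\<dots> \<le> harm m * pair_mass us w"
    proof (rule mult_left_mono[OF _ harm_nonneg])
      have "finite {(\<tau>, \<tau>'). \<tau> < length us \<and> \<tau>' < length us \<and> us ! \<tau> = us ! \<tau>'}"
        by (rule finite_subset[of _ "{..<m} \<times> {..<m}"]) (auto simp: m_def)
      then show "(\<Sum>(\<tau>, \<tau>')\<in>Y. (w (us ! \<tau>))\<^sup>2) \<le> pair_mass us w"
        unfolding pair_mass_def by (rule sum_mono2) (auto simp: Y_def m_def)
    qed
    finally show "2 * \<rho> * q\<^sup>2 / \<kappa> * (\<Sum>t\<in>Oc. 1 / real (card (C t)) * (\<Sum>(\<tau>, \<tau>')\<in>X t. (w (us ! \<tau>))\<^sup>2)) \<le>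
      2 * \<rho> * q\<^sup>2 / \<kappa> * (harm m * pair_mass us w)"
      using \<rho> by (intro mult_left_mono) auto
  qed
  finally show ?thesis unfolding m_def by (simp add: mult_ac)
qed

text \<open>Too many samples, too many ticks, a low hit count and a full starting slot fail with
  probability at most 1/16 each, lost competition at some scale with at most 1/8. Only scales below
  \<open>Z\<close> matter since the clock stays below \<open>B\<close>.\<close>

lemma prob_found:
  assumes Lf: "real (length us) * w i < 2 ^ Lf"
    and B: "0 < B" "B < 2 ^ Z" "16 * (\<Sum>t<length us. a (us ! t)) \<le> B"
    and cap: "16 \<le> cap" and \<eta>: "0 < \<eta>" "\<eta> \<le> 1/4"
    and i: "0 < count_list us i"
    and acc: "a i = 1 \<or> 3 \<le> \<eta>\<^sup>2 * (a i * real (count_list us i))"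
    and l1: "real Z * (real (length us) * exp (- \<rho>)) \<le> 1/16"
    and l2: "real Z * (2 * \<rho> * q\<^sup>2 * harm (length us) * pair_mass us w / \<kappa>) \<le> 1/16"
  shows "1/2 \<le> measure_pmf.prob (fold_pmf (kern a b) (0, 0, Map.empty) us)
    {(S, T, E). \<exists>h F c. E i = Some (h, F, c) \<and> (1 - 3 * \<eta>) * (a i * real (count_list us i)) \<le> real c}"
proof -
  define m where "m = length us"
  define \<mu> where "\<mu> = a i * real (count_list us i)"
  let ?P = "pair_pmf (ticks a us) (tape a b us)"
  have snd: "measure_pmf.prob ?P {x. R (snd x)} = measure_pmf.prob (tape a b us) {\<omega>. R \<omega>}" for R
    using prob_pair_Times[of "ticks a us" "tape a b us" UNIV "{\<omega>. R \<omega>}"] by (simp add: Collect_snd_Times)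
  have fst: "measure_pmf.prob ?P {x. R (fst x)} = measure_pmf.prob (ticks a us) {\<omega>. R \<omega>}" for R
    using prob_pair_Times[of "ticks a us" "tape a b us" "{\<omega>. R \<omega>}" UNIV] by (simp add: Collect_fst_Times)
  have b1: "measure_pmf.prob ?P {x. B \<le> samples (snd x) m} \<le> 1/16"
  proof -
    have "measure_pmf.prob ?P {x. B \<le> samples (snd x) m} \<le> (\<Sum>t<length us. a (us ! t)) / B"
      unfolding snd[of "\<lambda>\<omega>. B \<le> samples \<omega> m"] unfolding m_def
      by (rule prob_samples_ge[where a=a and b=b, OF a(1,2) b_bounds B(1)])
    also have "\<dots> \<le> 1/16" using B by (simp add: field_simps)
    finally show ?thesis .
  qed
  have b2: "measure_pmf.prob ?P {x. B \<le> clock (fst x) m} \<le> 1/16"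
  proof -
    have "measure_pmf.prob ?P {x. B \<le> clock (fst x) m} \<le> (\<Sum>t<length us. a (us ! t)) / B"
      unfolding fst[of "\<lambda>k. B \<le> clock k m"] unfolding m_def
      by (rule prob_clock_ge[where a=a and b=b, OF a(1,2) b_bounds B(1)])
    also have "\<dots> \<le> 1/16" using B by (simp add: field_simps)
    finally show ?thesis .
  qed
  have \<mu>pos: "0 < \<mu>"
    using acc i \<eta> a(1)[of i] unfolding \<mu>_def by (cases "a i = 0") auto
  have b3: "measure_pmf.prob ?P {x. real (hits us (snd x) i m) \<le> (1 - 3 * \<eta>) * \<mu>} \<le> 1/16"
  \<comment> \<open>At rate 1 every update is sampled and the count is exact even if it is small.
    Otherwise \<open>3 \<le> \<eta>\<^sup>2 * \<mu>\<close> makes the Chernoff bound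
    \<open>exp (- 3)\<close>.\<close>
  proof (cases "a i = 1")
    case False
    then have "3 \<le> \<eta>\<^sup>2 * \<mu>" using acc by (simp add: \<mu>_def)
    then have "exp (- \<eta>\<^sup>2 * \<mu>) \<le> exp (-3)" by simp
    also have "\<dots> \<le> (1/16::real)"
    proof -
      \<comment> \<open>\<open>1 + x + x\<^sup>2 / 2\<close> at \<open>x = 1/2\<close> is 13/8,
        whose sixth power exceeds 16.\<close>
      have "(16::real) \<le> (1 + 1/2 * 1 + 1/4/2) ^ 6" by (simp add: power_numeral_reduce)
      also have "\<dots> \<le> exp (1/2) ^ 6"
        using exp_lower_Taylor_quadratic[of "1/2"] by (intro power_mono) (auto simp: power2_eq_square)
      also have "\<dots> = exp 3" by (simp add: exp_of_nat_mult[symmetric])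
      finally show ?thesis by (simp add: exp_minus field_simps)
    qed
    finally show ?thesis
      using prob_hits_le[where a=a and b=b, OF a(1,2) b_bounds \<eta> \<mu>_def]
      unfolding snd[of "\<lambda>\<omega>. real (hits us \<omega> i m) \<le> (1 - 3 * \<eta>) * \<mu>"] unfolding m_def by linarith
  next
    case True
    let ?X = "{t. t < m \<and> us ! t = i}"
    have cX: "card ?X = count_list us i"
      by (simp add: m_def count_list_eq_length_filter length_filter_conv_card conj_commute eq_commute)
    have "measure_pmf.prob (tape a b us) {\<omega>. real (hits us \<omega> i m) \<le> (1 - 3 * \<eta>) * \<mu>} \<le>
      measure_pmf.prob (tape a b us) {\<omega>. \<exists>t\<in>?X. \<not> \<omega> t 0}"
    proof (rule prob_mono, rule ccontr)
      fix \<omega> :: "nat \<Rightarrow> nat \<Rightarrow> bool"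
      assume *: "real (hits us \<omega> i m) \<le> (1 - 3 * \<eta>) * \<mu>" "\<not> (\<exists>t\<in>?X. \<not> \<omega> t 0)"
      have "hits us \<omega> i m = card ?X" unfolding hits_def using *(2) by (intro arg_cong[where f=card]) auto
      then have "\<mu> \<le> (1 - 3 * \<eta>) * \<mu>" using *(1) True cX by (simp add: \<mu>_def)
      then have "\<eta> * \<mu> \<le> 0" by (simp add: algebra_simps)
      then show False using \<mu>pos \<eta>(1) by (simp add: mult_le_0_iff)
    qed
    also have "\<dots> \<le> (\<Sum>t\<in>?X. measure_pmf.prob (tape a b us) {\<omega>. \<not> \<omega> t 0})" by (rule prob_Ex_le) simp
    also have "\<dots> = 0"
    proof (rule sum.neutral, intro ballI)
      fix t assume "t \<in> ?X"
      then show "measure_pmf.prob (tape a b us) {\<omega>. \<not> \<omega> t 0} = 0"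
        using prob_tape[where a=a and b=b and us=us and A="{}" and N="{(t, 0)}", OF a(1,2) b_bounds] True by (simp add: m_def)
    qed
    finally show ?thesis unfolding snd[of "\<lambda>\<omega>. real (hits us \<omega> i m) \<le> (1 - 3 * \<eta>) * \<mu>"] by simp
  qed
  have b4: "measure_pmf.prob ?P {x. \<exists>t<m. first_hit us (snd x) i t \<and>
      cap \<le> card {\<tau>. \<tau> < t \<and> us ! \<tau> \<noteq> i \<and> snd x \<tau> 0 \<and> clock (fst x) \<tau> = clock (fst x) t}} \<le> 1/16"
  proof -
    have "measure_pmf.prob ?P {x. \<exists>t<m. first_hit us (snd x) i t \<and>
      cap \<le> card {\<tau>. \<tau> < t \<and> us ! \<tau> \<noteq> i \<and> snd x \<tau> 0 \<and> clock (fst x) \<tau> = clock (fst x) t}} \<le> 1 / real cap"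
      using prob_leaf_full[where a=a and b=b and us=us and i=i, OF a(1,2) b_bounds] cap unfolding m_def by (simp add: case_prod_unfold)
    also have "\<dots> \<le> 1/16" using cap by (simp add: field_simps)
    finally show ?thesis .
  qed
  let ?S = "\<lambda>z k \<omega>. \<exists>t<m. first_hit us \<omega> i t \<and> \<not> (\<exists>l<Lf. flagged us \<omega> (block k m z t) i t l \<and>
        card (competitors us \<omega> (block k m z t) i l) < \<kappa>)"
  have pm0: "0 \<le> pair_mass us w" unfolding pair_mass_def by (intro sum_nonneg) auto
  have b5: "measure_pmf.prob ?P {x. \<exists>z\<in>{..<Z}. ?S z (fst x) (snd x)} \<le> 1/8"
  proof -
    have "measure_pmf.prob ?P {x. \<exists>z\<in>{..<Z}. ?S z (fst x) (snd x)} \<le> (\<Sum>z<Z. measure_pmf.prob ?P {x. ?S z (fst x) (snd x)})"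
      by (rule prob_Ex_le) simp
    also have "\<dots> \<le> (\<Sum>z<Z. real m * exp (- \<rho>) + 2 * \<rho> * q\<^sup>2 * harm m * pair_mass us w / \<kappa>)"
    proof (rule sum_mono)
      fix z
      have "measure_pmf.prob ?P {(k, \<omega>). ?S z k \<omega>} \<le> real m * exp (- \<rho>) + 2 * \<rho> * q\<^sup>2 * harm m * pair_mass us w / \<kappa>"
      proof (rule prob_pair_le)
        show "measure_pmf.prob (tape a b us) {\<omega>. ?S z k \<omega>} \<le>
          real m * exp (- \<rho>) + 2 * \<rho> * q\<^sup>2 * harm m * pair_mass us w / \<kappa>" for k
          unfolding m_def by (rule prob_outcompeted[OF Lf])
        show "0 \<le> real m * exp (- \<rho>) + 2 * \<rho> * q\<^sup>2 * harm m * pair_mass us w / \<kappa>"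
          using \<rho> pm0 harm_nonneg[of m, where 'a=real] by (intro add_nonneg_nonneg divide_nonneg_nonneg mult_nonneg_nonneg) auto
      qed
      then show "measure_pmf.prob ?P {x. ?S z (fst x) (snd x)} \<le>
        real m * exp (- \<rho>) + 2 * \<rho> * q\<^sup>2 * harm m * pair_mass us w / \<kappa>" by (simp add: case_prod_unfold)
    qed
    also have "\<dots> = real Z * (real m * exp (- \<rho>)) + real Z * (2 * \<rho> * q\<^sup>2 * harm m * pair_mass us w / \<kappa>)"
      by (simp add: distrib_left)
    also have "\<dots> \<le> 1/16 + 1/16" unfolding m_def by (rule add_mono[OF l1 l2])
    finally show ?thesis by simp
  qed
  let ?good = "\<lambda>(S::nat, T::nat, E::held). \<exists>h F c. E i = Some (h, F, c) \<and> (1 - 3 * \<eta>) * \<mu> \<le> real c"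
  let ?r = "\<lambda>x. run us (fst x) (snd x) m"
  let ?b4 = "\<lambda>x. \<exists>t<m. first_hit us (snd x) i t \<and>
      cap \<le> card {\<tau>. \<tau> < t \<and> us ! \<tau> \<noteq> i \<and> snd x \<tau> 0 \<and> clock (fst x) \<tau> = clock (fst x) t}"
  have "measure_pmf.prob ?P {x. \<not> ?good (?r x)} \<le> measure_pmf.prob ?P {x. B \<le> samples (snd x) m \<or>
     B \<le> clock (fst x) m \<or> real (hits us (snd x) i m) \<le> (1 - 3 * \<eta>) * \<mu> \<or> ?b4 x \<or> (\<exists>z\<in>{..<Z}. ?S z (fst x) (snd x))}"
  proof (rule prob_mono, rule ccontr)
    fix x :: "(nat \<Rightarrow> bool) \<times> (nat \<Rightarrow> nat \<Rightarrow> bool)"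
    assume bad: "\<not> ?good (?r x)"
    assume h: "\<not> (B \<le> samples (snd x) m \<or> B \<le> clock (fst x) m \<or> real (hits us (snd x) i m) \<le> (1 - 3 * \<eta>) * \<mu> \<or>
      ?b4 x \<or> (\<exists>z\<in>{..<Z}. ?S z (fst x) (snd x)))"
    have g: "samples (snd x) m < B" "clock (fst x) m < B" "(1 - 3 * \<eta>) * \<mu> < real (hits us (snd x) i m)"
      using h by (meson not_le)+
    have g4: "\<not> ?b4 x" using h by blast
    have g5: "\<not> ?S z (fst x) (snd x)" if "z < Z" for z using h that by blast
    obtain k \<omega> where x: "x = (k, \<omega>)" by (cases x)
    have "0 \<le> (1 - 3 * \<eta>) * \<mu>" using \<eta> \<mu>pos by simp
    then have "0 < hits us \<omega> i m" using g(3) by (simp add: x)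
    then have "\<exists>t. t < m \<and> us ! t = i \<and> \<omega> t 0" unfolding hits_def by (auto simp: card_gt_0_iff)
    then obtain t where t: "t < m \<and> us ! t = i \<and> \<omega> t 0" "\<And>t'. t' < t \<Longrightarrow> \<not> (t' < m \<and> us ! t' = i \<and> \<omega> t' 0)"
      using exists_least_iff[of "\<lambda>t. t < m \<and> us ! t = i \<and> \<omega> t 0"] by auto
    have first: "first_hit us \<omega> i t" using t by (auto simp: first_hit_def)
    obtain S T E where r: "run us k \<omega> (length us) = (S, T, E)" by (cases "run us k \<omega> (length us)")
    have "\<exists>F. E i = Some (clock k t, F, hits us \<omega> i (length us))"
    proof (rule run_survives[OF _ _ _ first _ _ r])
      show "samples \<omega> (length us) < B" "clock k (length us) < B" "t < length us"
        using g t(1) by (simp_all add: x m_def)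
      show "card {\<tau>. \<tau> < t \<and> us ! \<tau> \<noteq> i \<and> \<omega> \<tau> 0 \<and> clock k \<tau> = clock k t} < cap"
        using g4 first t(1) by (auto simp: x not_le)
      fix z assume "2 ^ z \<le> B"
      then have "(2::nat) ^ z < 2 ^ Z" using B(2) by linarith
      then have "z < Z" by (rule power_less_imp_less_exp[rotated]) simp
      then show "\<exists>l<Lf. flagged us \<omega> (block k (length us) z t) i t l \<and>
        card (competitors us \<omega> (block k (length us) z t) i l) < \<kappa>"
        using g5[of z] first t(1) unfolding x m_def by auto
    qed
    then show False using bad g(3) r by (auto simp: x m_def)
  qed
  also have "\<dots> \<le> 1/16 + (1/16 + (1/16 + (1/16 + 1/8)))"
    by (intro order_trans[OF prob_or_le] add_mono b1 b2 b3 b4 b5)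
  finally have "measure_pmf.prob ?P {x. \<not> ?good (?r x)} \<le> 1/2" by simp
  moreover have "measure_pmf.prob ?P {x. \<not> ?good (?r x)} = 1 - measure_pmf.prob ?P {x. ?good (?r x)}"
    using measure_pmf.prob_compl[of "{x. ?good (?r x)}" ?P] by (simp add: Compl_eq_Diff_UNIV[symmetric] Collect_neg_eq)
  moreover have "measure_pmf.prob (fold_pmf (kern a b) (0, 0, Map.empty) us)
    {(S, T, E). \<exists>h F c. E i = Some (h, F, c) \<and> (1 - 3 * \<eta>) * (a i * real (count_list us i)) \<le> real c} =
     measure_pmf.prob ?P {x. ?good (?r x)}"
    unfolding fold_kern by (simp add: vimage_def case_prod_unfold m_def \<mu>_def)
  ultimately show ?thesis by simp
qed

end

lemma prob_overcount:
  assumes a: "\<And>u. 0 \<le> a u" "\<And>u. a u \<le> 1" and b: "\<And>u l. 0 \<le> b u l" "\<And>u l. b u l \<le> 1"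
    and \<eta>: "0 < \<eta>" "\<eta> \<le> 1/4" and M: "a i * real (count_list us i) \<le> M"
  shows "measure_pmf.prob (fold_pmf (kern a b) (0, 0, Map.empty) us)
    {(S, T, E). \<exists>h F c. E i = Some (h, F, c) \<and> (1 + 2 * \<eta>) * M \<le> real c} \<le> exp (- \<eta>\<^sup>2 * M / 2)"
proof -
  let ?P = "pair_pmf (ticks a us) (tape a b us)"
  let ?bad = "\<lambda>(S::nat, T::nat, E::held). \<exists>h F c. E i = Some (h, F, c) \<and> (1 + 2 * \<eta>) * M \<le> real c"
  have "measure_pmf.prob (fold_pmf (kern a b) (0, 0, Map.empty) us) {x. ?bad x} =
    measure_pmf.prob ?P {x. ?bad (run us (fst x) (snd x) (length us))}"
    unfolding fold_kern by (simp add: vimage_def case_prod_unfold)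
  also have "\<dots> \<le> measure_pmf.prob ?P {x. (1 + 2 * \<eta>) * M \<le> real (hits us (snd x) i (length us))}"
  proof (rule prob_mono)
    fix x assume *: "?bad (run us (fst x) (snd x) (length us))"
    obtain S T E where r: "run us (fst x) (snd x) (length us) = (S, T, E)" by (cases "run us (fst x) (snd x) (length us)")
    then obtain h F c where "E i = Some (h, F, c)" "(1 + 2 * \<eta>) * M \<le> real c" using * by auto
    then show "(1 + 2 * \<eta>) * M \<le> real (hits us (snd x) i (length us))"
      using run_hits[OF r] by (meson of_nat_le_iff order_trans)
  qed
  also have "\<dots> = measure_pmf.prob (tape a b us) {\<omega>. (1 + 2 * \<eta>) * M \<le> real (hits us \<omega> i (length us))}"
    using prob_pair_Times[of "ticks a us" "tape a b us" UNIV "{\<omega>. (1 + 2 * \<eta>) * M \<le> real (hits us \<omega> i (length us))}"]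
    by (simp add: Collect_snd_Times)
  also have "\<dots> \<le> exp (- \<eta>\<^sup>2 * M / 2)" by (rule prob_hits_ge[where a=a and b=b, OF a b \<eta> M])
  finally show ?thesis by (simp add: case_prod_unfold)
qed

end

section \<open>Pairwise independent hashing and threshold sampling\<close>

definition hash_pmf :: "nat \<Rightarrow> nat \<Rightarrow> (nat \<Rightarrow> nat) pmf" where
  "hash_pmf K M = Pi_pmf {..K} 0 (\<lambda>_. pmf_of_set {..<M})"

text \<open>
  The random subset sums of a random vector over the integers modulo \<open>M\<close>, selected by the binary digits
  of the key, are pairwise independent for arbitrary \<open>M\<close>.
\<close>

definition hash :: "nat \<Rightarrow> nat \<Rightarrow> (nat \<Rightarrow> nat) \<Rightarrow> nat \<Rightarrow> nat" where
  "hash K M g x = (g K + (\<Sum>k<K. if odd (x div 2 ^ k) then g k else 0)) mod M"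

lemma map_add_mod_uniform:
  assumes "0 < M"
  shows "map_pmf (\<lambda>a. (a + c) mod M) (pmf_of_set {..<M}) = pmf_of_set {..<M::nat}"
proof -
  have inj: "inj_on (\<lambda>a. (a + c) mod M) {..<M}"
  proof (rule inj_onI)
    fix a a' assume *: "a \<in> {..<M}" "a' \<in> {..<M}" "(a + c) mod M = (a' + c) mod M"
    \<comment> \<open>Adding \<open>M * c - c\<close> undoes the shift by \<open>c\<close> modulo
      \<open>M\<close> without leaving the natural numbers.\<close>
    have "((d + c) mod M + (M * c - c)) mod M = d" if "d < M" for d
    proof -
      have "c \<le> M * c" using assms by simp
      then have "(d + c) + (M * c - c) = d + M * c" by simp
      then have "((d + c) mod M + (M * c - c)) mod M = (d + M * c) mod M" by (metis mod_add_left_eq)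
      then show ?thesis using that by simp
    qed
    then show "a = a'" using * by (metis lessThan_iff)
  qed
  have "(\<lambda>a. (a + c) mod M) ` {..<M} = {..<M}"
    using assms by (intro endo_inj_surj inj) auto
  then show ?thesis using assms by (subst map_pmf_of_set_inj[OF inj]) auto
qed

text \<open>Fix all coefficients except \<open>g k\<close> and \<open>g K\<close>. The offset
  \<open>g K\<close> makes the hash of \<open>y\<close> uniform; \<open>g k\<close> enters only the
  hash of \<open>x\<close> and makes it uniform for every value of the offset.\<close>

lemma hash_pair_uniform_aux:
  assumes M: "0 < M" and k: "k < K" "odd (x div 2 ^ k)" "even (y div 2 ^ k)"
  shows "map_pmf (\<lambda>g. (hash K M g x, hash K M g y)) (hash_pmf K M) =
    pair_pmf (pmf_of_set {..<M}) (pmf_of_set {..<M})"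
proof -
  let ?U = "pmf_of_set {..<M}"
  let ?R = "{..<K} - {k}"
  let ?s = "\<lambda>f z. \<Sum>j\<in>?R. if odd (z div 2 ^ j) then f j else 0 :: nat"
  have idx: "{..K} = insert K (insert k ?R)" using k by auto
  have hs: "(\<Sum>j<K. if odd (z div 2 ^ j) then (f(k := a, K := b)) j else 0) =
    (if odd (z div 2 ^ k) then a else 0) + ?s f z" for f :: "nat \<Rightarrow> nat" and z a b
  proof -
    have "{..<K} = insert k ?R" using k by auto
    then have "(\<Sum>j<K. if odd (z div 2 ^ j) then (f(k := a, K := b)) j else 0) =
      (if odd (z div 2 ^ k) then (f(k := a, K := b)) k else 0) + (\<Sum>j\<in>?R. if odd (z div 2 ^ j) then (f(k := a, K := b)) j else 0)"
      by (metis (no_types, lifting) finite_Diff finite_lessThan sum.insert Diff_iff insertI1)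
    also have "(\<Sum>j\<in>?R. if odd (z div 2 ^ j) then (f(k := a, K := b)) j else 0) = ?s f z"
      by (rule sum.cong) auto
    finally show ?thesis using k by simp
  qed
  have h: "hash K M (f(k := a, K := b)) x = (a + (b + ?s f x)) mod M"
    "hash K M (f(k := a, K := b)) y = (b + ?s f y) mod M" for f a b
    unfolding hash_def hs using k by (simp_all add: add_ac)
  have f1: "finite (insert k ?R)" "K \<notin> insert k ?R" and f2: "finite ?R" "k \<notin> ?R" using k by auto
  have hp: "hash_pmf K M = bind_pmf ?U (\<lambda>b. bind_pmf ?U (\<lambda>a. bind_pmf (Pi_pmf ?R 0 (\<lambda>_. ?U))
      (\<lambda>f. return_pmf (f(k := a, K := b)))))"
    unfolding hash_pmf_def idx
    by (simp only: Pi_pmf_insert'[OF f1] Pi_pmf_insert'[OF f2] bind_assoc_pmf bind_return_pmf)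
  have "map_pmf (\<lambda>g. (hash K M g x, hash K M g y)) (hash_pmf K M) =
    bind_pmf ?U (\<lambda>b. bind_pmf ?U (\<lambda>a. bind_pmf (Pi_pmf ?R 0 (\<lambda>_. ?U))
      (\<lambda>f. return_pmf ((a + (b + ?s f x)) mod M, (b + ?s f y) mod M))))"
    unfolding hp by (simp only: map_bind_pmf map_return_pmf h)
  also have "\<dots> = bind_pmf (Pi_pmf ?R 0 (\<lambda>_. ?U)) (\<lambda>f. bind_pmf ?U (\<lambda>b. bind_pmf ?U
      (\<lambda>a. return_pmf ((a + (b + ?s f x)) mod M, (b + ?s f y) mod M))))"
    by (subst (2) bind_commute_pmf, subst bind_commute_pmf) (rule refl)
  also have "\<dots> = bind_pmf (Pi_pmf ?R 0 (\<lambda>_. ?U)) (\<lambda>f. pair_pmf ?U ?U)"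
  proof (rule bind_pmf_cong[OF refl])
    fix f
    have "bind_pmf ?U (\<lambda>a. return_pmf ((a + (b + ?s f x)) mod M, (b + ?s f y) mod M)) =
      map_pmf (\<lambda>X. (X, (b + ?s f y) mod M)) ?U" for b
    proof -
      have "bind_pmf ?U (\<lambda>a. return_pmf ((a + (b + ?s f x)) mod M, (b + ?s f y) mod M)) =
        map_pmf (\<lambda>X. (X, (b + ?s f y) mod M)) (map_pmf (\<lambda>a. (a + (b + ?s f x)) mod M) ?U)"
        by (simp add: map_pmf_def bind_assoc_pmf bind_return_pmf)
      then show ?thesis by (simp add: map_add_mod_uniform[OF M])
    qed
    then have "bind_pmf ?U (\<lambda>b. bind_pmf ?U (\<lambda>a. return_pmf ((a + (b + ?s f x)) mod M, (b + ?s f y) mod M))) =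
      bind_pmf (map_pmf (\<lambda>b. (b + ?s f y) mod M) ?U) (\<lambda>c. map_pmf (\<lambda>X. (X, c)) ?U)"
      by (simp add: bind_map_pmf)
    also have "\<dots> = bind_pmf ?U (\<lambda>c. map_pmf (\<lambda>X. (X, c)) ?U)" by (simp add: map_add_mod_uniform[OF M])
    also have "\<dots> = pair_pmf ?U ?U"
      unfolding pair_pmf_def map_pmf_def by (rule bind_commute_pmf)
    finally show "bind_pmf ?U (\<lambda>b. bind_pmf ?U (\<lambda>a. return_pmf ((a + (b + ?s f x)) mod M, (b + ?s f y) mod M))) = pair_pmf ?U ?U" .
  qed
  finally show ?thesis by simp
qed

lemma exists_distinguishing_bit:
  fixes x y :: nat
  assumes "x < 2 ^ K" "y < 2 ^ K" "x \<noteq> y"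
  shows "\<exists>k<K. odd (x div 2 ^ k) \<noteq> odd (y div 2 ^ k)"
proof (rule ccontr)
  assume *: "\<not> ?thesis"
  have "bit x k = bit y k" for k
  proof (cases "k < K")
    case False
    then have "(2::nat) ^ K \<le> 2 ^ k" by simp
    then have "x < 2 ^ k" "y < 2 ^ k" using assms by linarith+
    then have "x div 2 ^ k = 0" "y div 2 ^ k = 0" by simp_all
    then show ?thesis by (simp add: bit_iff_odd)
  qed (use * in \<open>auto simp: bit_iff_odd\<close>)
  then show False using assms(3) bit_eq_iff[of x y] by simp
qed

lemma hash_pair_uniform:
  assumes "0 < M" "x < 2 ^ K" "y < 2 ^ K" "x \<noteq> y"
  shows "map_pmf (\<lambda>g. (hash K M g x, hash K M g y)) (hash_pmf K M) =
    pair_pmf (pmf_of_set {..<M}) (pmf_of_set {..<M})"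
proof -
  obtain k where k: "k < K" "odd (x div 2 ^ k) \<noteq> odd (y div 2 ^ k)"
    using exists_distinguishing_bit[OF assms(2-4)] by auto
  show ?thesis
  proof (cases "odd (x div 2 ^ k)")
    case True
    then show ?thesis using hash_pair_uniform_aux[OF assms(1) k(1)] k(2) by simp
  next
    case False
    let ?U = "pmf_of_set {..<M}"
    have "map_pmf (\<lambda>g. (hash K M g x, hash K M g y)) (hash_pmf K M) =
      map_pmf (\<lambda>(u, v). (v, u)) (map_pmf (\<lambda>g. (hash K M g y, hash K M g x)) (hash_pmf K M))"
      by (simp add: pmf.map_comp o_def)
    also have "\<dots> = map_pmf (\<lambda>(u, v). (v, u)) (pair_pmf ?U ?U)"
      using hash_pair_uniform_aux[OF assms(1) k(1), of y x] k(2) False by simp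
    also have "\<dots> = pair_pmf ?U ?U" by (rule pair_commute_pmf[symmetric])
    finally show ?thesis .
  qed
qed

text \<open>Key 0 serves as a partner, so that the claim is a marginal of the pair statement. Items
  start at 1 and never equal this key.\<close>

lemma hash_uniform:
  assumes "0 < M" "x < 2 ^ K" "x \<noteq> 0"
  shows "map_pmf (\<lambda>g. hash K M g x) (hash_pmf K M) = pmf_of_set {..<M}"
proof -
  have "map_pmf (\<lambda>g. hash K M g x) (hash_pmf K M) = map_pmf fst (map_pmf (\<lambda>g. (hash K M g x, hash K M g 0)) (hash_pmf K M))"
    by (simp add: pmf.map_comp o_def)
  also have "\<dots> = pmf_of_set {..<M}"
    using assms by (subst hash_pair_uniform) (auto simp: map_fst_pair_pmf)
  finally show ?thesis .
qed

lemma finite_set_hash_pmf: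
  assumes "0 < M"
  shows "finite (set_pmf (hash_pmf K M))" "card (set_pmf (hash_pmf K M)) = M ^ Suc K"
proof -
  have e: "set_pmf (hash_pmf K M) = PiE_dflt {..K} 0 (\<lambda>_. {..<M})"
    unfolding hash_pmf_def using assms by (subst set_Pi_pmf) (auto simp: o_def set_pmf_of_set lessThan_empty_iff)
  show "finite (set_pmf (hash_pmf K M))" unfolding e by auto
  show "card (set_pmf (hash_pmf K M)) = M ^ Suc K" unfolding e by (subst card_PiE_dflt) auto
qed

lemma expectation_hash:
  fixes \<psi> :: "nat \<Rightarrow> real"
  assumes "0 < M" "x < 2 ^ K" "x \<noteq> 0"
  shows "measure_pmf.expectation (hash_pmf K M) (\<lambda>g. \<psi> (hash K M g x)) = (\<Sum>h<M. \<psi> h) / M"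
proof -
  have "measure_pmf.expectation (hash_pmf K M) (\<lambda>g. \<psi> (hash K M g x)) =
    measure_pmf.expectation (map_pmf (\<lambda>g. hash K M g x) (hash_pmf K M)) \<psi>" by simp
  also have "\<dots> = (\<Sum>h<M. \<psi> h) / M"
    unfolding hash_uniform[OF assms] using assms by (subst integral_pmf_of_set) (auto simp: lessThan_empty_iff)
  finally show ?thesis .
qed

lemma pair_pmf_of_set:
  assumes "finite A" "A \<noteq> {}" "finite C" "C \<noteq> {}"
  shows "pair_pmf (pmf_of_set A) (pmf_of_set C) = pmf_of_set (A \<times> C)"
proof (rule pmf_eqI)
  fix z
  show "pmf (pair_pmf (pmf_of_set A) (pmf_of_set C)) z = pmf (pmf_of_set (A \<times> C)) z"
    using assms by (cases z) (auto simp: pmf_pair indicator_def card_cartesian_product)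
qed

lemma expectation_hash_pair:
  fixes \<psi> \<phi> :: "nat \<Rightarrow> real"
  assumes "0 < M" "x < 2 ^ K" "y < 2 ^ K" "x \<noteq> y"
  shows "measure_pmf.expectation (hash_pmf K M) (\<lambda>g. \<psi> (hash K M g x) * \<phi> (hash K M g y)) =
    ((\<Sum>h<M. \<psi> h) / M) * ((\<Sum>h<M. \<phi> h) / M)"
proof -
  have "measure_pmf.expectation (hash_pmf K M) (\<lambda>g. \<psi> (hash K M g x) * \<phi> (hash K M g y)) =
    measure_pmf.expectation (map_pmf (\<lambda>g. (hash K M g x, hash K M g y)) (hash_pmf K M)) (\<lambda>(u, v). \<psi> u * \<phi> v)" by simp
  also have "\<dots> = measure_pmf.expectation (pmf_of_set ({..<M} \<times> {..<M})) (\<lambda>(u, v). \<psi> u * \<phi> v)"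
    unfolding hash_pair_uniform[OF assms] using assms by (subst pair_pmf_of_set) (auto simp: lessThan_empty_iff)
  also have "\<dots> = (\<Sum>(u, v)\<in>{..<M} \<times> {..<M}. \<psi> u * \<phi> v) / (real M * real M)"
    using assms by (subst integral_pmf_of_set) (auto simp: lessThan_empty_iff card_cartesian_product)
  also have "(\<Sum>(u, v)\<in>{..<M} \<times> {..<M}. \<psi> u * \<phi> v) = (\<Sum>h<M. \<psi> h) * (\<Sum>h<M. \<phi> h)"
    by (simp add: sum_product sum.cartesian_product)
  finally show ?thesis by simp
qed

text \<open>In the expanded square all mixed terms vanish, so pairwise independence suffices. This
  is what allows a seed short enough to be stored.\<close>

lemma chebyshev_pairwise:
  fixes X :: "'i \<Rightarrow> 'a \<Rightarrow> real"
  assumes fin: "finite (set_pmf P)" "finite I"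
    and e: "\<And>i. i \<in> I \<Longrightarrow> measure_pmf.expectation P (\<lambda>g. (X i g - e i)\<^sup>2) \<le> s i"
    and c: "\<And>i j. i \<in> I \<Longrightarrow> j \<in> I \<Longrightarrow> i \<noteq> j \<Longrightarrow> measure_pmf.expectation P (\<lambda>g. (X i g - e i) * (X j g - e j)) = 0"
    and \<delta>: "0 < \<delta>"
  shows "measure_pmf.prob P {g. \<delta> \<le> \<bar>(\<Sum>i\<in>I. X i g) - (\<Sum>i\<in>I. e i)\<bar>} \<le> (\<Sum>i\<in>I. s i) / \<delta>\<^sup>2"
proof -
  have int: "integrable (measure_pmf P) f" for f :: "'a \<Rightarrow> real"
    by (rule integrable_measure_pmf_finite[OF fin(1)])
  let ?D = "\<lambda>i g. X i g - e i"
  have sq: "((\<Sum>i\<in>I. X i g) - (\<Sum>i\<in>I. e i))\<^sup>2 = (\<Sum>i\<in>I. \<Sum>j\<in>I. ?D i g * ?D j g)" for g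
    by (simp add: sum_subtractf[symmetric] power2_eq_square sum_product)
  have "measure_pmf.expectation P (\<lambda>g. ((\<Sum>i\<in>I. X i g) - (\<Sum>i\<in>I. e i))\<^sup>2) =
    (\<Sum>i\<in>I. \<Sum>j\<in>I. measure_pmf.expectation P (\<lambda>g. ?D i g * ?D j g))"
    unfolding sq using int by (simp add: Bochner_Integration.integral_sum)
  also have "\<dots> \<le> (\<Sum>i\<in>I. s i)"
  proof (rule sum_mono)
    fix i assume i: "i \<in> I"
    have "(\<Sum>j\<in>I. measure_pmf.expectation P (\<lambda>g. ?D i g * ?D j g)) =
      measure_pmf.expectation P (\<lambda>g. ?D i g * ?D i g) + (\<Sum>j\<in>I - {i}. measure_pmf.expectation P (\<lambda>g. ?D i g * ?D j g))"
      using fin(2) i by (rule sum.remove)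
    also have "(\<Sum>j\<in>I - {i}. measure_pmf.expectation P (\<lambda>g. ?D i g * ?D j g)) = 0"
      using c i by (intro sum.neutral) auto
    finally show "(\<Sum>j\<in>I. measure_pmf.expectation P (\<lambda>g. ?D i g * ?D j g)) \<le> s i"
      using e[OF i] by (simp add: power2_eq_square)
  qed
  finally have E: "measure_pmf.expectation P (\<lambda>g. ((\<Sum>i\<in>I. X i g) - (\<Sum>i\<in>I. e i))\<^sup>2) \<le> (\<Sum>i\<in>I. s i)" .
  have "measure_pmf.prob P {g. \<delta> \<le> \<bar>(\<Sum>i\<in>I. X i g) - (\<Sum>i\<in>I. e i)\<bar>} \<le>
    measure_pmf.prob P {g. \<delta>\<^sup>2 \<le> ((\<Sum>i\<in>I. X i g) - (\<Sum>i\<in>I. e i))\<^sup>2}"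
    using \<delta> by (intro prob_mono) (auto simp: abs_le_square_iff[symmetric])
  also have "\<dots> \<le> measure_pmf.expectation P (\<lambda>g. ((\<Sum>i\<in>I. X i g) - (\<Sum>i\<in>I. e i))\<^sup>2) / \<delta>\<^sup>2"
    using \<delta> int by (intro prob_markov) auto
  also have "\<dots> \<le> (\<Sum>i\<in>I. s i) / \<delta>\<^sup>2" using E by (intro divide_right_mono) auto
  finally show ?thesis .
qed

section \<open>Threshold sampling\<close>

text \<open>The shift by 1 keeps the value at least \<open>1 / M\<close>, so the weights, its
  negative powers, stay bounded.\<close>

definition unit_hash :: "nat \<Rightarrow> nat \<Rightarrow> (nat \<Rightarrow> nat) \<Rightarrow> nat \<Rightarrow> real" where
  "unit_hash K M g x = (real (hash K M g x) + 1) / real M"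

lemma unit_hash_bounds:
  assumes "0 < M"
  shows "1 / real M \<le> unit_hash K M g x" "unit_hash K M g x \<le> 1" "0 < unit_hash K M g x"
proof -
  have "hash K M g x < M" using assms by (simp add: hash_def)
  then show "1 / real M \<le> unit_hash K M g x" "unit_hash K M g x \<le> 1" "0 < unit_hash K M g x"
    using assms by (auto simp: unit_hash_def field_simps)
qed

text \<open>The Horvitz-Thompson estimator of \<open>y\<close> under threshold sampling: for
  \<open>U\<close> uniform on the unit interval the item is kept with probability
  \<open>min 1 (y / v)\<close> and then contributes \<open>y\<close> divided by this probability,
  which is \<open>max y v\<close>.\<close>

definition threshold :: "real \<Rightarrow> real \<Rightarrow> real \<Rightarrow> real" where
  "threshold v U y = (if v * U \<le> y then max y v else 0)"

lemma threshold_nonneg: "0 \<le> v \<Longrightarrow> 0 \<le> threshold v U y"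
  by (auto simp: threshold_def)

lemma threshold_mono: "y \<le> y' \<Longrightarrow> 0 \<le> v \<Longrightarrow> threshold v U y \<le> threshold v U y'"
  by (auto simp: threshold_def)

lemma card_Suc_le_real:
  assumes "0 \<le> r" "r \<le> real M"
  shows "card {h. h < M \<and> real h + 1 \<le> r} = nat \<lfloor>r\<rfloor>"
proof -
  have "{h. h < M \<and> real h + 1 \<le> r} = {..<nat \<lfloor>r\<rfloor>}"
  proof (intro equalityI subsetI)
    fix h assume "h \<in> {h. h < M \<and> real h + 1 \<le> r}"
    then show "h \<in> {..<nat \<lfloor>r\<rfloor>}" by (simp add: le_floor_iff zless_nat_eq_int_zless) linarith
  next
    fix h assume "h \<in> {..<nat \<lfloor>r\<rfloor>}"
    then have "int h + 1 \<le> \<lfloor>r\<rfloor>" by simp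
    then have "real h + 1 \<le> r" by (simp add: le_floor_iff)
    then show "h \<in> {h. h < M \<and> real h + 1 \<le> r}" using assms(2) by simp
  qed
  then show ?thesis by simp
qed

text \<open>The grid of hash values rounds the inclusion probability down by at most
  \<open>1 / M\<close>, whence the bias \<open>v / M\<close>. For \<open>v \<le> y\<close> the item
  is always kept and there is no variance; otherwise the second moment is at most
  \<open>v\<^sup>2 * (y / v)\<close>.\<close>

lemma threshold_moments:
  assumes M: "0 < M" and v: "0 < v" and y: "0 \<le> y"
  defines "\<psi> \<equiv> \<lambda>h. threshold v ((real h + 1) / real M) y"
  defines "e \<equiv> (\<Sum>h<M. \<psi> h) / real M"
  shows "e \<le> y" "y - v / real M \<le> e" "(\<Sum>h<M. (\<psi> h - e)\<^sup>2) / real M \<le> v * y"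
proof -
  have M0: "0 < real M" using M by simp
  have "e \<le> y \<and> y - v / real M \<le> e \<and> (\<Sum>h<M. (\<psi> h - e)\<^sup>2) / real M \<le> v * y"
  proof (cases "v \<le> y")
    case True
    have "\<psi> h = y" if "h < M" for h
    proof -
      have "v * ((real h + 1) / real M) \<le> v * 1" using that M v by (intro mult_left_mono) (auto simp: field_simps)
      then show ?thesis using True by (simp add: \<psi>_def threshold_def)
    qed
    then have "e = y" "(\<Sum>h<M. (\<psi> h - e)\<^sup>2) = (\<Sum>h<M. (y - e)\<^sup>2)" using M by (simp_all add: e_def)
    then show ?thesis using v y M by simp
  next
    case False
    define r where "r = real M * y / v"
    have r: "0 \<le> r" "r \<le> real M" using False v y M0 by (auto simp: r_def field_simps)
    \<comment> \<open>The number of those among the \<open>M\<close> hash values that keep the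
      item.\<close>
    define N where "N = real (nat \<lfloor>r\<rfloor>)"
    have N: "0 \<le> N" "N \<le> r" "r - 1 \<le> N" using r unfolding N_def by (auto simp: of_nat_nat)
    have \<psi>: "\<psi> h = (if real h + 1 \<le> r then v else 0)" for h
      using False v M0 by (auto simp: \<psi>_def threshold_def r_def field_simps)
    have S: "(\<Sum>h<M. if real h + 1 \<le> r then c else 0) = N * c" for c :: real
      using card_Suc_le_real[OF r] by (simp add: sum.If_cases N_def Int_def lessThan_def conj_commute)
    have e: "e = N * v / M" by (simp add: e_def \<psi> S)
    have "(\<Sum>h<M. (\<psi> h - e)\<^sup>2) = (\<Sum>h<M. (\<psi> h)\<^sup>2) - 2 * e * (\<Sum>h<M. \<psi> h) + real M * e\<^sup>2"
      by (simp add: power2_diff sum.distrib sum_subtractf sum_distrib_left mult_ac)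
    also have "(\<Sum>h<M. \<psi> h) = real M * e" using M by (simp add: e_def)
    also have "(\<Sum>h<M. (\<psi> h)\<^sup>2) = N * v\<^sup>2"
      using S[of "v\<^sup>2"] by (simp add: \<psi> if_distrib[of "\<lambda>x. x\<^sup>2"] cong: if_cong)
    finally have "(\<Sum>h<M. (\<psi> h - e)\<^sup>2) \<le> N * v\<^sup>2"
      using mult_nonneg_nonneg[OF less_imp_le[OF M0] zero_le_power2[of e]] by (simp add: power2_eq_square mult_ac)
    also have "\<dots> \<le> r * v\<^sup>2" using N by (intro mult_right_mono) auto
    also have "\<dots> = real M * (v * y)" using v by (simp add: r_def power2_eq_square)
    finally have 3: "(\<Sum>h<M. (\<psi> h - e)\<^sup>2) / real M \<le> v * y" using M0 by (simp add: field_simps)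
    have "N * v \<le> r * v" "(r - 1) * v \<le> N * v" using N v by (auto intro!: mult_right_mono)
    moreover have "r * v = real M * y" using v by (simp add: r_def)
    ultimately have "N * v \<le> real M * y" "real M * y - v \<le> N * v" by (simp_all add: left_diff_distrib)
    then have "N * v / real M \<le> real M * y / real M" "(real M * y - v) / real M \<le> N * v / real M"
      by (intro divide_right_mono; simp)+
    then have "e \<le> y" "y - v / real M \<le> e" using M0 by (simp_all add: e diff_divide_distrib)
    then show ?thesis using 3 by simp
  qed
  then show "e \<le> y" "y - v / real M \<le> e" "(\<Sum>h<M. (\<psi> h - e)\<^sup>2) / real M \<le> v * y" by auto
qed

context
  fixes K M n :: nat and y :: "nat \<Rightarrow> real"
  assumes M: "0 < M" and n: "n < 2 ^ K" and y: "\<And>i. 0 \<le> y i"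
begin

text \<open>Chebyshev is applied around the exact means on the grid; their total bias
  \<open>n * v / M\<close> is added to the deviation.\<close>

lemma threshold_sum_concentrated:
  assumes v: "0 < v" and \<delta>: "0 < \<delta>"
  shows "measure_pmf.prob (hash_pmf K M) {g. \<delta> + real n * v / real M \<le>
      \<bar>(\<Sum>i=1..n. threshold v (unit_hash K M g i) (y i)) - (\<Sum>i=1..n. y i)\<bar>} \<le> v * (\<Sum>i=1..n. y i) / \<delta>\<^sup>2"
proof -
  define \<psi> where "\<psi> i h = threshold v ((real h + 1) / real M) (y i)" for i h
  define e where "e i = (\<Sum>h<M. \<psi> i h) / real M" for i
  have X: "threshold v (unit_hash K M g i) (y i) = \<psi> i (hash K M g i)" for g i
    by (simp add: \<psi>_def unit_hash_def)
  have em: "e i \<le> y i" "y i - v / real M \<le> e i" "(\<Sum>h<M. (\<psi> i h - e i)\<^sup>2) / real M \<le> v * y i" for i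
    using threshold_moments[OF M v y[of i]] unfolding e_def \<psi>_def by blast+
  have ctr: "(\<Sum>h<M. \<psi> i h - e i) = 0" for i using M by (simp add: e_def sum_subtractf)
  have "measure_pmf.prob (hash_pmf K M) {g. \<delta> + real n * v / real M \<le>
      \<bar>(\<Sum>i=1..n. threshold v (unit_hash K M g i) (y i)) - (\<Sum>i=1..n. y i)\<bar>} \<le>
    measure_pmf.prob (hash_pmf K M) {g. \<delta> \<le> \<bar>(\<Sum>i=1..n. \<psi> i (hash K M g i)) - (\<Sum>i=1..n. e i)\<bar>}"
  proof (rule prob_mono)
    fix g
    assume *: "\<delta> + real n * v / real M \<le> \<bar>(\<Sum>i=1..n. threshold v (unit_hash K M g i) (y i)) - (\<Sum>i=1..n. y i)\<bar>"
    have "(\<Sum>i=1..n. e i) \<le> (\<Sum>i=1..n. y i)" by (intro sum_mono em)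
    moreover have "(\<Sum>i=1..n. y i - v / real M) \<le> (\<Sum>i=1..n. e i)" by (intro sum_mono em)
    ultimately have "\<bar>(\<Sum>i=1..n. e i) - (\<Sum>i=1..n. y i)\<bar> \<le> real n * v / real M"
      by (simp add: sum_subtractf)
    then show "\<delta> \<le> \<bar>(\<Sum>i=1..n. \<psi> i (hash K M g i)) - (\<Sum>i=1..n. e i)\<bar>" using * unfolding X by linarith
  qed
  also have "\<dots> \<le> (\<Sum>i=1..n. v * y i) / \<delta>\<^sup>2"
  proof (rule chebyshev_pairwise)
    show "finite (set_pmf (hash_pmf K M))" by (rule finite_set_hash_pmf[OF M])
    show "measure_pmf.expectation (hash_pmf K M) (\<lambda>g. (\<psi> i (hash K M g i) - e i)\<^sup>2) \<le> v * y i" if "i \<in> {1..n}" for i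
      using that n em(3)[of i] by (subst expectation_hash[OF M]) auto
    show "measure_pmf.expectation (hash_pmf K M) (\<lambda>g. (\<psi> i (hash K M g i) - e i) * (\<psi> j (hash K M g j) - e j)) = 0"
      if "i \<in> {1..n}" "j \<in> {1..n}" "i \<noteq> j" for i j
      using that n ctr by (subst expectation_hash_pair[OF M]) auto
  qed (use \<delta> in auto)
  finally show ?thesis by (simp add: sum_distrib_left)
qed

lemma expectation_hash_sum:
  fixes \<psi> :: "nat \<Rightarrow> nat \<Rightarrow> real"
  shows "measure_pmf.expectation (hash_pmf K M) (\<lambda>g. \<Sum>i=1..n. \<psi> i (hash K M g i)) = (\<Sum>i=1..n. (\<Sum>h<M. \<psi> i h) / M)"
proof -
  have int: "integrable (measure_pmf (hash_pmf K M)) f" for f :: "_ \<Rightarrow> real"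
    by (rule integrable_measure_pmf_finite[OF finite_set_hash_pmf(1)[OF M]])
  have "measure_pmf.expectation (hash_pmf K M) (\<lambda>g. \<Sum>i=1..n. \<psi> i (hash K M g i)) =
    (\<Sum>i=1..n. measure_pmf.expectation (hash_pmf K M) (\<lambda>g. \<psi> i (hash K M g i)))"
    using int by (simp add: Bochner_Integration.integral_sum)
  also have "\<dots> = (\<Sum>i=1..n. (\<Sum>h<M. \<psi> i h) / M)"
    using n by (intro sum.cong expectation_hash[OF M]) auto
  finally show ?thesis .
qed

text \<open>Meant for guesses whose \<open>v\<close> is too large for a useful variance bound. There
  it is enough that the estimate is not much too large, and the mean yields that.\<close>

lemma threshold_sum_markov:
  assumes v: "0 < v" and c: "0 < c"
  shows "measure_pmf.prob (hash_pmf K M) {g. c \<le> (\<Sum>i=1..n. threshold v (unit_hash K M g i) (y i))} \<le> (\<Sum>i=1..n. y i) / c"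
proof -
  have int: "integrable (measure_pmf (hash_pmf K M)) f" for f :: "_ \<Rightarrow> real"
    by (rule integrable_measure_pmf_finite[OF finite_set_hash_pmf(1)[OF M]])
  have "measure_pmf.prob (hash_pmf K M) {g. c \<le> (\<Sum>i=1..n. threshold v (unit_hash K M g i) (y i))} \<le>
    measure_pmf.expectation (hash_pmf K M) (\<lambda>g. \<Sum>i=1..n. threshold v (unit_hash K M g i) (y i)) / c"
    using int v c by (intro prob_markov sum_nonneg threshold_nonneg) auto
  also have "\<dots> = (\<Sum>i=1..n. (\<Sum>h<M. threshold v ((real h + 1) / real M) (y i)) / M) / c"
    unfolding unit_hash_def by (subst expectation_hash_sum) (rule refl)
  also have "\<dots> \<le> (\<Sum>i=1..n. y i) / c"
    using c by (intro divide_right_mono sum_mono threshold_moments(1)[OF M v y]) auto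
  finally show ?thesis .
qed

text \<open>The mean of \<open>1 / U\<close> over the grid is the harmonic number of
  \<open>M\<close>. For \<open>y i\<close> the power \<open>f\<^sub>i\<^sup>p\<close> this bounds
  the moment of the rescaled frequencies and is the source of its logarithmic factor.\<close>

lemma inverse_hash_sum_markov:
  assumes c: "0 < c"
  shows "measure_pmf.prob (hash_pmf K M) {g. c \<le> (\<Sum>i=1..n. y i / unit_hash K M g i)} \<le> harm M * (\<Sum>i=1..n. y i) / c"
proof -
  have int: "integrable (measure_pmf (hash_pmf K M)) f" for f :: "_ \<Rightarrow> real"
    by (rule integrable_measure_pmf_finite[OF finite_set_hash_pmf(1)[OF M]])
  have "measure_pmf.prob (hash_pmf K M) {g. c \<le> (\<Sum>i=1..n. y i / unit_hash K M g i)} \<le>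
    measure_pmf.expectation (hash_pmf K M) (\<lambda>g. \<Sum>i=1..n. y i / unit_hash K M g i) / c"
    using int c y unit_hash_bounds(3)[OF M] by (intro prob_markov sum_nonneg divide_nonneg_pos) auto
  also have "\<dots> = (\<Sum>i=1..n. (\<Sum>h<M. y i / ((real h + 1) / real M)) / M) / c"
    unfolding unit_hash_def by (subst expectation_hash_sum) (rule refl)
  also have "(\<Sum>i=1..n. (\<Sum>h<M. y i / ((real h + 1) / real M)) / M) = (\<Sum>i=1..n. y i * harm M)"
  proof (rule sum.cong[OF refl])
    fix i
    have "(\<Sum>h<M. y i / ((real h + 1) / real M)) / M = y i * (\<Sum>h<M. 1 / (real h + 1))"
      using M by (simp add: sum_distrib_left sum_divide_distrib)
    also have "(\<Sum>h<M. 1 / (real h + 1)) = (\<Sum>h=1..M. 1 / real h)"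
      by (rule sum.reindex_bij_witness[of _ "\<lambda>h. h - 1" Suc]) (auto simp: of_nat_diff)
    finally show "(\<Sum>h<M. y i / ((real h + 1) / real M)) / M = y i * harm M"
      by (simp add: harm_def inverse_eq_divide)
  qed
  finally show ?thesis by (simp add: sum_distrib_left mult.commute)
qed

end

section \<open>The moment sketch\<close>

lemma fold_parallel:
  assumes I: "finite I" and "\<And>i. i \<notin> I \<Longrightarrow> \<sigma> i = d"
  shows "fold_pmf (\<lambda>\<sigma> u. Pi_pmf I d (\<lambda>i. k i (\<sigma> i) u)) \<sigma> us = Pi_pmf I d (\<lambda>i. fold_pmf (k i) (\<sigma> i) us)"
  using assms(2)
proof (induction us arbitrary: \<sigma>)
  case Nil
  then have "(\<lambda>x. if x \<in> I then \<sigma> x else d) = \<sigma>" by auto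
  then show ?case using I by simp
next
  case (Cons u us)
  let ?K = "\<lambda>\<sigma> u. Pi_pmf I d (\<lambda>i. k i (\<sigma> i) u)"
  have "fold_pmf ?K \<sigma> (u # us) = bind_pmf (?K \<sigma> u) (\<lambda>\<sigma>'. Pi_pmf I d (\<lambda>i. fold_pmf (k i) (\<sigma>' i) us))"
    unfolding fold_pmf.simps
  proof (rule bind_pmf_cong[OF refl])
    fix \<sigma>' assume "\<sigma>' \<in> set_pmf (?K \<sigma> u)"
    then have "\<sigma>' i = d" if "i \<notin> I" for i using set_Pi_pmf_subset[OF I] that by fastforce
    then show "fold_pmf ?K \<sigma>' us = Pi_pmf I d (\<lambda>i. fold_pmf (k i) (\<sigma>' i) us)" by (rule Cons.IH)
  qed
  also have "\<dots> = Pi_pmf I d (\<lambda>i. fold_pmf (k i) (\<sigma> i) (u # us))"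
    using Pi_pmf_bind[OF I, of d "\<lambda>i. k i (\<sigma> i) u" "\<lambda>i y. fold_pmf (k i) y us" d] by simp
  finally show ?case .
qed

lemma sum_stream:
  fixes h :: "nat \<Rightarrow> real"
  assumes "set us \<subseteq> {1..n}"
  shows "(\<Sum>t<length us. h (us ! t)) = (\<Sum>i=1..n. real (count_list us i) * h i)"
proof -
  have "(\<Sum>t<length us. h (us ! t)) = (\<Sum>i=1..n. \<Sum>t\<in>{t\<in>{..<length us}. us ! t = i}. h (us ! t))"
    using assms by (intro sum.group[symmetric]) auto
  also have "\<dots> = (\<Sum>i=1..n. real (count_list us i) * h i)"
  proof (rule sum.cong[OF refl])
    fix i
    have "card {t\<in>{..<length us}. us ! t = i} = count_list us i"
      by (simp add: count_list_eq_length_filter length_filter_conv_card eq_commute)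
    then show "(\<Sum>t\<in>{t\<in>{..<length us}. us ! t = i}. h (us ! t)) = real (count_list us i) * h i" by simp
  qed
  finally show ?thesis .
qed

lemma pair_mass_eq:
  assumes "set us \<subseteq> {1..n}"
  shows "pair_mass us w = (\<Sum>i=1..n. (real (count_list us i) * w i)\<^sup>2)"
proof -
  let ?m = "length us"
  have "pair_mass us w = (\<Sum>\<tau><?m. \<Sum>\<tau>'\<in>{\<tau>'. \<tau>' < ?m \<and> us ! \<tau> = us ! \<tau>'}. (w (us ! \<tau>))\<^sup>2)"
    unfolding pair_mass_def by (subst sum.Sigma) (auto intro!: sum.cong)
  also have "\<dots> = (\<Sum>\<tau><?m. real (count_list us (us ! \<tau>)) * (w (us ! \<tau>))\<^sup>2)"
    by (simp only: sum_constant count_list_eq_length_filter length_filter_conv_card)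
  also have "\<dots> = (\<Sum>i=1..n. real (count_list us i) * (real (count_list us i) * (w i)\<^sup>2))"
    by (rule sum_stream[OF assms])
  finally show ?thesis by (simp add: power2_eq_square mult_ac)
qed

lemma (in sample_hold) fold_kern_count:
  assumes "(S, T, E) \<in> set_pmf (fold_pmf (kern a b) (0, 0, Map.empty) us)" "E i = Some (h, F, c)"
  shows "c \<le> count_list us i"
proof -
  obtain k \<omega> where "run us k \<omega> (length us) = (S, T, E)"
    using assms(1) unfolding fold_kern by auto
  from run_hits[OF this assms(2)] have "c \<le> hits us \<omega> i (length us)" .
  also have "\<dots> \<le> card {x. x < length us \<and> us ! x = i}" unfolding hits_def by (rule card_mono) auto
  also have "\<dots> = count_list us i" by (simp add: count_list_eq_length_filter length_filter_conv_card eq_commute)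
  finally show ?thesis .
qed

section \<open>From sampled counts to estimates of the moment\<close>

text \<open>\<open>\<eta>\<close> is the relative error of the counts, \<open>L\<close> the
  oversampling and \<open>\<rho>\<close> the intensity of the flags. \<open>K\<close> and
  \<open>M\<close> are key length and range of the hash, \<open>Ng\<close> is the number of guesses,
  \<open>R\<close> the number of repetitions per guess, and \<open>v s\<close> the threshold that
  belongs to guess \<open>s\<close>.\<close>

locale moment_sketch =
  fixes p \<eta> L \<rho> :: real and n K M Ng R B \<kappa> Lf :: nat and v :: "nat \<Rightarrow> real"
  assumes p: "1 \<le> p" and \<eta>: "0 < \<eta>" "\<eta> \<le> 1/4" and L: "3 \<le> L" and \<rho>: "0 < \<rho>"
    and M: "0 < M" and R: "0 < R" and B: "0 < B" and \<kappa>: "0 < \<kappa>" and v: "\<And>s. 0 < v s"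
begin

text \<open>The slot size 16 lets a full slot contribute at most 1/16 to the failure probability of
  a cell.\<close>

sublocale sample_hold Lf \<kappa> 16 B .

abbreviation start :: "cell" where "start \<equiv> (0, 0, Map.empty)"

definition wt :: "(nat \<Rightarrow> nat) \<Rightarrow> nat \<Rightarrow> real" where
  "wt g u = unit_hash K M g u powr (- (1 / p))"

text \<open>Chosen so that, as long as the probability is not capped at 1, an item exactly at its
  cutoff has \<open>L / \<eta>\<^sup>2\<close> expected samples, enough for a relative error of
  order \<open>\<eta>\<close>; see \<open>rate_wt\<close>.\<close>

definition rate :: "nat \<Rightarrow> real" where
  "rate s = L / (\<eta>\<^sup>2 * v s powr (1 / p))"

definition prate :: "nat \<Rightarrow> (nat \<Rightarrow> nat) \<Rightarrow> nat \<Rightarrow> real" where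
  "prate s g u = min 1 (rate s * wt g u)"

definition flag_rate :: "(nat \<Rightarrow> nat) \<Rightarrow> nat \<Rightarrow> nat \<Rightarrow> real" where
  "flag_rate g u l = min 1 (\<rho> * wt g u / 2 ^ l)"

definition idx :: "(nat \<times> nat) set" where "idx = {..<Ng} \<times> {..<R}"

definition final :: "(nat \<Rightarrow> nat) \<Rightarrow> nat list \<Rightarrow> (nat \<times> nat \<Rightarrow> cell) pmf" where
  "final g us = Pi_pmf idx start (\<lambda>x. fold_pmf (kern (prate (fst x) g) (flag_rate g)) start us)"

definition cnt :: "cell \<Rightarrow> nat \<Rightarrow> real" where
  "cnt \<sigma> i = (case snd (snd \<sigma>) i of None \<Rightarrow> 0 | Some (h, F, c) \<Rightarrow> real c)"

text \<open>A maximum, because a failed repetition errs downwards by losing samples, while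
  overcounting can be excluded for all repetitions at once.\<close>

definition fhat :: "(nat \<Rightarrow> nat) \<Rightarrow> (nat \<times> nat \<Rightarrow> cell) \<Rightarrow> nat \<Rightarrow> nat \<Rightarrow> real" where
  "fhat g \<sigma> s i = Max ((\<lambda>r. cnt (\<sigma> (s, r)) i) ` {..<R}) / prate s g i"

definition guess :: "(nat \<Rightarrow> nat) \<Rightarrow> (nat \<times> nat \<Rightarrow> cell) \<Rightarrow> nat \<Rightarrow> real" where
  "guess g \<sigma> s = (\<Sum>i=1..n. threshold (v s) (unit_hash K M g i) (fhat g \<sigma> s i powr p))"

text \<open>The estimate that exact frequencies, scaled by \<open>\<theta>\<close>, would give. The
  factors \<open>1 + 2 * \<eta>\<close> and \<open>1 - 3 * \<eta>\<close> of the two Chernoff bounds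
  sandwich \<open>guess\<close>.\<close>

definition ideal :: "real \<Rightarrow> (nat \<Rightarrow> nat) \<Rightarrow> nat list \<Rightarrow> nat \<Rightarrow> real" where
  "ideal \<theta> g us s = (\<Sum>i=1..n. threshold (v s) (unit_hash K M g i) ((\<theta> * real (count_list us i)) powr p))"

lemma U: "0 < unit_hash K M g i" "unit_hash K M g i \<le> 1"
  using unit_hash_bounds[OF M] by auto

lemma wt_ge: "1 \<le> wt g u"
proof -
  have "1 powr (- (1 / p)) \<le> unit_hash K M g u powr (- (1 / p))"
    using U p by (intro powr_mono2') auto
  then show ?thesis by (simp add: wt_def)
qed

lemma rate_pos: "0 < rate s"
  using L \<eta> v[of s] by (simp add: rate_def)

lemma prate_bounds: "0 < prate s g u" "prate s g u \<le> 1" "prate s g u \<le> rate s * wt g u"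
  using rate_pos[of s] wt_ge[of g u] by (auto simp: prate_def min_def)

lemma flag_rate_bounds: "0 \<le> flag_rate g u l" "flag_rate g u l \<le> 1"
  using \<rho> wt_ge[of g u] by (auto simp: flag_rate_def)

definition cutoff :: "nat \<Rightarrow> (nat \<Rightarrow> nat) \<Rightarrow> nat \<Rightarrow> real" where
  "cutoff s g i = (v s * unit_hash K M g i) powr (1 / p)"

lemma cutoff_pos: "0 < cutoff s g i"
  using U[of g i] v[of s] by (simp add: cutoff_def)

lemma rate_wt: "rate s * wt g i = L / (\<eta>\<^sup>2 * cutoff s g i)"
  using U[of g i] v[of s] by (simp add: rate_def wt_def cutoff_def powr_mult powr_minus field_simps)

lemma threshold_active_iff:
  assumes "0 \<le> x"
  shows "v s * unit_hash K M g i \<le> x powr p \<longleftrightarrow> cutoff s g i \<le> x"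
proof -
  have e: "v s * unit_hash K M g i = cutoff s g i powr p"
    using U[of g i] v[of s] p by (simp add: cutoff_def powr_powr)
  show ?thesis
  proof
    assume "cutoff s g i \<le> x"
    then show "v s * unit_hash K M g i \<le> x powr p"
      unfolding e using cutoff_pos[of s g i] p by (intro powr_mono2) auto
  next
    assume *: "v s * unit_hash K M g i \<le> x powr p"
    show "cutoff s g i \<le> x"
    proof (rule ccontr)
      assume "\<not> cutoff s g i \<le> x"
      then have "x powr p < cutoff s g i powr p" using assms p by (intro powr_less_mono2) auto
      then show False using * e by simp
    qed
  qed
qed

lemma cnt_nonneg: "0 \<le> cnt \<sigma> i"
  by (auto simp: cnt_def split: option.splits)

lemma fhat_ge: "r < R \<Longrightarrow> cnt (\<sigma> (s, r)) i / prate s g i \<le> fhat g \<sigma> s i"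
  unfolding fhat_def using prate_bounds(1)[of s g i] by (intro divide_right_mono Max_ge) auto

lemma fhat_attained: "\<exists>r<R. fhat g \<sigma> s i = cnt (\<sigma> (s, r)) i / prate s g i"
proof -
  have "Max ((\<lambda>r. cnt (\<sigma> (s, r)) i) ` {..<R}) \<in> (\<lambda>r. cnt (\<sigma> (s, r)) i) ` {..<R}"
    using R by (intro Max_in) auto
  then show ?thesis unfolding fhat_def by auto
qed

lemma fhat_nonneg: "0 \<le> fhat g \<sigma> s i"
proof -
  obtain r where "fhat g \<sigma> s i = cnt (\<sigma> (s, r)) i / prate s g i" using fhat_attained by blast
  then show ?thesis using divide_nonneg_pos[OF cnt_nonneg prate_bounds(1)] by simp
qed

text \<open>The floor keeps the Chernoff exponent at \<open>L / 8\<close> for items with few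
  expected samples. It is a quarter of the expected count at the cutoff, so an item whose count
  reaches only the floor still fails the threshold test.\<close>

definition slack :: "nat \<Rightarrow> (nat \<Rightarrow> nat) \<Rightarrow> nat list \<Rightarrow> nat \<Rightarrow> real" where
  "slack s g us i = max (prate s g i * real (count_list us i)) (L / (4 * \<eta>\<^sup>2))"

definition over :: "(nat \<Rightarrow> nat) \<Rightarrow> nat list \<Rightarrow> nat \<Rightarrow> nat \<Rightarrow> cell \<Rightarrow> bool" where
  "over g us s i \<sigma> \<longleftrightarrow> (if prate s g i = 1 then real (count_list us i) < cnt \<sigma> i
     else (1 + 2 * \<eta>) * slack s g us i \<le> cnt \<sigma> i)"

lemma prob_over:
  "measure_pmf.prob (fold_pmf (kern (prate s g) (flag_rate g)) start us) {\<sigma>. over g us s i \<sigma>} \<le> exp (- L / 8)"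
proof (cases "prate s g i = 1")
  case True
  have "measure_pmf.prob (fold_pmf (kern (prate s g) (flag_rate g)) start us) {\<sigma>. over g us s i \<sigma>} \<le>
    measure_pmf.prob (fold_pmf (kern (prate s g) (flag_rate g)) start us) {\<sigma>. False}"
  proof (rule prob_mono)
    fix \<sigma> assume *: "\<sigma> \<in> set_pmf (fold_pmf (kern (prate s g) (flag_rate g)) start us)" "over g us s i \<sigma>"
    obtain S T E where \<sigma>: "\<sigma> = (S, T, E)" by (cases \<sigma>)
    show False
      using *(2) fold_kern_count[OF *(1)[unfolded \<sigma>], of i] True
      by (auto simp: over_def cnt_def \<sigma> split: option.splits)
  qed
  also have "\<dots> = 0" by simp
  also have "\<dots> \<le> exp (- L / 8)" by (rule exp_ge_zero)
  finally show ?thesis .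
next
  case False
  let ?M = "slack s g us i"
  have M0: "L / (4 * \<eta>\<^sup>2) \<le> ?M" by (simp add: slack_def)
  then have Mpos: "0 < ?M" using L \<eta> by (intro less_le_trans[OF _ M0]) auto
  have "measure_pmf.prob (fold_pmf (kern (prate s g) (flag_rate g)) start us) {\<sigma>. over g us s i \<sigma>} \<le>
    measure_pmf.prob (fold_pmf (kern (prate s g) (flag_rate g)) start us)
      {x. case x of (S, T, E) \<Rightarrow> \<exists>h F c. E i = Some (h, F, c) \<and> (1 + 2 * \<eta>) * ?M \<le> real c}"
  proof (rule prob_mono)
    fix \<sigma> assume *: "over g us s i \<sigma>"
    obtain S T E where \<sigma>: "\<sigma> = (S, T, E)" by (cases \<sigma>)
    have "0 < (1 + 2 * \<eta>) * ?M" using Mpos \<eta> by simp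
    then show "case \<sigma> of (S, T, E) \<Rightarrow> \<exists>h F c. E i = Some (h, F, c) \<and> (1 + 2 * \<eta>) * ?M \<le> real c"
      using * False by (auto simp: over_def cnt_def \<sigma> split: option.splits)
  qed
  also have "\<dots> \<le> exp (- \<eta>\<^sup>2 * ?M / 2)"
    by (rule prob_overcount[OF _ _ _ _ \<eta>])
      (use prate_bounds flag_rate_bounds in \<open>auto simp: slack_def less_imp_le\<close>)
  also have "\<dots> \<le> exp (- L / 8)"
  proof -
    have "\<eta>\<^sup>2 * (L / (4 * \<eta>\<^sup>2)) \<le> \<eta>\<^sup>2 * ?M" using M0 by (rule mult_left_mono) simp
    then show ?thesis using \<eta> by simp
  qed
  finally show ?thesis .
qed

text \<open>The estimate of an item is at most \<open>1 + 2 * \<eta>\<close> times its frequency, or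
  it lies below the cutoff and contributes nothing. Light items therefore need no accurate
  count.\<close>

lemma guess_le_ideal:
  assumes "\<And>r i. r < R \<Longrightarrow> i \<in> {1..n} \<Longrightarrow> \<not> over g us s i (\<sigma> (s, r))"
  shows "guess g \<sigma> s \<le> ideal (1 + 2 * \<eta>) g us s"
  unfolding guess_def ideal_def
proof (rule sum_mono)
  fix i assume i: "i \<in> {1..n}"
  let ?f = "real (count_list us i)" and ?a = "prate s g i"
  obtain r where r: "r < R" "fhat g \<sigma> s i = cnt (\<sigma> (s, r)) i / ?a" using fhat_attained by blast
  have no: "\<not> over g us s i (\<sigma> (s, r))" using assms r i by auto
  have "fhat g \<sigma> s i \<le> (1 + 2 * \<eta>) * ?f \<or> fhat g \<sigma> s i < cutoff s g i"
  proof (cases "?a = 1")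
    case True
    then have "fhat g \<sigma> s i \<le> 1 * ?f" using no r by (simp add: over_def)
    also have "\<dots> \<le> (1 + 2 * \<eta>) * ?f" using \<eta> by (intro mult_right_mono) auto
    finally show ?thesis by simp
  next
    case False
    have a: "?a = L / (\<eta>\<^sup>2 * cutoff s g i)" using False by (auto simp: prate_def rate_wt min_def)
    have apos: "0 < ?a" by (rule prate_bounds)
    have c: "cnt (\<sigma> (s, r)) i < (1 + 2 * \<eta>) * slack s g us i" using no False by (simp add: over_def)
    have f: "fhat g \<sigma> s i < (1 + 2 * \<eta>) * slack s g us i / ?a"
      unfolding r(2) using c apos by (rule divide_strict_right_mono)
    show ?thesis
    proof (cases "L / (4 * \<eta>\<^sup>2) \<le> ?a * ?f")
      case True
      then have "slack s g us i = ?a * ?f" by (simp add: slack_def)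
      then show ?thesis using f apos by simp
    next
      case False
      then have sl: "slack s g us i = L / (4 * \<eta>\<^sup>2)" by (simp add: slack_def)
      \<comment> \<open>The quarter in the floor beats the overcount, as
        \<open>(1 + 2 * \<eta>) / 4 \<le> 3/8\<close>.\<close>
      have "(1 + 2 * \<eta>) * slack s g us i / ?a = (1 + 2 * \<eta>) / 4 * cutoff s g i"
        unfolding sl a using L \<eta> cutoff_pos[of s g i] by (simp add: field_simps)
      also have "\<dots> \<le> 1 * cutoff s g i" using \<eta> cutoff_pos[of s g i] by (intro mult_right_mono) auto
      finally show ?thesis using f by simp
    qed
  qed
  then show "threshold (v s) (unit_hash K M g i) (fhat g \<sigma> s i powr p) \<le>
    threshold (v s) (unit_hash K M g i) (((1 + 2 * \<eta>) * ?f) powr p)"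
  proof
    assume "fhat g \<sigma> s i \<le> (1 + 2 * \<eta>) * ?f"
    then show ?thesis using fhat_nonneg p v[of s] by (intro threshold_mono powr_mono2) (auto simp: less_imp_le)
  next
    assume "fhat g \<sigma> s i < cutoff s g i"
    then have "\<not> v s * unit_hash K M g i \<le> fhat g \<sigma> s i powr p"
      using threshold_active_iff[OF fhat_nonneg] by (simp add: not_le)
    then show ?thesis using threshold_nonneg[of "v s"] v[of s] by (simp add: threshold_def less_imp_le)
  qed
qed

definition found :: "(nat \<Rightarrow> nat) \<Rightarrow> nat list \<Rightarrow> nat \<Rightarrow> nat \<Rightarrow> cell \<Rightarrow> bool" where
  "found g us s i \<sigma> \<longleftrightarrow> (1 - 3 * \<eta>) * (prate s g i * real (count_list us i)) \<le> cnt \<sigma> i"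

text \<open>Only items that pass the threshold test after scaling by \<open>1 - 3 * \<eta>\<close>
  contribute on the left, so only these have to be found.\<close>

lemma ideal_le_guess:
  assumes "\<And>i. i \<in> {1..n} \<Longrightarrow> cutoff s g i \<le> (1 - 3 * \<eta>) * real (count_list us i) \<Longrightarrow> \<exists>r<R. found g us s i (\<sigma> (s, r))"
  shows "ideal (1 - 3 * \<eta>) g us s \<le> guess g \<sigma> s"
  unfolding guess_def ideal_def
proof (rule sum_mono)
  fix i assume i: "i \<in> {1..n}"
  let ?f = "real (count_list us i)" and ?a = "prate s g i"
  have nn: "0 \<le> (1 - 3 * \<eta>) * ?f" using \<eta> by simp
  show "threshold (v s) (unit_hash K M g i) (((1 - 3 * \<eta>) * ?f) powr p) \<le>
    threshold (v s) (unit_hash K M g i) (fhat g \<sigma> s i powr p)"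
  proof (cases "cutoff s g i \<le> (1 - 3 * \<eta>) * ?f")
    case True
    obtain r where r: "r < R" "found g us s i (\<sigma> (s, r))" using assms[OF i True] by auto
    have "(1 - 3 * \<eta>) * ?f \<le> cnt (\<sigma> (s, r)) i / ?a"
      using r(2) prate_bounds(1)[of s g i] by (simp add: found_def field_simps)
    then have "(1 - 3 * \<eta>) * ?f \<le> fhat g \<sigma> s i" using fhat_ge[OF r(1), of \<sigma> s i g] by linarith
    then show ?thesis using nn p v[of s] by (intro threshold_mono powr_mono2) (auto simp: less_imp_le)
  next
    case False
    then have "\<not> v s * unit_hash K M g i \<le> ((1 - 3 * \<eta>) * ?f) powr p"
      using threshold_active_iff[OF nn] by simp
    then show ?thesis using threshold_nonneg[of "v s"] v[of s] by (simp add: threshold_def less_imp_le)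
  qed
qed

text \<open>What a seed must grant to one cell: Markov's inequality then bounds a sample or tick
  overrun by 1/16 each, and competition over all scales costs at most 1/16.\<close>

definition affordable :: "(nat \<Rightarrow> nat) \<Rightarrow> nat list \<Rightarrow> nat \<Rightarrow> nat \<Rightarrow> bool" where
  "affordable g us Z s \<longleftrightarrow> 16 * (\<Sum>t<length us. prate s g (us ! t)) \<le> B \<and>
     real Z * (2 * \<rho> * (rate s)\<^sup>2 * harm (length us) * pair_mass us (wt g) / \<kappa>) \<le> 1/16"

lemma prob_not_found:
  assumes act: "cutoff s g i \<le> (1 - 3 * \<eta>) * real (count_list us i)"
    and af: "affordable g us Z s" and Z: "B < 2 ^ Z"
    and Lf: "real (length us) * wt g i < 2 ^ Lf"
    and l1: "real Z * (real (length us) * exp (- \<rho>)) \<le> 1/16"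
  shows "measure_pmf.prob (fold_pmf (kern (prate s g) (flag_rate g)) start us) {\<sigma>. \<not> found g us s i \<sigma>} \<le> 1/2"
proof -
  let ?p = "fold_pmf (kern (prate s g) (flag_rate g)) start us"
  let ?f = "real (count_list us i)" and ?a = "prate s g i"
  have cp: "0 < cutoff s g i" by (rule cutoff_pos)
  have fpos: "0 < ?f"
  proof (rule ccontr)
    assume "\<not> 0 < ?f" then show False using act cp by simp
  qed
  have le1: "(1 - 3 * \<eta>) * ?f \<le> 1 * ?f" using \<eta> by (intro mult_right_mono) auto
  then have cf: "cutoff s g i \<le> ?f" using act by simp
  have acc: "?a = 1 \<or> 3 \<le> \<eta>\<^sup>2 * (?a * ?f)"
  proof (cases "?a = 1")
    case False
    have a: "?a = L / (\<eta>\<^sup>2 * cutoff s g i)" using False by (auto simp: prate_def rate_wt min_def)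
    \<comment> \<open>Above the cutoff the expected count is at least
      \<open>L / \<eta>\<^sup>2\<close>; here \<open>3 \<le> L\<close> enters.\<close>
    have "3 * 1 \<le> L * (?f / cutoff s g i)" using L cf cp by (intro mult_mono) auto
    also have "\<dots> = \<eta>\<^sup>2 * (?a * ?f)" using \<eta> by (simp add: a)
    finally show ?thesis by simp
  qed simp
  have "1/2 \<le> measure_pmf.prob ?p {(S, T, E). \<exists>h F c. E i = Some (h, F, c) \<and> (1 - 3 * \<eta>) * (?a * ?f) \<le> real c}"
  proof (rule prob_found[where w = "wt g" and q = "rate s" and \<rho> = \<rho> and Z = Z])
    show "16 * (\<Sum>t<length us. prate s g (us ! t)) \<le> B"
      "real Z * (2 * \<rho> * (rate s)\<^sup>2 * harm (length us) * pair_mass us (wt g) / \<kappa>) \<le> 1/16"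
      using af by (auto simp: affordable_def)
    show "0 < count_list us i" using fpos by simp
  qed (use prate_bounds wt_ge \<rho> rate_pos \<kappa> Lf B Z \<eta> acc l1 in \<open>auto simp: flag_rate_def less_imp_le\<close>)
  also have "\<dots> \<le> measure_pmf.prob ?p {\<sigma>. found g us s i \<sigma>}"
    by (rule measure_pmf.finite_measure_mono) (auto simp: found_def cnt_def)
  finally have "1/2 \<le> measure_pmf.prob ?p {\<sigma>. found g us s i \<sigma>}" .
  moreover have "measure_pmf.prob ?p {\<sigma>. \<not> found g us s i \<sigma>} = 1 - measure_pmf.prob ?p {\<sigma>. found g us s i \<sigma>}"
    using measure_pmf.prob_compl[of "{\<sigma>. found g us s i \<sigma>}" ?p] by (simp add: Compl_eq_Diff_UNIV[symmetric] Collect_neg_eq)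
  ultimately show ?thesis by simp
qed

lemma finite_idx: "finite idx" by (simp add: idx_def)

lemma prob_final_component:
  assumes "x \<in> idx"
  shows "measure_pmf.prob (final g us) {\<sigma>. P (\<sigma> x)} =
    measure_pmf.prob (fold_pmf (kern (prate (fst x) g) (flag_rate g)) start us) {\<sigma>. P \<sigma>}"
proof -
  have "measure_pmf.prob (final g us) {\<sigma>. P (\<sigma> x)} = measure_pmf.prob (map_pmf (\<lambda>\<sigma>. \<sigma> x) (final g us)) {\<sigma>. P \<sigma>}"
    by (simp add: vimage_def)
  then show ?thesis unfolding final_def using assms by (subst (asm) Pi_pmf_component) (simp_all add: finite_idx)
qed

lemma prob_final_all_reps:
  assumes "s < Ng" and "measure_pmf.prob (fold_pmf (kern (prate s g) (flag_rate g)) start us) {\<sigma>. P \<sigma>} \<le> c"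
  shows "measure_pmf.prob (final g us) {\<sigma>. \<forall>r<R. P (\<sigma> (s, r))} \<le> c ^ R"
proof -
  let ?pr = "measure_pmf.prob (fold_pmf (kern (prate s g) (flag_rate g)) start us) {\<sigma>. P \<sigma>}"
  have "{\<sigma>. \<forall>r<R. P (\<sigma> (s, r))} = Pi idx (\<lambda>x. if fst x = s then {\<sigma>. P \<sigma>} else UNIV)"
    using assms(1) by (auto simp: idx_def Pi_def)
  then have "measure_pmf.prob (final g us) {\<sigma>. \<forall>r<R. P (\<sigma> (s, r))} =
    (\<Prod>x\<in>idx. measure_pmf.prob (fold_pmf (kern (prate (fst x) g) (flag_rate g)) start us) (if fst x = s then {\<sigma>. P \<sigma>} else UNIV))"
    unfolding final_def by (simp only: measure_Pi_pmf_Pi[OF finite_idx])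
  also have "\<dots> = (\<Prod>x\<in>idx. if fst x = s then ?pr else 1)"
    by (rule prod.cong) auto
  also have "\<dots> = (\<Prod>s'<Ng. \<Prod>r<R. if s' = s then ?pr else 1)"
    unfolding idx_def by (subst prod.cartesian_product) (simp add: case_prod_unfold)
  also have "\<dots> = (\<Prod>s'<Ng. if s' = s then ?pr ^ R else 1)" by (rule prod.cong) auto
  also have "\<dots> = ?pr ^ R" using assms(1) by (simp add: prod.delta)
  also have "\<dots> \<le> c ^ R" using assms(2) by (intro power_mono) auto
  finally show ?thesis .
qed

text \<open>Overcounting is excluded for all guesses, but items are claimed to be found only from
  \<open>s0\<close> on, since smaller guesses may sample beyond the budget. This asymmetry is
  harmless because the largest accepted guess is used.\<close>

lemma prob_final_bad:
  assumes af: "\<And>s. s0 \<le> s \<Longrightarrow> s < Ng \<Longrightarrow> affordable g us Z s" and Z: "B < 2 ^ Z"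
    and Lf: "\<And>i. real (length us) * wt g i < 2 ^ Lf"
    and l1: "real Z * (real (length us) * exp (- \<rho>)) \<le> 1/16"
  shows "measure_pmf.prob (final g us) {\<sigma>. \<not> (\<forall>s<Ng. guess g \<sigma> s \<le> ideal (1 + 2 * \<eta>) g us s \<and>
      (s0 \<le> s \<longrightarrow> ideal (1 - 3 * \<eta>) g us s \<le> guess g \<sigma> s))}
    \<le> real Ng * real R * real n * exp (- L / 8) + real Ng * real n * (1/2) ^ R"
proof -
  let ?X = "idx \<times> {1..n}" and ?Y = "{(s, i). s < Ng \<and> s0 \<le> s \<and> i \<in> {1..n} \<and> cutoff s g i \<le> (1 - 3 * \<eta>) * real (count_list us i)}"
  have fin: "finite ?X" "finite ?Y"
    using finite_idx by (auto intro: finite_subset[of _ "{..<Ng} \<times> {1..n}"])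
  have cX: "card ?X = Ng * R * n" by (simp add: card_cartesian_product idx_def)
  have "card ?Y \<le> card ({..<Ng} \<times> {1..n})" by (rule card_mono) auto
  then have cY: "card ?Y \<le> Ng * n" by (simp add: card_cartesian_product)
  have "measure_pmf.prob (final g us) {\<sigma>. \<not> (\<forall>s<Ng. guess g \<sigma> s \<le> ideal (1 + 2 * \<eta>) g us s \<and>
      (s0 \<le> s \<longrightarrow> ideal (1 - 3 * \<eta>) g us s \<le> guess g \<sigma> s))} \<le>
    measure_pmf.prob (final g us) {\<sigma>. (\<exists>x\<in>?X. over g us (fst (fst x)) (snd x) (\<sigma> (fst x))) \<or>
      (\<exists>x\<in>?Y. \<forall>r<R. \<not> found g us (fst x) (snd x) (\<sigma> (fst x, r)))}"
  proof (rule prob_mono, rule ccontr)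
    fix \<sigma>
    assume a1: "\<not> (\<forall>s<Ng. guess g \<sigma> s \<le> ideal (1 + 2 * \<eta>) g us s \<and>
      (s0 \<le> s \<longrightarrow> ideal (1 - 3 * \<eta>) g us s \<le> guess g \<sigma> s))"
      and a2: "\<not> ((\<exists>x\<in>?X. over g us (fst (fst x)) (snd x) (\<sigma> (fst x))) \<or>
      (\<exists>x\<in>?Y. \<forall>r<R. \<not> found g us (fst x) (snd x) (\<sigma> (fst x, r))))"
    have "guess g \<sigma> s \<le> ideal (1 + 2 * \<eta>) g us s" if "s < Ng" for s
    proof (rule guess_le_ideal)
      fix r i assume "r < R" "i \<in> {1..n}"
      then have "((s, r), i) \<in> ?X" using that by (auto simp: idx_def)
      then show "\<not> over g us s i (\<sigma> (s, r))" using a2 by force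
    qed
    moreover have "ideal (1 - 3 * \<eta>) g us s \<le> guess g \<sigma> s" if "s < Ng" "s0 \<le> s" for s
    proof (rule ideal_le_guess)
      fix i assume "i \<in> {1..n}" "cutoff s g i \<le> (1 - 3 * \<eta>) * real (count_list us i)"
      then have "(s, i) \<in> ?Y" using that by auto
      then show "\<exists>r<R. found g us s i (\<sigma> (s, r))" using a2 by force
    qed
    ultimately show False using a1 by blast
  qed
  also have "\<dots> \<le> (\<Sum>x\<in>?X. measure_pmf.prob (final g us) {\<sigma>. over g us (fst (fst x)) (snd x) (\<sigma> (fst x))}) +
    (\<Sum>x\<in>?Y. measure_pmf.prob (final g us) {\<sigma>. \<forall>r<R. \<not> found g us (fst x) (snd x) (\<sigma> (fst x, r))})"
    by (intro order_trans[OF prob_or_le] add_mono prob_Ex_le fin)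
  also have "\<dots> \<le> (\<Sum>x\<in>?X. exp (- L / 8)) + (\<Sum>x\<in>?Y. (1/2) ^ R)"
  proof (intro add_mono sum_mono)
    fix x assume "x \<in> ?X"
    then have "fst x \<in> idx" by auto
    then show "measure_pmf.prob (final g us) {\<sigma>. over g us (fst (fst x)) (snd x) (\<sigma> (fst x))} \<le> exp (- L / 8)"
      using prob_final_component[of "fst x" g us "over g us (fst (fst x)) (snd x)"] prob_over by simp
  next
    fix x assume x: "x \<in> ?Y"
    obtain s i where xe: "x = (s, i)" by (cases x)
    have si: "s < Ng" "s0 \<le> s" "cutoff s g i \<le> (1 - 3 * \<eta>) * real (count_list us i)" using x by (auto simp: xe)
    show "measure_pmf.prob (final g us) {\<sigma>. \<forall>r<R. \<not> found g us (fst x) (snd x) (\<sigma> (fst x, r))} \<le> (1/2) ^ R"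
      unfolding xe fst_conv snd_conv
      by (rule prob_final_all_reps[OF si(1) prob_not_found[OF si(3) af[OF si(2,1)] Z Lf l1]])
  qed
  also have "\<dots> \<le> real Ng * real R * real n * exp (- L / 8) + real Ng * real n * (1/2) ^ R"
  proof (rule add_mono)
    have "real (card ?Y) \<le> real (Ng * n)" using cY by (simp only: of_nat_le_iff)
    then show "(\<Sum>x\<in>?Y. (1/2) ^ R) \<le> real Ng * real n * (1/2::real) ^ R" by (simp add: mult_right_mono)
  qed (unfold sum_constant cX, simp)
  finally show ?thesis .
qed

end

section \<open>Norm inequalities\<close>

text \<open>Bernoulli's inequality for real exponents, obtained from Young's inequality with second
  factor 1.\<close>

lemma powr_ge_tangent:
  fixes u r :: real
  assumes "0 \<le> u" "1 \<le> r"
  shows "1 + r * (u - 1) \<le> u powr r"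
proof (cases "u = 0")
  case True then show ?thesis using assms by simp
next
  case False
  then have u: "0 < u" using assms by simp
  have "(u powr r) powr (1 / r) * 1 powr (1 - 1 / r) \<le> (1 / r) * u powr r + (1 - 1 / r) * 1"
    using assms u by (intro Youngs_inequality_0) auto
  then have "u \<le> u powr r / r + 1 - 1 / r" using assms u by (simp add: powr_powr)
  then have "r * u \<le> r * (u powr r / r + 1 - 1 / r)" using assms by (intro mult_left_mono) auto
  then show ?thesis using assms by (simp add: algebra_simps)
qed

text \<open>Jensen's inequality for the \<open>r\<close>-th power: the tangent bound is taken at the
  average \<open>c\<close>, and its linear terms cancel in the sum.\<close>

lemma sum_le_power_mean:
  fixes x :: "'i \<Rightarrow> real"
  assumes I: "finite I" and x: "\<And>i. i \<in> I \<Longrightarrow> 0 \<le> x i" and r: "1 \<le> r"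
  shows "(\<Sum>i\<in>I. x i) \<le> real (card I) powr (1 - 1 / r) * (\<Sum>i\<in>I. x i powr r) powr (1 / r)"
proof (cases "(\<Sum>i\<in>I. x i) = 0")
  case True then show ?thesis by simp
next
  case False
  then have S: "0 < (\<Sum>i\<in>I. x i)" using sum_nonneg[of I x] x by force
  then have ne: "I \<noteq> {}" by auto
  let ?N = "real (card I)"
  have N: "0 < ?N" using ne I by (simp add: card_gt_0_iff)
  define c where "c = (\<Sum>i\<in>I. x i) / ?N"
  have c: "0 < c" using S N by (simp add: c_def)
  have sx: "(\<Sum>i\<in>I. x i) = ?N * c" using N by (simp add: c_def)
  have "?N * c powr r = (\<Sum>i\<in>I. c powr r * (1 + r * (x i / c - 1)))"
    using sx c by (simp add: sum_distrib_left[symmetric] sum.distrib sum_subtractf sum_divide_distrib[symmetric])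
  also have "\<dots> \<le> (\<Sum>i\<in>I. x i powr r)"
  proof (rule sum_mono)
    fix i assume "i \<in> I"
    then have "c powr r * (1 + r * (x i / c - 1)) \<le> c powr r * (x i / c) powr r"
      using x c r by (intro mult_left_mono powr_ge_tangent) auto
    also have "\<dots> = x i powr r" using x[OF \<open>i \<in> I\<close>] c by (simp add: powr_divide)
    finally show "c powr r * (1 + r * (x i / c - 1)) \<le> x i powr r" .
  qed
  finally have "(?N * c powr r) powr (1 / r) \<le> (\<Sum>i\<in>I. x i powr r) powr (1 / r)"
    using N c r by (intro powr_mono2) auto
  then have "?N powr (1 / r) * c \<le> (\<Sum>i\<in>I. x i powr r) powr (1 / r)"
    using N c r by (simp add: powr_mult powr_powr)
  then have "?N powr (1 - 1 / r) * (?N powr (1 / r) * c) \<le> ?N powr (1 - 1 / r) * (\<Sum>i\<in>I. x i powr r) powr (1 / r)"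
    by (intro mult_left_mono) auto
  moreover have "?N powr (1 - 1 / r) * (?N powr (1 / r) * c) = ?N * c"
    using N by (simp add: mult.assoc[symmetric] powr_add[symmetric])
  ultimately show ?thesis by (simp only: sx)
qed

text \<open>The l2 norm is at most the lp norm: from each square a factor
  \<open>x i powr (2 - p)\<close> is estimated by the whole sum.\<close>

lemma sum_squares_le_powr:
  fixes x :: "'i \<Rightarrow> real"
  assumes I: "finite I" and x: "\<And>i. i \<in> I \<Longrightarrow> 0 \<le> x i" and p: "0 < p" "p \<le> 2"
  shows "(\<Sum>i\<in>I. (x i)\<^sup>2) \<le> (\<Sum>i\<in>I. x i powr p) powr (2 / p)"
proof -
  define S where "S = (\<Sum>i\<in>I. x i powr p)"
  have S0: "0 \<le> S" unfolding S_def by (intro sum_nonneg) auto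
  have "(\<Sum>i\<in>I. (x i)\<^sup>2) \<le> (\<Sum>i\<in>I. x i powr p * S powr (2 / p - 1))"
  proof (rule sum_mono)
    fix i assume i: "i \<in> I"
    show "(x i)\<^sup>2 \<le> x i powr p * S powr (2 / p - 1)"
    proof (cases "x i = 0")
      case False
      then have xi: "0 < x i" using x[OF i] by simp
      have le: "x i powr p \<le> S" unfolding S_def using I i by (intro member_le_sum) auto
      have "(x i)\<^sup>2 = x i powr p * x i powr (2 - p)"
        using xi by (simp add: powr_add[symmetric] powr_numeral)
      also have "x i powr (2 - p) = (x i powr p) powr (2 / p - 1)"
        using p by (simp add: powr_powr right_diff_distrib)
      also have "\<dots> \<le> S powr (2 / p - 1)"
        using le p by (intro powr_mono2) (auto simp: field_simps)
      finally show ?thesis by (simp add: mult_left_mono)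
    qed simp
  qed
  also have "\<dots> = S * S powr (2 / p - 1)" by (simp add: S_def sum_distrib_right)
  also have "\<dots> = S powr (2 / p)"
    using S0 by (cases "S = 0") (simp_all add: powr_diff)
  finally show ?thesis by (simp add: S_def)
qed

lemma sum_squares_le:
  fixes x :: "nat \<Rightarrow> real"
  assumes x: "\<And>i. 0 \<le> x i" and p: "1 \<le> p"
  shows "(\<Sum>i=1..n. (x i)\<^sup>2) \<le> (if p \<le> 2 then 1 else real n powr (1 - 2 / p)) * (\<Sum>i=1..n. x i powr p) powr (2 / p)"
proof (cases "p \<le> 2")
  case True
  then show ?thesis using sum_squares_le_powr[of "{1..n}" x p] x p by simp
next
  case False
  have e: "(x i)\<^sup>2 powr (p / 2) = x i powr p" for i
  proof (cases "x i = 0")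
    case False
    then have "(x i)\<^sup>2 = x i powr 2" using x[of i] by (simp add: powr_numeral)
    then show ?thesis by (simp add: powr_powr)
  qed (use p in simp)
  have "(\<Sum>i=1..n. (x i)\<^sup>2) \<le> real (card {1..n}) powr (1 - 1 / (p / 2)) * (\<Sum>i=1..n. (x i)\<^sup>2 powr (p / 2)) powr (1 / (p / 2))"
    using False by (intro sum_le_power_mean) auto
  then show ?thesis using False by (simp add: e)
qed

context moment_sketch
begin

text \<open>\<open>W\<close> bounds the rescaled moment in units of \<open>v s\<close>. The power
  mean turns this into a bound on the expected number of samples, and \<open>sum_squares_le\<close>
  into one on the pair mass. In both, \<open>v s\<close> cancels against the sampling rate, so the
  unknown moment disappears.\<close>

lemma affordable_of_mass:
  fixes F H W \<theta> :: real and us :: "nat list"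
  defines "nn \<equiv> (if p \<le> 2 then 1 else real n powr (1 - 2 / p))"
  assumes us: "set us \<subseteq> {1..n}" and F: "0 < F" and H: "0 < H" and \<theta>: "0 < \<theta>"
    and W: "W = 4 * \<theta> * H" "1 \<le> W"
    and mass: "(\<Sum>i=1..n. real (count_list us i) powr p / unit_hash K M g i) \<le> H * F"
    and vs: "F / (4 * \<theta>) \<le> v s"
    and budget: "16 * (L / \<eta>\<^sup>2) * real n powr (1 - 1 / p) * W \<le> B"
    and cap: "32 * real Z * \<rho> * harm (length us) * (L / \<eta>\<^sup>2)\<^sup>2 * nn * W\<^sup>2 \<le> \<kappa>"
  shows "affordable g us Z s"
proof -
  let ?x = "\<lambda>i. real (count_list us i) * wt g i"
  have x0: "0 \<le> ?x i" for i using wt_ge[of g i] by simp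
  have "wt g i powr p = 1 / unit_hash K M g i" for i
    unfolding wt_def powr_powr using U[of g i] p by (simp add: powr_minus_divide)
  then have xp: "?x i powr p = real (count_list us i) powr p / unit_hash K M g i" for i
    using wt_ge[of g i] by (simp add: powr_mult)
  have S: "(\<Sum>i=1..n. ?x i powr p) \<le> H * F" unfolding xp by (rule mass)
  have S0: "0 \<le> (\<Sum>i=1..n. ?x i powr p)" by (intro sum_nonneg) auto
  have HF: "H * F \<le> W * v s"
  proof -
    have "F \<le> 4 * \<theta> * v s" using vs \<theta> by (simp add: field_simps)
    then have "H * F \<le> H * (4 * \<theta> * v s)" using H by (intro mult_left_mono) auto
    then show ?thesis by (simp add: W mult_ac)
  qed
  have W0: "0 < W" using W(2) by linarith
  have vp: "0 < v s powr (1 / p)" using v[of s] by simp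
  have q: "rate s = L / \<eta>\<^sup>2 / v s powr (1 / p)" by (simp add: rate_def)
  have L\<eta>: "0 < L / \<eta>\<^sup>2" using L \<eta> by simp
  have root: "(\<Sum>i=1..n. ?x i powr p) powr (1 / p) \<le> W * v s powr (1 / p)"
  proof -
    have "(\<Sum>i=1..n. ?x i powr p) powr (1 / p) \<le> (W * v s) powr (1 / p)"
      using S HF S0 p by (intro powr_mono2) auto
    also have "\<dots> = W powr (1 / p) * v s powr (1 / p)" using W0 v[of s] by (simp add: powr_mult)
    \<comment> \<open>Crude for large \<open>p\<close>, but the powers of
      \<open>1 / \<epsilon>\<close> that result still fit the claimed exponents.\<close>
    also have "\<dots> \<le> W powr 1 * v s powr (1 / p)" using W p by (intro mult_right_mono powr_mono) auto
    finally show ?thesis using W0 by simp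
  qed
  have "(\<Sum>t<length us. prate s g (us ! t)) \<le> (\<Sum>t<length us. rate s * wt g (us ! t))"
    by (intro sum_mono prate_bounds)
  also have "\<dots> = rate s * (\<Sum>i=1..n. ?x i)"
    using sum_stream[OF us, of "wt g"] by (simp add: sum_distrib_left[symmetric])
  also have "\<dots> \<le> rate s * (real n powr (1 - 1 / p) * (W * v s powr (1 / p)))"
  proof (rule mult_left_mono)
    have "(\<Sum>i=1..n. ?x i) \<le> real (card {1..n}) powr (1 - 1 / p) * (\<Sum>i=1..n. ?x i powr p) powr (1 / p)"
      using x0 p by (intro sum_le_power_mean) auto
    also have "\<dots> \<le> real (card {1..n}) powr (1 - 1 / p) * (W * v s powr (1 / p))"
      using root by (intro mult_left_mono) auto
    finally show "(\<Sum>i=1..n. ?x i) \<le> real n powr (1 - 1 / p) * (W * v s powr (1 / p))" by simp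
  qed (use rate_pos in \<open>simp add: less_imp_le\<close>)
  also have "\<dots> = (L / \<eta>\<^sup>2) * real n powr (1 - 1 / p) * W" using vp by (simp add: q)
  finally have 1: "16 * (\<Sum>t<length us. prate s g (us ! t)) \<le> B" using budget by simp
  have nn0: "0 \<le> nn" by (simp add: nn_def)
  have "pair_mass us (wt g) = (\<Sum>i=1..n. (?x i)\<^sup>2)" by (rule pair_mass_eq[OF us])
  also have "\<dots> \<le> nn * (\<Sum>i=1..n. ?x i powr p) powr (2 / p)"
    unfolding nn_def using x0 p by (rule sum_squares_le)
  also have "(\<Sum>i=1..n. ?x i powr p) powr (2 / p) = ((\<Sum>i=1..n. ?x i powr p) powr (1 / p))\<^sup>2"
    using S0 by (cases "(\<Sum>i=1..n. ?x i powr p) = 0") (simp_all add: powr_powr powr_numeral[symmetric] del: powr_numeral)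
  also have "nn * \<dots> \<le> nn * (W * v s powr (1 / p))\<^sup>2"
    using root nn0 by (intro mult_left_mono power_mono) auto
  finally have "(rate s)\<^sup>2 * pair_mass us (wt g) \<le> (rate s)\<^sup>2 * (nn * (W * v s powr (1 / p))\<^sup>2)"
    by (intro mult_left_mono) auto
  also have "\<dots> = (L / \<eta>\<^sup>2)\<^sup>2 * nn * W\<^sup>2" using vp by (simp add: q power_mult_distrib power_divide)
  finally have pm: "(rate s)\<^sup>2 * pair_mass us (wt g) \<le> (L / \<eta>\<^sup>2)\<^sup>2 * nn * W\<^sup>2" .
  have "32 * real Z * \<rho> * harm (length us) * ((rate s)\<^sup>2 * pair_mass us (wt g)) \<le>
    32 * real Z * \<rho> * harm (length us) * ((L / \<eta>\<^sup>2)\<^sup>2 * nn * W\<^sup>2)"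
    using pm \<rho> harm_nonneg[of "length us", where 'a=real] by (intro mult_left_mono mult_nonneg_nonneg) auto
  also have "\<dots> \<le> \<kappa>" using cap by (simp add: mult_ac)
  finally have "real Z * (2 * \<rho> * (rate s)\<^sup>2 * harm (length us) * pair_mass us (wt g) / \<kappa>) \<le> 1/16"
    using \<kappa> by (simp add: field_simps)
  then show ?thesis using 1 by (simp add: affordable_def)
qed

section \<open>Selecting a guess\<close>

text \<open>A guess is accepted if its own estimate confirms it up to a factor 4. Estimates are
  rarely much too large, so guesses far above the moment are rejected and the largest accepted one
  is safe.\<close>

definition pick :: "(nat \<Rightarrow> nat) \<Rightarrow> (nat \<times> nat \<Rightarrow> cell) \<Rightarrow> real" where
  "pick g \<sigma> = (let A = {s. s < Ng \<and> 2 ^ s \<le> 4 * guess g \<sigma> s} in if A = {} then 0 else guess g \<sigma> (Max A))"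

definition mom :: "nat list \<Rightarrow> real" where
  "mom us = (\<Sum>i=1..n. real (count_list us i) powr p)"

text \<open>Large thresholds are out of reach for Chebyshev; for them a bound from above suffices,
  whose only task is to prevent acceptance.\<close>

definition good_seed :: "real \<Rightarrow> nat list \<Rightarrow> (nat \<Rightarrow> nat) \<Rightarrow> bool" where
  "good_seed \<epsilon> us g \<longleftrightarrow>
     (\<Sum>i=1..n. real (count_list us i) powr p / unit_hash K M g i) \<le> 32 * harm M * mom us \<and>
     (\<forall>s<Ng. if v s \<le> \<epsilon>\<^sup>2 * mom us / (2048 * real Ng)
        then (\<forall>\<theta>\<in>{1 + 2 * \<eta>, 1 - 3 * \<eta>}. \<bar>ideal \<theta> g us s - \<theta> powr p * mom us\<bar> \<le> \<epsilon> * mom us / 4 + real n * v s / real M)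
        else ideal (1 + 2 * \<eta>) g us s < 64 * real Ng * mom us)"

lemma ideal_mom: "0 \<le> \<theta> \<Longrightarrow> (\<Sum>i=1..n. (\<theta> * real (count_list us i)) powr p) = \<theta> powr p * mom us"
  by (simp add: mom_def sum_distrib_left powr_mult)

text \<open>Three failures of 1/32 each. Below the limit on \<open>v s\<close>, Chebyshev gives 2 *
  16 / (2048 Ng) = 1 / (64 Ng) for each of \<open>Ng\<close> guesses and two scalings; above it,
  Markov gives 2 / (64 Ng) for each guess.\<close>

lemma prob_bad_seed:
  assumes n: "n < 2 ^ K" and F: "0 < mom us" and \<epsilon>: "0 < \<epsilon>"
    and up: "(1 + 2 * \<eta>) powr p \<le> 2" and Ng: "0 < real Ng"
  shows "measure_pmf.prob (hash_pmf K M) {g. \<not> good_seed \<epsilon> us g} \<le> 3/32"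
proof -
  let ?F = "mom us" and ?P = "hash_pmf K M"
  let ?T = "{1 + 2 * \<eta>, 1 - 3 * \<eta>}"
  let ?b1 = "\<lambda>g. 32 * harm M * ?F \<le> (\<Sum>i=1..n. real (count_list us i) powr p / unit_hash K M g i)"
  let ?b2 = "\<lambda>x g. v (fst x) \<le> \<epsilon>\<^sup>2 * ?F / (2048 * real Ng) \<and>
     \<epsilon> * ?F / 4 + real n * v (fst x) / real M \<le> \<bar>ideal (snd x) g us (fst x) - snd x powr p * ?F\<bar>"
  let ?b3 = "\<lambda>s g. 64 * real Ng * ?F \<le> ideal (1 + 2 * \<eta>) g us s"
  have hM: "0 < (harm M :: real)" using M by (intro harm_pos) auto
  then have hM0: "(harm M :: real) \<noteq> 0" by (rule less_imp_neq[symmetric])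
  have \<theta>: "0 \<le> \<theta>" "\<theta> powr p * ?F \<le> 2 * ?F" if "\<theta> \<in> ?T" for \<theta>
  proof -
    show t0: "0 \<le> \<theta>" using that \<eta> by auto
    have "\<theta> \<le> 1 + 2 * \<eta>" using that \<eta> by auto
    then have "\<theta> powr p \<le> (1 + 2 * \<eta>) powr p" using t0 p by (intro powr_mono2) auto
    then show "\<theta> powr p * ?F \<le> 2 * ?F" using up F by (intro mult_right_mono) auto
  qed
  have p1: "measure_pmf.prob ?P {g. ?b1 g} \<le> 1/32"
  proof -
    have "measure_pmf.prob ?P {g. ?b1 g} \<le> harm M * (\<Sum>i=1..n. real (count_list us i) powr p) / (32 * harm M * ?F)"
      using hM F by (intro inverse_hash_sum_markov[OF M n]) auto
    also have "\<dots> = 1/32" unfolding mom_def[symmetric] using hM0 F by simp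
    finally show ?thesis .
  qed
  have p2: "measure_pmf.prob ?P {g. ?b2 x g} \<le> 1 / (64 * real Ng)" if x: "x \<in> {..<Ng} \<times> ?T" for x
  proof (cases "v (fst x) \<le> \<epsilon>\<^sup>2 * ?F / (2048 * real Ng)")
    case False
    then show ?thesis by simp
  next
    case True
    obtain s \<theta> where xe: "x = (s, \<theta>)" "\<theta> \<in> ?T" using x by auto
    have "measure_pmf.prob ?P {g. ?b2 x g} = measure_pmf.prob ?P {g. \<epsilon> * ?F / 4 + real n * v s / real M \<le>
       \<bar>(\<Sum>i=1..n. threshold (v s) (unit_hash K M g i) ((\<theta> * real (count_list us i)) powr p)) -
         (\<Sum>i=1..n. (\<theta> * real (count_list us i)) powr p)\<bar>}"
      using True unfolding xe(1) ideal_def ideal_mom[OF \<theta>(1)[OF xe(2)]] by simp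
    also have "\<dots> \<le> v s * (\<Sum>i=1..n. (\<theta> * real (count_list us i)) powr p) / (\<epsilon> * ?F / 4)\<^sup>2"
      using \<epsilon> F v by (intro threshold_sum_concentrated[OF M n]) auto
    also have "\<dots> \<le> v s * (2 * ?F) / (\<epsilon> * ?F / 4)\<^sup>2"
      unfolding ideal_mom[OF \<theta>(1)[OF xe(2)]]
      using \<theta>[OF xe(2)] v[of s] by (intro divide_right_mono mult_left_mono) auto
    also have "\<dots> \<le> (\<epsilon>\<^sup>2 * ?F / (2048 * real Ng)) * (2 * ?F) / (\<epsilon> * ?F / 4)\<^sup>2"
      using True F by (intro divide_right_mono mult_right_mono) (auto simp: xe)
    also have "\<dots> = 1 / (64 * real Ng)" using \<epsilon> F Ng by (simp add: power2_eq_square field_simps)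
    finally show ?thesis .
  qed
  have p3: "measure_pmf.prob ?P {g. ?b3 s g} \<le> 1 / (32 * real Ng)" for s
  proof -
    have "measure_pmf.prob ?P {g. ?b3 s g} \<le> (\<Sum>i=1..n. ((1 + 2 * \<eta>) * real (count_list us i)) powr p) / (64 * real Ng * ?F)"
      unfolding ideal_def using Ng F v by (intro threshold_sum_markov[OF M n]) auto
    also have "\<dots> \<le> (2 * ?F) / (64 * real Ng * ?F)"
      unfolding ideal_mom[OF \<theta>(1)[OF insertI1]]
      using \<theta>[of "1 + 2 * \<eta>"] Ng F by (intro divide_right_mono) auto
    also have "\<dots> = 1 / (32 * real Ng)" using F Ng by (simp add: field_simps)
    finally show ?thesis .
  qed
  have "measure_pmf.prob ?P {g. \<not> good_seed \<epsilon> us g} \<le>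
    measure_pmf.prob ?P {g. ?b1 g \<or> (\<exists>x\<in>{..<Ng} \<times> ?T. ?b2 x g) \<or> (\<exists>s\<in>{..<Ng}. ?b3 s g)}"
  proof (rule prob_mono, rule ccontr)
    fix g assume a1: "\<not> good_seed \<epsilon> us g"
      and a2: "\<not> (?b1 g \<or> (\<exists>x\<in>{..<Ng} \<times> ?T. ?b2 x g) \<or> (\<exists>s\<in>{..<Ng}. ?b3 s g))"
    have nb1: "\<not> ?b1 g" using a2 by blast
    have nb2: "\<not> ?b2 (s, \<theta>) g" if "s < Ng" "\<theta> \<in> ?T" for s \<theta>
      using a2 that by (meson SigmaI lessThan_iff)
    have nb3: "\<not> ?b3 s g" if "s < Ng" for s using a2 that by blast
    have "good_seed \<epsilon> us g"
      unfolding good_seed_def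
    proof (intro conjI allI impI)
      show "(\<Sum>i=1..n. real (count_list us i) powr p / unit_hash K M g i) \<le> 32 * harm M * mom us"
        using nb1 by simp
      fix s assume s: "s < Ng"
      show "if v s \<le> \<epsilon>\<^sup>2 * mom us / (2048 * real Ng)
        then (\<forall>\<theta>\<in>{1 + 2 * \<eta>, 1 - 3 * \<eta>}. \<bar>ideal \<theta> g us s - \<theta> powr p * mom us\<bar> \<le> \<epsilon> * mom us / 4 + real n * v s / real M)
        else ideal (1 + 2 * \<eta>) g us s < 64 * real Ng * mom us"
        using nb2[OF s] nb3[OF s] by (auto simp: not_le less_imp_le)
    qed
    then show False using a1 by simp
  qed
  also have "\<dots> \<le> 1/32 + ((\<Sum>x\<in>{..<Ng} \<times> ?T. 1 / (64 * real Ng)) + (\<Sum>s<Ng. 1 / (32 * real Ng)))"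
    by (intro order_trans[OF prob_or_le] add_mono p1 order_trans[OF prob_Ex_le sum_mono[OF p2]]
        order_trans[OF prob_Ex_le sum_mono[OF p3]]) auto
  also have "\<dots> \<le> 3/32"
  proof -
    have "card ({..<Ng} \<times> ?T) \<le> Ng * 2" by (simp add: card_cartesian_product card_insert_if)
    then have "real (card ({..<Ng} \<times> ?T)) \<le> real Ng * 2" by (metis of_nat_le_iff of_nat_mult of_nat_numeral)
    then have "real (card ({..<Ng} \<times> ?T)) * (1 / (64 * real Ng)) \<le> real Ng * 2 * (1 / (64 * real Ng))"
      by (intro mult_right_mono) auto
    also have "\<dots> = 1/32" using Ng by simp
    finally show ?thesis using Ng by simp
  qed
  finally show ?thesis .
qed

text \<open>The constant in \<open>\<theta>\<close> makes \<open>v s\<close> exceed the Chebyshev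
  limit \<open>?V\<close> exactly when \<open>2 ^ s\<close> exceeds \<open>256 * Ng\<close> times
  the moment. The estimate of such a guess is below \<open>64 * Ng\<close> times the moment, so it
  is rejected. As \<open>s0\<close> is accepted, the largest accepted guess is at least
  \<open>s0\<close> and concentrated.\<close>

lemma pick_accurate:
  assumes good: "good_seed \<epsilon> us g" and \<epsilon>: "0 < \<epsilon>" "\<epsilon> < 1"
    and vdef: "\<And>s. v s = 2 ^ s / (2 * \<theta>)" and \<theta>: "\<theta> = 2 ^ 18 * (real Ng)\<^sup>2 / \<epsilon>\<^sup>2"
    and s0: "s0 < Ng" "2 ^ s0 \<le> mom us"
    and bounds: "\<And>s. s < Ng \<Longrightarrow> guess g \<sigma> s \<le> ideal (1 + 2 * \<eta>) g us s"
      "\<And>s. s < Ng \<Longrightarrow> s0 \<le> s \<Longrightarrow> ideal (1 - 3 * \<eta>) g us s \<le> guess g \<sigma> s"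
    and up: "(1 + 2 * \<eta>) powr p \<le> 1 + \<epsilon> / 4" and lo: "1 - \<epsilon> / 4 \<le> (1 - 3 * \<eta>) powr p"
    and M8: "8 * real n \<le> \<epsilon> * real M"
  shows "\<bar>pick g \<sigma> - mom us\<bar> \<le> \<epsilon> * mom us"
proof -
  let ?F = "mom us" and ?V = "\<epsilon>\<^sup>2 * mom us / (2048 * real Ng)"
  have Ng: "1 \<le> real Ng" using s0(1) by simp
  have F: "0 < ?F" using s0(2) by (smt (verit) zero_less_power)
  have \<theta>0: "0 < \<theta>" using Ng \<epsilon> by (simp add: \<theta>)
  have \<theta>V: "2 * \<theta> * ?V = 256 * real Ng * ?F"
    using Ng \<epsilon> by (simp add: \<theta> power2_eq_square field_simps)
  have VF: "?V \<le> ?F"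
  proof -
    have "\<epsilon>\<^sup>2 * ?F \<le> 1 * ?F" using \<epsilon> F by (intro mult_right_mono) (auto simp: power_le_one)
    also have "\<dots> \<le> (2048 * real Ng) * ?F" using Ng F by (intro mult_right_mono) auto
    finally show ?thesis using Ng by (simp add: field_simps)
  qed
  \<comment> \<open>The error 5/8 is 1/4 from the counts, 1/4 from Chebyshev and 1/8 from the grid
    of hash values.\<close>
  have acc: "?F - 5 * (\<epsilon> * ?F) / 8 \<le> guess g \<sigma> s \<and> guess g \<sigma> s \<le> ?F + 5 * (\<epsilon> * ?F) / 8"
    if s: "s < Ng" "s0 \<le> s" "v s \<le> ?V" for s
  proof -
    have M0: "0 < real M" using M by simp
    have "real n * v s \<le> (\<epsilon> * real M / 8) * ?F"
      using M8 s(3) VF v[of s] \<epsilon> by (intro mult_mono) auto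
    then have nv: "real n * v s / real M \<le> \<epsilon> * ?F / 8" using M0 by (simp add: field_simps)
    have "\<bar>ideal \<xi> g us s - \<xi> powr p * ?F\<bar> \<le> \<epsilon> * ?F / 4 + real n * v s / real M"
      if "\<xi> \<in> {1 + 2 * \<eta>, 1 - 3 * \<eta>}" for \<xi>
      using good s that unfolding good_seed_def by auto
    then have i1: "ideal (1 + 2 * \<eta>) g us s \<le> (1 + 2 * \<eta>) powr p * ?F + \<epsilon> * ?F / 4 + real n * v s / real M"
      and i2: "(1 - 3 * \<eta>) powr p * ?F - \<epsilon> * ?F / 4 - real n * v s / real M \<le> ideal (1 - 3 * \<eta>) g us s"
      by (smt (verit) insertCI)+
    have u: "(1 + 2 * \<eta>) powr p * ?F \<le> ?F + \<epsilon> * ?F / 4"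
      using mult_right_mono[OF up, of ?F] F by (simp add: algebra_simps)
    have l: "?F - \<epsilon> * ?F / 4 \<le> (1 - 3 * \<eta>) powr p * ?F"
      using mult_right_mono[OF lo, of ?F] F by (simp add: algebra_simps)
    have "guess g \<sigma> s \<le> ?F + 5 * (\<epsilon> * ?F) / 8"
      using i1 u nv bounds(1)[OF s(1)] by linarith
    moreover have "?F - 5 * (\<epsilon> * ?F) / 8 \<le> guess g \<sigma> s"
      using i2 l nv bounds(2)[OF s(1,2)] by linarith
    ultimately show ?thesis by simp
  qed
  define A where "A = {s. s < Ng \<and> 2 ^ s \<le> 4 * guess g \<sigma> s}"
  have small: "v s \<le> ?V" if "s \<in> A" for s
  proof (rule ccontr)
    assume nv: "\<not> v s \<le> ?V"
    have s: "s < Ng" "2 ^ s \<le> 4 * guess g \<sigma> s" using that by (auto simp: A_def)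
    have "ideal (1 + 2 * \<eta>) g us s < 64 * real Ng * ?F"
      using good s(1) nv unfolding good_seed_def by auto
    then have "2 ^ s < 256 * real Ng * ?F" using s bounds(1)[OF s(1)] by linarith
    also have "\<dots> = 2 * \<theta> * ?V" by (simp only: \<theta>V)
    also have "\<dots> < 2 * \<theta> * v s" using nv \<theta>0 by (intro mult_strict_left_mono) auto
    also have "\<dots> = 2 ^ s" using \<theta>0 by (simp add: vdef)
    finally show False by simp
  qed
  have "2 * \<theta> * v s0 \<le> 2 * \<theta> * ?V"
  proof -
    have "2 * \<theta> * v s0 = 2 ^ s0" using \<theta>0 by (simp add: vdef)
    also have "\<dots> \<le> ?F" by (rule s0)
    also have "\<dots> \<le> (256 * real Ng) * ?F" using Ng F by simp
    finally show ?thesis by (simp only: \<theta>V)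
  qed
  then have vs0: "v s0 \<le> ?V" by (rule mult_left_le_imp_le) (use \<theta>0 in simp)
  \<comment> \<open>An error of 5/8 leaves at least 3/8 of the moment, so the factor 4 in the test
    accepts \<open>s0\<close>.\<close>
  have "s0 \<in> A"
  proof -
    have "\<epsilon> * ?F \<le> 1 * ?F" using \<epsilon> F by (intro mult_right_mono) auto
    then have "2 ^ s0 \<le> 4 * guess g \<sigma> s0" using acc[OF s0(1) order_refl vs0] s0(2) F by linarith
    then show ?thesis using s0(1) by (simp add: A_def)
  qed
  have finA: "finite A" by (simp add: A_def)
  have mA: "Max A \<in> A" using finA \<open>s0 \<in> A\<close> by (intro Max_in) auto
  have "s0 \<le> Max A" using finA \<open>s0 \<in> A\<close> by (rule Max_ge)
  moreover have "Max A < Ng" using mA by (simp add: A_def)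
  ultimately have "?F - 5 * (\<epsilon> * ?F) / 8 \<le> guess g \<sigma> (Max A) \<and> guess g \<sigma> (Max A) \<le> ?F + 5 * (\<epsilon> * ?F) / 8"
    using acc small[OF mA] by blast
  moreover have "pick g \<sigma> = guess g \<sigma> (Max A)"
    using \<open>s0 \<in> A\<close> unfolding pick_def A_def[symmetric] Let_def by auto
  moreover have "0 \<le> \<epsilon> * ?F" using \<epsilon> F by simp
  ultimately show ?thesis by (simp add: abs_le_iff)
qed

end

lemma prob_bind_split:
  assumes "measure_pmf.prob p {x. \<not> G x} \<le> c1"
    and "\<And>x. x \<in> set_pmf p \<Longrightarrow> G x \<Longrightarrow> measure_pmf.prob (f x) S \<le> c2" and "0 \<le> c2"
  shows "measure_pmf.prob (bind_pmf p f) S \<le> c1 + c2"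
proof -
  have c1: "0 \<le> c1" using assms(1) measure_nonneg order_trans by blast
  have "emeasure (bind_pmf p f) S = (\<integral>\<^sup>+x. emeasure (f x) S \<partial>p)" by simp
  also have "\<dots> \<le> (\<integral>\<^sup>+x. indicator {x. \<not> G x} x + ennreal c2 \<partial>p)"
  proof (intro nn_integral_mono_AE AE_pmfI)
    fix x assume "x \<in> set_pmf p"
    then show "emeasure (f x) S \<le> indicator {x. \<not> G x} x + ennreal c2"
      using assms(2)[of x] assms(3) measure_pmf.emeasure_le_1[of "f x" S]
      by (cases "G x") (auto simp: measure_pmf.emeasure_eq_measure intro: add_increasing2)
  qed
  also have "\<dots> = emeasure p {x. \<not> G x} + ennreal c2"
    by (subst nn_integral_add) auto
  also have "\<dots> \<le> ennreal c1 + ennreal c2"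
    using assms(1) by (intro add_right_mono) (simp add: measure_pmf.emeasure_eq_measure ennreal_leI)
  also have "\<dots> = ennreal (c1 + c2)" using c1 assms(3) by simp
  finally have "ennreal (measure_pmf.prob (bind_pmf p f) S) \<le> ennreal (c1 + c2)"
    by (simp only: measure_pmf.emeasure_eq_measure)
  moreover have "0 \<le> c1 + c2" using c1 assms(3) by simp
  ultimately show ?thesis by (simp only: ennreal_le_iff)
qed

text \<open>Caps the moment, so that logarithmically many powers of two are enough as
  guesses.\<close>

lemma sum_count_powr_le:
  fixes us :: "nat list"
  assumes us: "set us \<subseteq> {1..n}" and p: "1 \<le> p"
  shows "(\<Sum>i=1..n. real (count_list us i) powr p) \<le> real (length us) powr p"
proof -
  let ?m = "real (length us)"
  have "(\<Sum>i=1..n. real (count_list us i) powr p) \<le> (\<Sum>i=1..n. real (count_list us i) * ?m powr (p - 1))"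
  proof (rule sum_mono)
    fix i
    have c: "count_list us i \<le> length us" by (rule count_le_length)
    show "real (count_list us i) powr p \<le> real (count_list us i) * ?m powr (p - 1)"
    proof (cases "count_list us i = 0")
      case False
      then have "real (count_list us i) powr p = real (count_list us i) * real (count_list us i) powr (p - 1)"
        by (simp add: powr_diff)
      also have "\<dots> \<le> real (count_list us i) * ?m powr (p - 1)"
        using c p by (intro mult_left_mono powr_mono2) auto
      finally show ?thesis .
    qed simp
  qed
  also have "\<dots> = ?m * ?m powr (p - 1)"
    using sum_stream[OF us, of "\<lambda>_. 1"] by (simp add: sum_distrib_right[symmetric])
  also have "\<dots> = ?m powr p" by (cases "length us = 0") (simp_all add: powr_diff)
  finally show ?thesis .
qed

lemma PiE_dflt_mem: "f \<in> PiE_dflt A d C \<Longrightarrow> x \<in> A \<Longrightarrow> f x \<in> C x"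
  and PiE_dflt_out: "f \<in> PiE_dflt A d C \<Longrightarrow> x \<notin> A \<Longrightarrow> f x = d"
  by (auto simp: PiE_dflt_def)

section \<open>The complete sketch\<close>

context moment_sketch
begin

definition ens :: "(nat \<Rightarrow> nat) \<Rightarrow> (nat \<times> nat \<Rightarrow> cell) \<Rightarrow> nat \<Rightarrow> (nat \<times> nat \<Rightarrow> cell) pmf" where
  "ens g \<sigma> u = Pi_pmf idx start (\<lambda>x. kern (prate (fst x) g) (flag_rate g) (\<sigma> x) u)"

fun sketch :: "sketch_state \<Rightarrow> nat \<Rightarrow>
    sketch_state pmf" where
  "sketch None u = bind_pmf (hash_pmf K M) (\<lambda>g. map_pmf (\<lambda>\<sigma>. Some (g, \<sigma>)) (ens g (\<lambda>_. start) u))"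
| "sketch (Some (g, \<sigma>)) u = map_pmf (\<lambda>\<sigma>. Some (g, \<sigma>)) (ens g \<sigma> u)"

fun readout :: "sketch_state \<Rightarrow> real" where
  "readout None = 0"
| "readout (Some (g, \<sigma>)) = pick g \<sigma>"

lemma fold_sketch_Some: "fold_pmf sketch (Some (g, \<sigma>)) us = map_pmf (\<lambda>\<sigma>. Some (g, \<sigma>)) (fold_pmf (ens g) \<sigma> us)"
  by (induction us arbitrary: \<sigma>) (simp_all add: map_bind_pmf bind_map_pmf)

lemma fold_sketch_None:
  "fold_pmf sketch None (u # us) = bind_pmf (hash_pmf K M) (\<lambda>g. map_pmf (\<lambda>\<sigma>. Some (g, \<sigma>)) (final g (u # us)))"
proof -
  have f: "fold_pmf (ens g) (\<lambda>_. start) (u # us) = final g (u # us)" for g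
  proof -
    have "ens g = (\<lambda>\<sigma> u. Pi_pmf idx start (\<lambda>x. kern (prate (fst x) g) (flag_rate g) (\<sigma> x) u))"
      by (intro ext) (simp add: ens_def)
    then show ?thesis
      unfolding final_def
      using fold_parallel[OF finite_idx, of "\<lambda>_. start" start "\<lambda>x. kern (prate (fst x) g) (flag_rate g)" "u # us"] by simp
  qed
  have "fold_pmf sketch None (u # us) =
    bind_pmf (hash_pmf K M) (\<lambda>g. map_pmf (\<lambda>\<sigma>. Some (g, \<sigma>)) (fold_pmf (ens g) (\<lambda>_. start) (u # us)))"
    by (simp add: bind_assoc_pmf bind_map_pmf fold_sketch_Some map_bind_pmf)
  then show ?thesis by (simp only: f)
qed

lemma mom_eq: "mom us = freq_moment p n us"
  by (simp add: mom_def freq_moment_def)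

lemma wt_le: "wt g i \<le> real M"
proof -
  have "wt g i \<le> (1 / real M) powr (- (1 / p))"
    unfolding wt_def using unit_hash_bounds[OF M, of K g i] M p by (intro powr_mono2') auto
  also have "\<dots> = real M powr (1 / p)" using M by (simp add: powr_minus_divide powr_divide)
  also have "\<dots> \<le> real M powr 1" using M p by (intro powr_mono) auto
  finally show ?thesis using M by simp
qed

text \<open>The moment lies between \<open>2 ^ s0\<close> and \<open>2 ^ Suc s0\<close> for some
  \<open>s0 < Ng\<close>. For a good seed all guesses from \<open>s0\<close> on are affordable and
  the coins fail with probability at most 1/16; a bad seed has probability at most 3/32.\<close>

lemma sketch_correct:
  fixes \<epsilon> \<theta> W :: real
  defines "nn \<equiv> (if p \<le> 2 then 1 else real n powr (1 - 2 / p))"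
  assumes us: "set us \<subseteq> {1..n}" "length us \<le> m"
    and n: "n < 2 ^ K" and \<epsilon>: "0 < \<epsilon>" "\<epsilon> < 1"
    and vdef: "\<And>s. v s = 2 ^ s / (2 * \<theta>)" and \<theta>: "\<theta> = 2 ^ 18 * (real Ng)\<^sup>2 / \<epsilon>\<^sup>2"
    and Ng: "real m powr p < 2 ^ Ng"
    and up: "(1 + 2 * \<eta>) powr p \<le> 1 + \<epsilon> / 4" and lo: "1 - \<epsilon> / 4 \<le> (1 - 3 * \<eta>) powr p"
    and M8: "8 * real n \<le> \<epsilon> * real M"
    and Z: "B < 2 ^ Z" and Lf: "real m * real M < 2 ^ Lf"
    and l1: "real Z * (real m * exp (- \<rho>)) \<le> 1/16"
    and W: "W = 128 * \<theta> * harm M" "1 \<le> W"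
    and budget: "16 * (L / \<eta>\<^sup>2) * real n powr (1 - 1 / p) * W \<le> B"
    and cap: "32 * real Z * \<rho> * harm m * (L / \<eta>\<^sup>2)\<^sup>2 * nn * W\<^sup>2 \<le> \<kappa>"
    and fail: "real Ng * real R * real n * exp (- L / 8) + real Ng * real n * (1/2) ^ R \<le> 1/16"
  shows "2/3 \<le> measure_pmf.prob (map_pmf readout (fold_pmf sketch None us))
    {x. \<bar>x - freq_moment p n us\<bar> \<le> \<epsilon> * freq_moment p n us}"
proof (cases us)
  \<comment> \<open>The seed has not been drawn: the readout is 0, and so is the moment.\<close>
  case Nil
  have "mom [] = 0" by (simp add: mom_def)
  then show ?thesis by (simp add: Nil mom_eq[symmetric])
next
  case (Cons u us')
  let ?F = "mom us"
  have F1: "1 \<le> ?F"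
  proof -
    have u: "u \<in> {1..n}" "0 < count_list us u" using us Cons by auto
    have "1 \<le> real (count_list us u) powr p" using u(2) p by (intro ge_one_powr_ge_zero) auto
    also have "\<dots> \<le> ?F" unfolding mom_def using u(1) by (intro member_le_sum) auto
    finally show ?thesis .
  qed
  then have F0: "0 < ?F" by simp
  have "?F \<le> real (length us) powr p" unfolding mom_def by (rule sum_count_powr_le[OF us(1) p])
  also have "\<dots> \<le> real m powr p" using us(2) p by (intro powr_mono2) auto
  finally have F2: "?F < 2 ^ Ng" using Ng by simp
  obtain s0 where s0: "2 ^ s0 \<le> ?F" "?F < 2 ^ Suc s0" using pow2_bracket[OF F1] by auto
  have "(2::real) ^ s0 < 2 ^ Ng" using s0 F2 by linarith
  then have s0Ng: "s0 < Ng" by (rule power_less_imp_less_exp[rotated]) simp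
  then have Ng0: "0 < real Ng" by simp
  then have \<theta>0: "0 < \<theta>" using \<epsilon> by (simp add: \<theta>)
  have hM: "0 < (harm M :: real)" using M by (intro harm_pos) auto
  let ?bad = "\<lambda>g \<sigma>. \<not> (\<forall>s<Ng. guess g \<sigma> s \<le> ideal (1 + 2 * \<eta>) g us s \<and>
      (s0 \<le> s \<longrightarrow> ideal (1 - 3 * \<eta>) g us s \<le> guess g \<sigma> s))"
  have coins: "measure_pmf.prob (final g us) {\<sigma>. ?bad g \<sigma>} \<le> 1/16" if g: "good_seed \<epsilon> us g" for g
  proof -
    have "measure_pmf.prob (final g us) {\<sigma>. ?bad g \<sigma>} \<le>
      real Ng * real R * real n * exp (- L / 8) + real Ng * real n * (1/2) ^ R"
    proof (rule prob_final_bad[OF _ Z])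
      fix s assume s: "s0 \<le> s" "s < Ng"
      show "affordable g us Z s"
      proof (rule affordable_of_mass[OF us(1) F0, where H = "32 * harm M" and \<theta> = \<theta> and W = W])
        show "0 < 32 * (harm M :: real)" using hM by simp
        show "W = 4 * \<theta> * (32 * harm M)" using W by simp
        show "(\<Sum>i=1..n. real (count_list us i) powr p / unit_hash K M g i) \<le> 32 * harm M * ?F"
          using g by (simp add: good_seed_def)
        \<comment> \<open>The 4 in the lower bound on \<open>v s\<close> is the 2 in the definition
          of \<open>v\<close> times the factor 2 lost by rounding the moment to a power of
          two.\<close>
        have "?F \<le> 2 ^ Suc s0" using s0 by simp
        also have "\<dots> \<le> 2 ^ Suc s" using s by (intro power_increasing) auto
        finally show "?F / (4 * \<theta>) \<le> v s" using \<theta>0 by (simp add: vdef field_simps)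
        have "32 * real Z * \<rho> * harm (length us) * (L / \<eta>\<^sup>2)\<^sup>2 * nn * W\<^sup>2 \<le>
          32 * real Z * \<rho> * harm m * (L / \<eta>\<^sup>2)\<^sup>2 * nn * W\<^sup>2"
        proof -
          have "harm (length us) \<le> (harm m :: real)" unfolding harm_def using us(2) by (intro sum_mono2) auto
          then show ?thesis using \<rho> by (intro mult_right_mono mult_left_mono) (auto simp: nn_def)
        qed
        then show "32 * real Z * \<rho> * harm (length us) * (L / \<eta>\<^sup>2)\<^sup>2 * (if p \<le> 2 then 1 else real n powr (1 - 2 / p)) * W\<^sup>2 \<le> \<kappa>"
          using cap unfolding nn_def by linarith
      qed (use \<theta>0 W budget in auto)
    next
      fix i
      have "real (length us) * wt g i \<le> real m * real M"
        using us(2) wt_le[of g i] wt_ge[of g i] by (intro mult_mono) auto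
      then show "real (length us) * wt g i < 2 ^ Lf" using Lf by simp
    next
      have "real Z * (real (length us) * exp (- \<rho>)) \<le> real Z * (real m * exp (- \<rho>))"
        using us(2) by (intro mult_left_mono mult_right_mono) auto
      then show "real Z * (real (length us) * exp (- \<rho>)) \<le> 1/16" using l1 by simp
    qed
    then show ?thesis using fail by simp
  qed
  have up2: "(1 + 2 * \<eta>) powr p \<le> 2" using up \<epsilon> by simp
  have "measure_pmf.prob (bind_pmf (hash_pmf K M) (\<lambda>g. map_pmf (\<lambda>\<sigma>. Some (g, \<sigma>)) (final g us)))
    {x. \<not> \<bar>readout x - ?F\<bar> \<le> \<epsilon> * ?F} \<le> 3/32 + 1/16"
  proof (rule prob_bind_split[where G = "good_seed \<epsilon> us"])
    show "measure_pmf.prob (hash_pmf K M) {g. \<not> good_seed \<epsilon> us g} \<le> 3/32"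
      by (rule prob_bad_seed[OF n F0 \<epsilon>(1) up2 Ng0])
    fix g assume g: "good_seed \<epsilon> us g"
    have "measure_pmf.prob (map_pmf (\<lambda>\<sigma>. Some (g, \<sigma>)) (final g us)) {x. \<not> \<bar>readout x - ?F\<bar> \<le> \<epsilon> * ?F} =
      measure_pmf.prob (final g us) {\<sigma>. \<not> \<bar>pick g \<sigma> - ?F\<bar> \<le> \<epsilon> * ?F}" by (simp add: vimage_def)
    also have "\<dots> \<le> measure_pmf.prob (final g us) {\<sigma>. ?bad g \<sigma>}"
    proof (rule prob_mono, rule ccontr)
      fix \<sigma> assume a: "\<not> \<bar>pick g \<sigma> - ?F\<bar> \<le> \<epsilon> * ?F" and b: "\<not> ?bad g \<sigma>"
      have "\<bar>pick g \<sigma> - ?F\<bar> \<le> \<epsilon> * ?F"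
        by (rule pick_accurate[OF g \<epsilon> vdef \<theta> s0Ng s0(1) _ _ up lo M8]) (use b in auto)
      then show False using a by simp
    qed
    also have "\<dots> \<le> 1/16" by (rule coins[OF g])
    finally show "measure_pmf.prob (map_pmf (\<lambda>\<sigma>. Some (g, \<sigma>)) (final g us)) {x. \<not> \<bar>readout x - ?F\<bar> \<le> \<epsilon> * ?F} \<le> 1/16" .
  qed simp
  then have "measure_pmf.prob (map_pmf readout (fold_pmf sketch None us)) {x. \<not> \<bar>x - ?F\<bar> \<le> \<epsilon> * ?F} \<le> 1/3"
    unfolding Cons fold_sketch_None by (simp add: vimage_def)
  moreover have "measure_pmf.prob (map_pmf readout (fold_pmf sketch None us)) {x. \<not> \<bar>x - ?F\<bar> \<le> \<epsilon> * ?F} =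
    1 - measure_pmf.prob (map_pmf readout (fold_pmf sketch None us)) {x. \<bar>x - ?F\<bar> \<le> \<epsilon> * ?F}"
    by (subst measure_pmf.prob_compl[symmetric]) (auto intro!: arg_cong[where f="measure_pmf.prob _"])
  ultimately show ?thesis unfolding mom_eq by simp
qed

definition states :: "sketch_state set" where
  "states = insert None (Some ` (set_pmf (hash_pmf K M) \<times> PiE_dflt idx start (\<lambda>_. {\<sigma>. valid n \<sigma>})))"

text \<open>The 1 pays for storing the seed, a change of state even if no cell moves.\<close>

fun total_progress :: "sketch_state \<Rightarrow> real" where
  "total_progress None = 0"
| "total_progress (Some (g, \<sigma>)) = 1 + (\<Sum>x\<in>idx. progress (\<sigma> x))"

lemma valid_start: "valid n start"
  by (auto simp: held_if_def)

lemma progress_start: "progress start = 0"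
  by (simp add: weight_def)

lemma set_kern:
  assumes "y \<in> set_pmf (kern a b \<sigma> u)"
  shows "\<exists>k smp G. G \<subseteq> {..<Lf} \<and> y = step \<sigma> u k smp G"
proof -
  obtain k c where "y = step \<sigma> u k (c 0) {l. l < Lf \<and> c (Suc l)}"
    using assms unfolding kern_def by (auto simp del: step.simps)
  then show ?thesis by (intro exI[of _ k] exI[of _ "c 0"] exI[of _ "{l. l < Lf \<and> c (Suc l)}"]) (auto simp del: step.simps)
qed

lemma kern_valid:
  assumes "valid n \<sigma>" "u \<in> {1..n}" "y \<in> set_pmf (kern a b \<sigma> u)"
  shows "valid n y"
proof -
  obtain k smp G where "G \<subseteq> {..<Lf}" "y = step \<sigma> u k smp G" using set_kern[OF assms(3)] by (elim exE conjE)
  then show ?thesis using valid_step[OF assms(1,2)] by (simp only:)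
qed

lemma kern_progress:
  assumes "valid n \<sigma>" "y \<in> set_pmf (kern a b \<sigma> u)"
  shows "y = \<sigma> \<or> progress \<sigma> + 1 \<le> progress y"
proof -
  obtain k smp G where "G \<subseteq> {..<Lf}" "y = step \<sigma> u k smp G" using set_kern[OF assms(2)] by (elim exE conjE)
  then show ?thesis using progress_step[OF assms(1), of G u k smp] by (cases "y = \<sigma>") (simp_all only: simp_thms)
qed

lemma ens_set:
  assumes "\<sigma> \<in> PiE_dflt idx start (\<lambda>_. {\<sigma>. valid n \<sigma>})" "u \<in> {1..n}" "\<sigma>' \<in> set_pmf (ens g \<sigma> u)"
  shows "\<sigma>' \<in> PiE_dflt idx start (\<lambda>_. {\<sigma>. valid n \<sigma>})"
    "\<sigma>' = \<sigma> \<or> (\<Sum>x\<in>idx. progress (\<sigma> x)) + 1 \<le> (\<Sum>x\<in>idx. progress (\<sigma>' x))"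
proof -
  have \<sigma>': "\<sigma>' \<in> PiE_dflt idx start (\<lambda>x. set_pmf (kern (prate (fst x) g) (flag_rate g) (\<sigma> x) u))"
    using assms(3) unfolding ens_def set_Pi_pmf[OF finite_idx] by (simp add: o_def)
  note s = PiE_dflt_mem[OF \<sigma>'] and d = PiE_dflt_out[OF \<sigma>'] and d' = PiE_dflt_out[OF assms(1)]
  have val: "valid n (\<sigma> x)" if "x \<in> idx" for x
    using PiE_dflt_mem[OF assms(1) that] unfolding mem_Collect_eq .
  have "valid n (\<sigma>' x)" if "x \<in> idx" for x
    by (rule kern_valid[OF val[OF that] assms(2) s[OF that]])
  then show "\<sigma>' \<in> PiE_dflt idx start (\<lambda>_. {\<sigma>. valid n \<sigma>})"
    using d unfolding PiE_dflt_def mem_Collect_eq by blast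
  have pr: "\<sigma>' x = \<sigma> x \<or> progress (\<sigma> x) + 1 \<le> progress (\<sigma>' x)" if "x \<in> idx" for x
    using kern_progress[OF val[OF that] s[OF that]] .
  show "\<sigma>' = \<sigma> \<or> (\<Sum>x\<in>idx. progress (\<sigma> x)) + 1 \<le> (\<Sum>x\<in>idx. progress (\<sigma>' x))"
  proof (cases "\<sigma>' = \<sigma>")
    case False
    then obtain x where "\<sigma>' x \<noteq> \<sigma> x" by (meson ext)
    then have x: "x \<in> idx" "\<sigma>' x \<noteq> \<sigma> x" using d d' by metis+
    have "(\<Sum>x\<in>idx. progress (\<sigma> x)) + 1 = (progress (\<sigma> x) + 1) + (\<Sum>x\<in>idx - {x}. progress (\<sigma> x))"
      using sum.remove[OF finite_idx x(1), of "\<lambda>x. progress (\<sigma> x)"] by simp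
    also have "\<dots> \<le> progress (\<sigma>' x) + (\<Sum>x\<in>idx - {x}. progress (\<sigma>' x))"
      using pr[OF x(1)] x(2) by (intro add_mono sum_mono) (use pr in force)+
    also have "\<dots> = (\<Sum>x\<in>idx. progress (\<sigma>' x))"
      using sum.remove[OF finite_idx x(1), of "\<lambda>x. progress (\<sigma>' x)"] by simp
    finally show ?thesis by simp
  qed simp
qed

lemma start_ens: "(\<lambda>_. start) \<in> PiE_dflt idx start (\<lambda>_. {\<sigma>. valid n \<sigma>})"
  using valid_start by (simp add: PiE_dflt_def del: valid.simps)

text \<open>The left side of \<open>bits\<close> counts states: one for \<open>None\<close>, and the
  number of seeds times the possible contents of \<open>Ng * R\<close> cells. Progress adds up over
  the cells, since a change of the ensemble moves at least one and none ever loses.\<close>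

lemma sketch_realization:
  assumes Z: "B < 2 ^ Z"
    and bits: "1 + M ^ Suc K * ((B + 1)\<^sup>2 * (n * (B + 1)\<^sup>2 * 2 ^ Lf + 1) ^ (Z * (Lf * \<kappa>) + 16)) ^ (Ng * R) \<le> 2 ^ bb"
  obtains A where
    "\<And>us \<sigma>s. set us \<subseteq> {1..n} \<Longrightarrow> \<sigma>s \<in> set_pmf (run_pmf A us) \<Longrightarrow>
      real (state_changes \<sigma>s) \<le> 1 + real (Ng * R) * ((real Lf + 3) * real B)"
    "\<And>us \<sigma>s \<sigma>. set us \<subseteq> {1..n} \<Longrightarrow> \<sigma>s \<in> set_pmf (run_pmf A us) \<Longrightarrow> \<sigma> \<in> set \<sigma>s \<Longrightarrow> length \<sigma> \<le> bb"
    "\<And>us. set us \<subseteq> {1..n} \<Longrightarrow> output_pmf A us = map_pmf readout (fold_pmf sketch None us)"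
proof (rule finite_state_realization[where X = states and ?x0.0 = None and b = bb and V = "{1..n}" and
    K = sketch and \<mu> = total_progress and D = "1 + real (Ng * R) * ((real Lf + 3) * real B)" and est = readout])
  let ?P = "PiE_dflt idx start (\<lambda>_. {\<sigma>. valid n \<sigma>})"
  have fin: "finite (set_pmf (hash_pmf K M) \<times> ?P)"
    using finite_set_hash_pmf(1)[OF M] valid_finite_card(1)[OF Z] finite_idx by auto
  show "finite states" unfolding states_def using fin by simp
  show "None \<in> states" by (simp add: states_def)
  have "card states \<le> Suc (card (set_pmf (hash_pmf K M) \<times> ?P))"
    unfolding states_def by (rule order_trans[OF card_insert_le_m1[where n="Suc (card (set_pmf (hash_pmf K M) \<times> ?P))"]])
      (use card_image_le[OF fin] in auto)
  also have "card (set_pmf (hash_pmf K M) \<times> ?P) = M ^ Suc K * card {\<sigma>. valid n \<sigma>} ^ (Ng * R)"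
  proof -
    have "card ?P = (\<Prod>x\<in>idx. card {\<sigma>. valid n \<sigma>})"
      using valid_finite_card(1)[OF Z] by (intro card_PiE_dflt finite_idx)
    then show ?thesis
      unfolding card_cartesian_product finite_set_hash_pmf(2)[OF M] by (simp add: idx_def card_cartesian_product)
  qed
  also have "Suc \<dots> \<le> 1 + M ^ Suc K * ((B + 1)\<^sup>2 * (n * (B + 1)\<^sup>2 * 2 ^ Lf + 1) ^ (Z * (Lf * \<kappa>) + 16)) ^ (Ng * R)"
    using valid_finite_card(2)[OF Z] by (simp del: power_Suc valid.simps add: power_mono mult_left_mono)
  also have "\<dots> \<le> 2 ^ bb" by (rule bits)
  finally show "card states \<le> 2 ^ bb" .
  show "set_pmf (sketch x u) \<subseteq> states" if "x \<in> states" "u \<in> {1..n}" for x u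
  proof (cases x)
    case None
    then show ?thesis using ens_set(1)[OF start_ens that(2)] by (auto simp: states_def)
  next
    case (Some y)
    obtain g \<sigma> where "y = (g, \<sigma>)" by (cases y)
    then have "x = Some (g, \<sigma>)" "g \<in> set_pmf (hash_pmf K M)" "\<sigma> \<in> ?P"
      using that(1) Some by (auto simp: states_def)
    then show ?thesis using ens_set(1)[of \<sigma> u] that(2) by (auto simp: states_def)
  qed
  show "total_progress x + 1 \<le> total_progress y"
    if a: "x \<in> states" "u \<in> {1..n}" "y \<in> set_pmf (sketch x u)" "y \<noteq> x" for x u y
  proof (cases x)
    case None
    then obtain g \<sigma> where y: "y = Some (g, \<sigma>)" "\<sigma> \<in> set_pmf (ens g (\<lambda>_. start) u)" using a(3) by auto
    have "0 \<le> (\<Sum>x\<in>idx. progress (\<sigma> x))"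
      using ens_set(2)[OF start_ens a(2) y(2)] progress_start by (auto simp del: progress.simps)
    then show ?thesis using None y by (simp del: progress.simps)
  next
    case (Some z)
    obtain g \<sigma> where "z = (g, \<sigma>)" by (cases z)
    then have x: "x = Some (g, \<sigma>)" "\<sigma> \<in> ?P"
      using a(1) Some by (auto simp: states_def)
    then obtain \<sigma>' where y: "y = Some (g, \<sigma>')" "\<sigma>' \<in> set_pmf (ens g \<sigma> u)" using a(3) by auto
    show ?thesis using ens_set(2)[OF x(2) a(2) y(2)] a(4) x(1) y(1) by (auto simp del: progress.simps)
  qed
  show "total_progress x \<le> total_progress None + (1 + real (Ng * R) * ((real Lf + 3) * real B))" if "x \<in> states" for x
  proof (cases x)
    case None
    then show ?thesis by simp
  next
    case (Some z)
    obtain g \<sigma> where "z = (g, \<sigma>)" by (cases z)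
    then have x: "x = Some (g, \<sigma>)" "\<sigma> \<in> ?P"
      using that(1) Some by (auto simp: states_def)
    have "(\<Sum>y\<in>idx. progress (\<sigma> y)) \<le> (\<Sum>y\<in>idx. (real Lf + 3) * real B)"
    proof (rule sum_mono)
      fix y assume "y \<in> idx"
      from PiE_dflt_mem[OF x(2) this] have "valid n (\<sigma> y)" unfolding mem_Collect_eq .
      then show "progress (\<sigma> y) \<le> (real Lf + 3) * real B" by (rule progress_le)
    qed
    also have "\<dots> = real (Ng * R) * ((real Lf + 3) * real B)" by (simp add: idx_def card_cartesian_product)
    finally show ?thesis by (simp add: x del: progress.simps)
  qed
qed (use that in blast)

end

section \<open>Choice of the parameters\<close>

definition regular :: "nat \<Rightarrow> nat \<Rightarrow> real \<Rightarrow> bool" where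
  "regular n m \<epsilon> \<longleftrightarrow> 1 \<le> n \<and> 1 \<le> m \<and> 1 / (real m * real n) < \<epsilon> \<and> \<epsilon> < 1"

text \<open>
  On regular parameters \<open>1 / \<epsilon> < m n\<close>, so logarithms of \<open>1 / \<epsilon>\<close> count as polylogarithmic factors.
\<close>

definition polylog :: "(nat \<Rightarrow> nat \<Rightarrow> real \<Rightarrow> real) \<Rightarrow> bool" where
  "polylog f \<longleftrightarrow> (\<exists>C k. 0 \<le> C \<and> (\<forall>n m \<epsilon>. regular n m \<epsilon> \<longrightarrow> 0 \<le> f n m \<epsilon> \<and> f n m \<epsilon> \<le> C * lg_mn m n ^ k))"

text \<open>Quantities that are harmless under a logarithm, such as the range of the hash.\<close>

definition polysize :: "(nat \<Rightarrow> nat \<Rightarrow> real \<Rightarrow> real) \<Rightarrow> bool" where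
  "polysize f \<longleftrightarrow> (\<forall>n m \<epsilon>. regular n m \<epsilon> \<longrightarrow> 0 \<le> f n m \<epsilon>) \<and> polylog (\<lambda>n m \<epsilon>. log 2 (1 + f n m \<epsilon>))"

lemma lg_mn_ge_1: "1 \<le> n \<Longrightarrow> 1 \<le> m \<Longrightarrow> 1 \<le> lg_mn m n"
proof -
  assume *: "1 \<le> n" "1 \<le> m"
  have "1 * 1 \<le> real m * real n" using * by (intro mult_mono) auto
  then have "log 2 2 \<le> log 2 (real m * real n + 1)" by (subst log_le_cancel_iff) auto
  then show ?thesis by (simp add: lg_mn_def)
qed

lemma regular_facts:
  assumes "regular n m \<epsilon>"
  shows "1 \<le> n" "1 \<le> m" "0 < \<epsilon>" "\<epsilon> < 1" "1 / \<epsilon> < real m * real n" "1 \<le> 1 / \<epsilon>" "1 \<le> lg_mn m n"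
proof -
  show n: "1 \<le> n" and m: "1 \<le> m" and e: "\<epsilon> < 1" using assms by (auto simp: regular_def)
  have mn: "0 < real m * real n" using n m by simp
  then have "0 < 1 / (real m * real n)" by simp
  then show e0: "0 < \<epsilon>" using assms unfolding regular_def by linarith
  show "1 / \<epsilon> < real m * real n" using assms e0 mn by (simp add: regular_def field_simps)
  show "1 \<le> 1 / \<epsilon>" using e e0 by simp
  show "1 \<le> lg_mn m n" by (rule lg_mn_ge_1[OF n m])
qed

lemma polylog_mono:
  assumes "polylog g" "\<And>n m \<epsilon>. regular n m \<epsilon> \<Longrightarrow> 0 \<le> f n m \<epsilon> \<and> f n m \<epsilon> \<le> g n m \<epsilon>"
  shows "polylog f"
  using assms unfolding polylog_def by (meson order_trans)

lemma polylog_nonneg: "polylog f \<Longrightarrow> regular n m \<epsilon> \<Longrightarrow> 0 \<le> f n m \<epsilon>"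
  unfolding polylog_def by blast

lemma polylog_const: "0 \<le> c \<Longrightarrow> polylog (\<lambda>_ _ _. c)"
  unfolding polylog_def by (intro exI[of _ c] exI[of _ 0]) auto

lemma polylog_lg: "polylog (\<lambda>n m \<epsilon>. lg_mn m n)"
  unfolding polylog_def by (intro exI[of _ 1] exI[of _ 1]) (use regular_facts(7) in force)

lemma polylog_add:
  assumes "polylog f" "polylog g"
  shows "polylog (\<lambda>n m \<epsilon>. f n m \<epsilon> + g n m \<epsilon>)"
proof -
  obtain C k where f: "0 \<le> C" "\<And>n m \<epsilon>. regular n m \<epsilon> \<Longrightarrow> 0 \<le> f n m \<epsilon> \<and> f n m \<epsilon> \<le> C * lg_mn m n ^ k"
    using assms(1) unfolding polylog_def by blast
  obtain D j where g: "0 \<le> D" "\<And>n m \<epsilon>. regular n m \<epsilon> \<Longrightarrow> 0 \<le> g n m \<epsilon> \<and> g n m \<epsilon> \<le> D * lg_mn m n ^ j"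
    using assms(2) unfolding polylog_def by blast
  have "f n m \<epsilon> + g n m \<epsilon> \<le> (C + D) * lg_mn m n ^ (k + j)" if r: "regular n m \<epsilon>" for n m \<epsilon>
  proof -
    have "C * lg_mn m n ^ k \<le> C * lg_mn m n ^ (k + j)" "D * lg_mn m n ^ j \<le> D * lg_mn m n ^ (k + j)"
      using f(1) g(1) regular_facts(7)[OF r] by (intro mult_left_mono power_increasing; simp)+
    then show ?thesis using f(2)[OF r] g(2)[OF r] by (simp add: distrib_right)
  qed
  then show ?thesis unfolding polylog_def
    using f g by (intro exI[of _ "C + D"] exI[of _ "k + j"]) auto
qed

lemma polylog_mult:
  assumes "polylog f" "polylog g"
  shows "polylog (\<lambda>n m \<epsilon>. f n m \<epsilon> * g n m \<epsilon>)"
proof -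
  obtain C k where f: "0 \<le> C" "\<And>n m \<epsilon>. regular n m \<epsilon> \<Longrightarrow> 0 \<le> f n m \<epsilon> \<and> f n m \<epsilon> \<le> C * lg_mn m n ^ k"
    using assms(1) unfolding polylog_def by blast
  obtain D j where g: "0 \<le> D" "\<And>n m \<epsilon>. regular n m \<epsilon> \<Longrightarrow> 0 \<le> g n m \<epsilon> \<and> g n m \<epsilon> \<le> D * lg_mn m n ^ j"
    using assms(2) unfolding polylog_def by blast
  have "f n m \<epsilon> * g n m \<epsilon> \<le> (C * D) * lg_mn m n ^ (k + j)" if r: "regular n m \<epsilon>" for n m \<epsilon>
  proof -
    have "f n m \<epsilon> * g n m \<epsilon> \<le> (C * lg_mn m n ^ k) * (D * lg_mn m n ^ j)"
      using f(1) f(2)[OF r] g(2)[OF r] regular_facts(7)[OF r] by (intro mult_mono) auto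
    then show ?thesis by (simp add: power_add mult_ac)
  qed
  then show ?thesis unfolding polylog_def
    using f g by (intro exI[of _ "C * D"] exI[of _ "k + j"]) auto
qed

lemma polylog_power: "polylog f \<Longrightarrow> polylog (\<lambda>n m \<epsilon>. f n m \<epsilon> ^ i)"
proof (induction i)
  case 0 then show ?case by (simp add: polylog_const)
next
  case (Suc i) then show ?case using polylog_mult[of f] by simp
qed

lemma log2_1_plus_le: "0 \<le> y \<Longrightarrow> log 2 (1 + y) \<le> 2 * (y::real)"
proof -
  assume y: "0 \<le> y"
  have "log 2 (1 + y) \<le> y / ln 2" unfolding log_def using y by (intro divide_right_mono ln_add_one_self_le_self) auto
  also have "\<dots> \<le> y / (1/2)" using y ln2_ge_two_thirds by (intro divide_left_mono) auto
  finally show ?thesis by simp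
qed

lemma ln_le_log2: "1 \<le> y \<Longrightarrow> ln y \<le> log 2 (y::real)"
proof -
  assume y: "1 \<le> y"
  have "ln y * ln 2 \<le> ln y * 1" using y ln_2_less_1 by (intro mult_left_mono) auto
  then show ?thesis by (simp add: log_def field_simps)
qed

lemma polylog_polysize: "polylog f \<Longrightarrow> polysize f"
proof -
  assume f: "polylog f"
  have "polylog (\<lambda>n m \<epsilon>. log 2 (1 + f n m \<epsilon>))"
  proof (rule polylog_mono[OF polylog_mult[OF polylog_const[of 2] f]])
    show "0 \<le> log 2 (1 + f n m \<epsilon>) \<and> log 2 (1 + f n m \<epsilon>) \<le> 2 * f n m \<epsilon>" if "regular n m \<epsilon>" for n m \<epsilon>
      using polylog_nonneg[OF f that] log2_1_plus_le by simp
  qed simp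
  then show ?thesis using polylog_nonneg[OF f] by (simp add: polysize_def)
qed

lemma polysize_log: "polysize f \<Longrightarrow> polylog (\<lambda>n m \<epsilon>. log 2 (1 + f n m \<epsilon>))"
  and polysize_nonneg: "polysize f \<Longrightarrow> regular n m \<epsilon> \<Longrightarrow> 0 \<le> f n m \<epsilon>"
  by (auto simp: polysize_def)

text \<open>Under the last assumption the logarithm of \<open>1 + h\<close> splits into a sum;
  pointwise sums, products and minorants are all of this kind.\<close>

lemma polysize_bound:
  assumes "polysize f" "polysize g"
    and "\<And>n m \<epsilon>. regular n m \<epsilon> \<Longrightarrow> 0 \<le> h n m \<epsilon> \<and> 1 + h n m \<epsilon> \<le> (1 + f n m \<epsilon>) * (1 + g n m \<epsilon>)"
  shows "polysize h"
proof -
  have "polylog (\<lambda>n m \<epsilon>. log 2 (1 + h n m \<epsilon>))"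
  proof (rule polylog_mono[OF polylog_add[OF polysize_log[OF assms(1)] polysize_log[OF assms(2)]]])
    fix n m \<epsilon> assume r: "regular n m \<epsilon>"
    have f: "0 \<le> f n m \<epsilon>" and g: "0 \<le> g n m \<epsilon>" using polysize_nonneg assms(1,2) r by auto
    have "log 2 (1 + h n m \<epsilon>) \<le> log 2 ((1 + f n m \<epsilon>) * (1 + g n m \<epsilon>))"
      using assms(3)[OF r] by (intro log_mono) auto
    also have "\<dots> = log 2 (1 + f n m \<epsilon>) + log 2 (1 + g n m \<epsilon>)" using f g by (simp add: log_mult)
    finally show "0 \<le> log 2 (1 + h n m \<epsilon>) \<and> log 2 (1 + h n m \<epsilon>) \<le> log 2 (1 + f n m \<epsilon>) + log 2 (1 + g n m \<epsilon>)"
      using assms(3)[OF r] by simp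
  qed
  then show ?thesis using assms(3) by (simp add: polysize_def)
qed

lemma polysize_mono:
  assumes "polysize g" "\<And>n m \<epsilon>. regular n m \<epsilon> \<Longrightarrow> 0 \<le> f n m \<epsilon> \<and> f n m \<epsilon> \<le> g n m \<epsilon>"
  shows "polysize f"
  by (rule polysize_bound[OF assms(1) polylog_polysize[OF polylog_const[of 0]]]) (use assms(2) in auto)

lemma polysize_add:
  assumes "polysize f" "polysize g"
  shows "polysize (\<lambda>n m \<epsilon>. f n m \<epsilon> + g n m \<epsilon>)"
proof (rule polysize_bound[OF assms])
  fix n m \<epsilon> assume "regular n m \<epsilon>"
  then have "0 \<le> f n m \<epsilon>" "0 \<le> g n m \<epsilon>" using assms polysize_nonneg by auto
  then show "0 \<le> f n m \<epsilon> + g n m \<epsilon> \<and> 1 + (f n m \<epsilon> + g n m \<epsilon>) \<le> (1 + f n m \<epsilon>) * (1 + g n m \<epsilon>)"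
    by (simp add: algebra_simps)
qed

lemma polysize_mult:
  assumes "polysize f" "polysize g"
  shows "polysize (\<lambda>n m \<epsilon>. f n m \<epsilon> * g n m \<epsilon>)"
proof (rule polysize_bound[OF assms])
  fix n m \<epsilon> assume "regular n m \<epsilon>"
  then have "0 \<le> f n m \<epsilon>" "0 \<le> g n m \<epsilon>" using assms polysize_nonneg by auto
  then show "0 \<le> f n m \<epsilon> * g n m \<epsilon> \<and> 1 + (f n m \<epsilon> * g n m \<epsilon>) \<le> (1 + f n m \<epsilon>) * (1 + g n m \<epsilon>)"
    by (simp add: algebra_simps)
qed

lemma polysize_power: "polysize f \<Longrightarrow> polysize (\<lambda>n m \<epsilon>. f n m \<epsilon> ^ i)"
proof (induction i)
  case 0 then show ?case by (simp add: polylog_const polylog_polysize)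
next
  case (Suc i) then show ?case using polysize_mult[of f] by simp
qed

lemma polysize_basic:
  "polysize (\<lambda>n m \<epsilon>. real n)" "polysize (\<lambda>n m \<epsilon>. real m)" "polysize (\<lambda>n m \<epsilon>. 1 / \<epsilon>)"
proof -
  have mn: "polysize (\<lambda>n m \<epsilon>. real m * real n)"
    unfolding polysize_def
  proof (intro conjI)
    show "polylog (\<lambda>n m \<epsilon>. log 2 (1 + real m * real n))"
      using polylog_lg by (simp add: lg_mn_def add.commute)
  qed simp
  show "polysize (\<lambda>n m \<epsilon>. real n)"
  proof (rule polysize_mono[OF mn])
    fix n m :: nat and \<epsilon> :: real assume r: "regular n m \<epsilon>"
    have "1 * real n \<le> real m * real n" using regular_facts(2)[OF r] by (intro mult_right_mono) auto
    then show "0 \<le> real n \<and> real n \<le> real m * real n" by simp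
  qed
  show "polysize (\<lambda>n m \<epsilon>. real m)"
  proof (rule polysize_mono[OF mn])
    fix n m :: nat and \<epsilon> :: real assume r: "regular n m \<epsilon>"
    have "real m * 1 \<le> real m * real n" using regular_facts(1)[OF r] by (intro mult_left_mono) auto
    then show "0 \<le> real m \<and> real m \<le> real m * real n" by simp
  qed
  show "polysize (\<lambda>n m \<epsilon>. 1 / \<epsilon>)"
    by (rule polysize_mono[OF mn]) (use regular_facts(3,5) in \<open>auto simp: less_imp_le\<close>)
qed

lemma harm_le_log:
  assumes "1 \<le> j"
  shows "harm j \<le> 1 + log 2 (1 + real j)"
proof -
  have "harm j - ln (of_nat j) \<le> harm 1 - ln (of_nat 1 :: real)"
    using assms by (intro euler_mascheroni_sequence_decreasing) auto
  then have "harm j \<le> 1 + ln (real j)" by (simp add: harm_def)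
  also have "ln (real j) \<le> ln (1 + real j)" using assms by simp
  also have "\<dots> \<le> log 2 (1 + real j)" using assms by (intro ln_le_log2) auto
  finally show ?thesis by simp
qed

lemma nat_ceiling_le: "0 \<le> x \<Longrightarrow> real (nat \<lceil>x\<rceil>) \<le> x + 1"
  by linarith

section \<open>The parameters and their growth\<close>

text \<open>Enough for \<open>m powr p < 2 ^ Ng\<close>.\<close>

definition guesses :: "real \<Rightarrow> nat \<Rightarrow> nat \<Rightarrow> real \<Rightarrow> nat" where
  "guesses p n m \<epsilon> = nat \<lceil>p * log 2 (real m)\<rceil> + 1"

text \<open>\<open>Ng * n\<close> pairs of a guess and an item, each missed by all repetitions with
  probability at most \<open>(1/2) ^ R\<close>, must fail with at most 1/32 in total.\<close>

definition reps :: "real \<Rightarrow> nat \<Rightarrow> nat \<Rightarrow> real \<Rightarrow> nat" where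
  "reps p n m \<epsilon> = nat \<lceil>log 2 (1 + 32 * real (guesses p n m \<epsilon>) * real n)\<rceil> + 1"

text \<open>The logarithm makes \<open>exp (- L / 8)\<close> at most 1/32 divided by the number of
  possible overcounts; the summand 3 secures the lower bound on \<open>L\<close>.\<close>

definition oversampling :: "real \<Rightarrow> nat \<Rightarrow> nat \<Rightarrow> real \<Rightarrow> real" where
  "oversampling p n m \<epsilon> = 8 * log 2 (1 + 32 * real (guesses p n m \<epsilon>) * real (reps p n m \<epsilon>) * real n) + 3"

text \<open>Keeps the bias \<open>n * v / M\<close> within an eighth of \<epsilon> times the
  moment.\<close>

definition grid :: "nat \<Rightarrow> nat \<Rightarrow> real \<Rightarrow> nat" where
  "grid n m \<epsilon> = nat \<lceil>8 * real n / \<epsilon>\<rceil>"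

text \<open>\<open>L / \<eta>\<^sup>2\<close> without its power of \<epsilon>; 256 is the square of
  the 16 in \<open>\<eta> = \<epsilon> / (16 * p)\<close>.\<close>

definition sample_factor :: "real \<Rightarrow> nat \<Rightarrow> nat \<Rightarrow> real \<Rightarrow> real" where
  "sample_factor p n m \<epsilon> = 256 * p\<^sup>2 * oversampling p n m \<epsilon>"

text \<open>\<open>W\<close> without its power of \<epsilon>; \<open>2 ^ 25\<close> is 128 times the
  \<open>2 ^ 18\<close> in \<open>\<theta>\<close>.\<close>

definition mass_factor :: "real \<Rightarrow> nat \<Rightarrow> nat \<Rightarrow> real \<Rightarrow> real" where
  "mass_factor p n m \<epsilon> = 2 ^ 25 * (real (guesses p n m \<epsilon>))\<^sup>2 * harm (grid n m \<epsilon>)"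

definition budget :: "real \<Rightarrow> nat \<Rightarrow> nat \<Rightarrow> real \<Rightarrow> nat" where
  "budget p n m \<epsilon> = nat \<lceil>16 * (sample_factor p n m \<epsilon> * (1 / \<epsilon>) ^ 2) * real n powr (1 - 1 / p) *
     (mass_factor p n m \<epsilon> * (1 / \<epsilon>) ^ 2)\<rceil> + 1"

definition scales :: "real \<Rightarrow> nat \<Rightarrow> nat \<Rightarrow> real \<Rightarrow> nat" where
  "scales p n m \<epsilon> = nat \<lfloor>log 2 (real (budget p n m \<epsilon>))\<rfloor> + 1"

text \<open>Makes \<open>exp (- \<rho>)\<close> small enough for a union over \<open>Z\<close>
  scales and \<open>m\<close> updates.\<close>

definition flag_factor :: "real \<Rightarrow> nat \<Rightarrow> nat \<Rightarrow> real \<Rightarrow> real" where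
  "flag_factor p n m \<epsilon> = log 2 (1 + 16 * real (scales p n m \<epsilon>) * real m) + 1"

definition levels :: "nat \<Rightarrow> nat \<Rightarrow> real \<Rightarrow> nat" where
  "levels n m \<epsilon> = nat \<lfloor>log 2 (real m * real (grid n m \<epsilon>))\<rfloor> + 1"

definition dim_factor :: "real \<Rightarrow> nat \<Rightarrow> real" where
  "dim_factor p n = (if p \<le> 2 then 1 else real n powr (1 - 2 / p))"

definition capacity :: "real \<Rightarrow> nat \<Rightarrow> nat \<Rightarrow> real \<Rightarrow> nat" where
  "capacity p n m \<epsilon> = nat \<lceil>32 * real (scales p n m \<epsilon>) * flag_factor p n m \<epsilon> * harm m *
     (sample_factor p n m \<epsilon> * (1 / \<epsilon>) ^ 2)\<^sup>2 * dim_factor p n * (mass_factor p n m \<epsilon> * (1 / \<epsilon>) ^ 2)\<^sup>2\<rceil> + 1"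

definition key_length :: "nat \<Rightarrow> nat \<Rightarrow> real \<Rightarrow> nat" where
  "key_length n m \<epsilon> = nat \<lceil>lg_mn m n\<rceil>"

lemma grid_facts:
  assumes "regular n m \<epsilon>"
  shows "1 \<le> grid n m \<epsilon>" "8 * real n \<le> \<epsilon> * real (grid n m \<epsilon>)" "real (grid n m \<epsilon>) \<le> 8 * real n * (1 / \<epsilon>) + 1"
proof -
  note r = regular_facts[OF assms]
  have pos: "0 < 8 * real n / \<epsilon>" using r by simp
  show "1 \<le> grid n m \<epsilon>" using pos by (simp add: grid_def Suc_le_eq)
  have "8 * real n / \<epsilon> \<le> real (grid n m \<epsilon>)" unfolding grid_def by linarith
  then show "8 * real n \<le> \<epsilon> * real (grid n m \<epsilon>)" using r(3) by (simp add: field_simps)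
  show "real (grid n m \<epsilon>) \<le> 8 * real n * (1 / \<epsilon>) + 1"
    using nat_ceiling_le[of "8 * real n / \<epsilon>"] pos by (simp add: grid_def)
qed

lemma polysize_grid: "polysize (\<lambda>n m \<epsilon>. real (grid n m \<epsilon>))"
proof (rule polysize_mono)
  show "polysize (\<lambda>n m \<epsilon>. 8 * real n * (1 / \<epsilon>) + 1)"
    by (intro polysize_add polysize_mult polysize_basic polylog_polysize polylog_const) auto
qed (use grid_facts(3) in auto)

lemma polylog_harm:
  assumes "polysize (\<lambda>n m \<epsilon>. real (f n m \<epsilon>))" "\<And>n m \<epsilon>. regular n m \<epsilon> \<Longrightarrow> 1 \<le> f n m \<epsilon>"
  shows "polylog (\<lambda>n m \<epsilon>. harm (f n m \<epsilon>))"
proof (rule polylog_mono[OF polylog_add[OF polylog_const[of 1] polysize_log[OF assms(1)]]])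
  show "0 \<le> (harm (f n m \<epsilon>) :: real) \<and> harm (f n m \<epsilon>) \<le> 1 + log 2 (1 + real (f n m \<epsilon>))" if "regular n m \<epsilon>" for n m \<epsilon>
    using harm_le_log[OF assms(2)[OF that]] harm_nonneg by blast
qed simp

lemma less_two_power_floor_log:
  assumes "1 \<le> x"
  shows "x < 2 ^ (nat \<lfloor>log 2 x\<rfloor> + 1)" "real (nat \<lfloor>log 2 x\<rfloor> + 1) \<le> log 2 x + 1"
proof -
  have l: "0 \<le> log 2 x" using assms by simp
  then show "real (nat \<lfloor>log 2 x\<rfloor> + 1) \<le> log 2 x + 1" by simp
  have "log 2 x < real (nat \<lfloor>log 2 x\<rfloor> + 1)" using l by linarith
  then have "x < 2 powr real (nat \<lfloor>log 2 x\<rfloor> + 1)" using assms by (subst (asm) log_less_iff) auto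
  then show "x < 2 ^ (nat \<lfloor>log 2 x\<rfloor> + 1)" by (simp only: powr_realpow zero_less_numeral)
qed

context
  fixes p :: real
  assumes p: "1 \<le> p"
begin

lemma polylog_guesses: "polylog (\<lambda>n m \<epsilon>. real (guesses p n m \<epsilon>))"
proof (rule polylog_mono[OF polylog_add[OF polylog_mult[OF polylog_const[of p] polysize_log[OF polysize_basic(2)]] polylog_const[of 2]]])
  fix n m :: nat and \<epsilon> :: real assume r: "regular n m \<epsilon>"
  have "0 \<le> log 2 (real m)" "log 2 (real m) \<le> log 2 (1 + real m)" using regular_facts(2)[OF r] by auto
  then have "0 \<le> p * log 2 (real m)" "p * log 2 (real m) \<le> p * log 2 (1 + real m)"
    using p by (auto intro: mult_left_mono)
  then show "0 \<le> real (guesses p n m \<epsilon>) \<and> real (guesses p n m \<epsilon>) \<le> p * log 2 (1 + real m) + 2"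
    using nat_ceiling_le[of "p * log 2 (real m)"] unfolding guesses_def of_nat_add of_nat_1 by linarith
qed (use p in auto)

lemma polylog_reps: "polylog (\<lambda>n m \<epsilon>. real (reps p n m \<epsilon>))"
proof (rule polylog_mono[OF polylog_add[OF polysize_log[OF polysize_mult[OF polysize_mult[OF
        polylog_polysize[OF polylog_const[of 32]] polylog_polysize[OF polylog_guesses]] polysize_basic(1)]] polylog_const[of 2]]])
  fix n m :: nat and \<epsilon> :: real
  have "0 \<le> log 2 (1 + 32 * real (guesses p n m \<epsilon>) * real n)"
    by (subst zero_le_log_cancel_iff) (auto intro: add_pos_nonneg)
  from nat_ceiling_le[OF this]
  show "0 \<le> real (reps p n m \<epsilon>) \<and> real (reps p n m \<epsilon>) \<le> log 2 (1 + 32 * real (guesses p n m \<epsilon>) * real n) + 2"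
    unfolding reps_def of_nat_add of_nat_1 by linarith
qed auto

lemma polylog_oversampling: "polylog (\<lambda>n m \<epsilon>. oversampling p n m \<epsilon>)"
  unfolding oversampling_def
  by (intro polylog_add polylog_mult[OF polylog_const] polysize_log polysize_mult polysize_basic
      polylog_polysize polylog_guesses polylog_reps polylog_const) auto

lemma polylog_sample_factor: "polylog (\<lambda>n m \<epsilon>. sample_factor p n m \<epsilon>)"
  unfolding sample_factor_def by (intro polylog_mult polylog_const polylog_oversampling) auto

lemma polylog_mass_factor: "polylog (\<lambda>n m \<epsilon>. mass_factor p n m \<epsilon>)"
  unfolding mass_factor_def
  by (intro polylog_mult polylog_const polylog_power polylog_guesses polylog_harm polysize_grid grid_facts) auto

lemma budget_le:
  assumes "regular n m \<epsilon>"
  shows "real (budget p n m \<epsilon>) \<le> (16 * sample_factor p n m \<epsilon> * mass_factor p n m \<epsilon> + 2) * (real n powr (1 - 1 / p) * (1 / \<epsilon>) ^ 4)"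
proof -
  note r = regular_facts[OF assms]
  let ?x = "16 * (sample_factor p n m \<epsilon> * (1 / \<epsilon>) ^ 2) * real n powr (1 - 1 / p) * (mass_factor p n m \<epsilon> * (1 / \<epsilon>) ^ 2)"
  let ?Q = "real n powr (1 - 1 / p) * (1 / \<epsilon>) ^ 4"
  have e: "?x = 16 * sample_factor p n m \<epsilon> * mass_factor p n m \<epsilon> * ?Q" by (simp add: power2_eq_square power4_eq_xxxx mult_ac)
  have "0 \<le> ?x"
    using polylog_nonneg[OF polylog_sample_factor assms] polylog_nonneg[OF polylog_mass_factor assms] r by simp
  from nat_ceiling_le[OF this] have "real (budget p n m \<epsilon>) \<le> ?x + 2"
    unfolding budget_def of_nat_add of_nat_1 by linarith
  moreover have "1 * 1 \<le> ?Q"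
    using r p by (intro mult_mono one_le_power ge_one_powr_ge_zero) auto
  ultimately show ?thesis unfolding e by (simp add: distrib_right)
qed

lemma polysize_budget: "polysize (\<lambda>n m \<epsilon>. real (budget p n m \<epsilon>))"
proof (rule polysize_mono)
  show "polysize (\<lambda>n m \<epsilon>. (16 * sample_factor p n m \<epsilon> * mass_factor p n m \<epsilon> + 2) * (real n * (1 / \<epsilon>) ^ 4))"
    by (intro polysize_add polysize_mult polysize_power polysize_basic polylog_polysize[OF polylog_sample_factor]
        polylog_polysize[OF polylog_mass_factor] polylog_polysize[OF polylog_const]) auto
  fix n m :: nat and \<epsilon> :: real assume r: "regular n m \<epsilon>"
  have "real n powr (1 - 1 / p) \<le> real n powr 1" using regular_facts[OF r] p by (intro powr_mono) auto
  then have "(16 * sample_factor p n m \<epsilon> * mass_factor p n m \<epsilon> + 2) * (real n powr (1 - 1 / p) * (1 / \<epsilon>) ^ 4) \<le>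
    (16 * sample_factor p n m \<epsilon> * mass_factor p n m \<epsilon> + 2) * (real n * (1 / \<epsilon>) ^ 4)"
    using polylog_nonneg[OF polylog_sample_factor r] polylog_nonneg[OF polylog_mass_factor r] regular_facts[OF r]
    by (intro mult_left_mono mult_right_mono) auto
  then show "0 \<le> real (budget p n m \<epsilon>) \<and> real (budget p n m \<epsilon>) \<le>
    (16 * sample_factor p n m \<epsilon> * mass_factor p n m \<epsilon> + 2) * (real n * (1 / \<epsilon>) ^ 4)"
    using budget_le[OF r] by simp
qed

lemma polylog_scales: "polylog (\<lambda>n m \<epsilon>. real (scales p n m \<epsilon>))"
proof (rule polylog_mono[OF polylog_add[OF polysize_log[OF polysize_budget] polylog_const[of 1]]])
  fix n m :: nat and \<epsilon> :: real
  have b: "1 \<le> real (budget p n m \<epsilon>)" by (simp add: budget_def)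
  have "real (scales p n m \<epsilon>) \<le> log 2 (real (budget p n m \<epsilon>)) + 1"
    unfolding scales_def by (rule less_two_power_floor_log(2)[OF b])
  also have "log 2 (real (budget p n m \<epsilon>)) \<le> log 2 (1 + real (budget p n m \<epsilon>))" using b by simp
  finally show "0 \<le> real (scales p n m \<epsilon>) \<and> real (scales p n m \<epsilon>) \<le> log 2 (1 + real (budget p n m \<epsilon>)) + 1"
    by simp
qed simp

lemma polylog_flag_factor: "polylog (\<lambda>n m \<epsilon>. flag_factor p n m \<epsilon>)"
  unfolding flag_factor_def
  by (intro polylog_add polysize_log polysize_mult polysize_basic polylog_polysize[OF polylog_scales]
      polylog_polysize[OF polylog_const] polylog_const) auto

lemma polylog_levels: "polylog (\<lambda>n m \<epsilon>. real (levels n m \<epsilon>))"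
proof (rule polylog_mono[OF polylog_add[OF polysize_log[OF polysize_mult[OF polysize_basic(2) polysize_grid]] polylog_const[of 1]]])
  fix n m :: nat and \<epsilon> :: real assume r: "regular n m \<epsilon>"
  have "1 * 1 \<le> real m * real (grid n m \<epsilon>)" using regular_facts(2)[OF r] grid_facts(1)[OF r] by (intro mult_mono) auto
  then have b: "1 \<le> real m * real (grid n m \<epsilon>)" by simp
  have "real (levels n m \<epsilon>) \<le> log 2 (real m * real (grid n m \<epsilon>)) + 1"
    unfolding levels_def by (rule less_two_power_floor_log(2)[OF b])
  also have "log 2 (real m * real (grid n m \<epsilon>)) \<le> log 2 (1 + real m * real (grid n m \<epsilon>))"
    by (rule log_mono) (use b in linarith)+
  finally show "0 \<le> real (levels n m \<epsilon>) \<and> real (levels n m \<epsilon>) \<le> log 2 (1 + real m * real (grid n m \<epsilon>)) + 1"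
    by simp
qed simp

lemma dim_factor_ge_1: "1 \<le> n \<Longrightarrow> 1 \<le> dim_factor p n"
  by (auto simp: dim_factor_def field_simps intro!: ge_one_powr_ge_zero)

lemma polylog_harm_length: "polylog (\<lambda>n m \<epsilon>. harm m)"
  by (rule polylog_harm[OF polysize_basic(2) regular_facts(2)])

definition capacity_factor :: "nat \<Rightarrow> nat \<Rightarrow> real \<Rightarrow> real" where
  "capacity_factor n m \<epsilon> = 32 * real (scales p n m \<epsilon>) * flag_factor p n m \<epsilon> * harm m *
     (sample_factor p n m \<epsilon>)\<^sup>2 * (mass_factor p n m \<epsilon>)\<^sup>2 + 2"

lemma polylog_capacity_factor: "polylog capacity_factor"
proof -
  have "polylog (\<lambda>n m \<epsilon>. capacity_factor n m \<epsilon>)"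
    unfolding capacity_factor_def
    by (intro polylog_add polylog_mult polylog_power polylog_scales polylog_flag_factor polylog_harm_length
        polylog_sample_factor polylog_mass_factor polylog_const) auto
  then show ?thesis by simp
qed

lemma capacity_le:
  assumes "regular n m \<epsilon>"
  shows "real (capacity p n m \<epsilon>) \<le> capacity_factor n m \<epsilon> * (dim_factor p n * (1 / \<epsilon>) ^ 8)"
proof -
  note r = regular_facts[OF assms]
  let ?Q = "dim_factor p n * (1 / \<epsilon>) ^ 8"
  let ?c = "32 * real (scales p n m \<epsilon>) * flag_factor p n m \<epsilon> * harm m * (sample_factor p n m \<epsilon>)\<^sup>2 * (mass_factor p n m \<epsilon>)\<^sup>2"
  let ?x = "32 * real (scales p n m \<epsilon>) * flag_factor p n m \<epsilon> * harm m *
     (sample_factor p n m \<epsilon> * (1 / \<epsilon>) ^ 2)\<^sup>2 * dim_factor p n * (mass_factor p n m \<epsilon> * (1 / \<epsilon>) ^ 2)\<^sup>2"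
  have "((1 / \<epsilon>) ^ 2)\<^sup>2 * ((1 / \<epsilon>) ^ 2)\<^sup>2 = (1 / \<epsilon>) ^ 8" by (simp add: power_mult[symmetric] power_add[symmetric] del: power_divide power_one_over)
  then have e: "?x = ?c * ?Q" by (simp only: power_mult_distrib mult_ac)
  have Q: "1 * 1 \<le> ?Q"
    using dim_factor_ge_1[OF r(1)] one_le_power[OF r(6), of 8] by (intro mult_mono) auto
  have "0 \<le> ?c"
    using polylog_nonneg[OF polylog_flag_factor assms] polylog_nonneg[OF polylog_harm_length assms] by simp
  then have "0 \<le> ?x" unfolding e using Q by (intro mult_nonneg_nonneg[of ?c ?Q]) auto
  from nat_ceiling_le[OF this] have "real (capacity p n m \<epsilon>) \<le> ?x + 2"
    unfolding capacity_def of_nat_add of_nat_1 by linarith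
  also have "\<dots> \<le> ?c * ?Q + 2 * ?Q" unfolding e using Q by simp
  also have "\<dots> = capacity_factor n m \<epsilon> * ?Q" unfolding capacity_factor_def by (rule distrib_right[symmetric])
  finally show ?thesis .
qed

definition bits :: "nat \<Rightarrow> nat \<Rightarrow> real \<Rightarrow> nat" where
  "bits n m \<epsilon> = nat \<lceil>log 2 (real (1 + grid n m \<epsilon> ^ Suc (key_length n m \<epsilon>) *
     ((budget p n m \<epsilon> + 1)\<^sup>2 * (n * (budget p n m \<epsilon> + 1)\<^sup>2 * 2 ^ levels n m \<epsilon> + 1) ^
       (scales p n m \<epsilon> * (levels n m \<epsilon> * capacity p n m \<epsilon>) + 16)) ^ (guesses p n m \<epsilon> * reps p n m \<epsilon>)))\<rceil>"

text \<open>The cost of one held item: its name, start value, count and set of flags.\<close>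

definition entry_bits :: "nat \<Rightarrow> nat \<Rightarrow> real \<Rightarrow> real" where
  "entry_bits n m \<epsilon> = log 2 (1 + real n * (real (budget p n m \<epsilon>) + 1)\<^sup>2 * 2 ^ levels n m \<epsilon>)"

definition bits_factor :: "nat \<Rightarrow> nat \<Rightarrow> real \<Rightarrow> real" where
  "bits_factor n m \<epsilon> = 2 + (lg_mn m n + 2) * log 2 (1 + real (grid n m \<epsilon>)) +
     real (guesses p n m \<epsilon>) * real (reps p n m \<epsilon>) * (2 * log 2 (1 + real (budget p n m \<epsilon>)) +
       (real (scales p n m \<epsilon>) * (real (levels n m \<epsilon>) * capacity_factor n m \<epsilon>) + 16) * entry_bits n m \<epsilon>)"

lemma polylog_entry_bits: "polylog (\<lambda>n m \<epsilon>. entry_bits n m \<epsilon>)"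
proof -
  have "polysize (\<lambda>n m \<epsilon>. 2 ^ levels n m \<epsilon>)"
    unfolding polysize_def
  proof (intro conjI allI impI)
    show "polylog (\<lambda>n m \<epsilon>. log 2 (1 + 2 ^ levels n m \<epsilon>))"
    proof (rule polylog_mono[OF polylog_add[OF polylog_const[of 1] polylog_levels]])
      fix n m :: nat and \<epsilon> :: real
      have "log 2 (1 + 2 ^ levels n m \<epsilon>) \<le> log 2 (2 ^ Suc (levels n m \<epsilon>))"
        by (intro log_mono) (auto intro: add_pos_pos)
      also have "\<dots> = 1 + real (levels n m \<epsilon>)" by (subst log_nat_power) auto
      finally have "log 2 (1 + 2 ^ levels n m \<epsilon>) \<le> 1 + real (levels n m \<epsilon>)" .
      moreover have "0 \<le> log 2 (1 + 2 ^ levels n m \<epsilon>)"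
        by (subst zero_le_log_cancel_iff) (auto intro: add_pos_pos)
      ultimately show "0 \<le> log 2 (1 + 2 ^ levels n m \<epsilon>) \<and> log 2 (1 + 2 ^ levels n m \<epsilon>) \<le> 1 + real (levels n m \<epsilon>)"
        by simp
    qed simp
  qed simp
  then show ?thesis
    unfolding entry_bits_def
    by (intro polysize_log polysize_mult polysize_power polysize_add polysize_basic polysize_budget
        polylog_polysize[OF polylog_const]) auto
qed

lemma polylog_bits_factor: "polylog bits_factor"
proof -
  have "polylog (\<lambda>n m \<epsilon>. bits_factor n m \<epsilon>)"
    unfolding bits_factor_def
    by (intro polylog_add polylog_mult polylog_const polylog_lg polysize_log[OF polysize_grid] polylog_guesses
        polylog_reps polysize_log[OF polysize_budget] polylog_scales polylog_levels polylog_entry_bits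
        polylog_capacity_factor) auto
  then show ?thesis by simp
qed

text \<open>Only \<open>capacity\<close> carries the factors \<open>dim_factor\<close> and
  \<open>(1 / \<epsilon>) ^ 8\<close>, and it enters linearly as the number of entries. All other
  terms are polylogarithmic and may be multiplied by these factors, whose product is at least
  1.\<close>

lemma bits_le:
  assumes reg: "regular n m \<epsilon>"
  shows "real (bits n m \<epsilon>) \<le> bits_factor n m \<epsilon> * (dim_factor p n * (1 / \<epsilon>) ^ 8)"
proof -
  note r = regular_facts[OF reg]
  let ?Q = "dim_factor p n * (1 / \<epsilon>) ^ 8"
  let ?G = "grid n m \<epsilon>" and ?B = "budget p n m \<epsilon>" and ?e = "scales p n m \<epsilon> * (levels n m \<epsilon> * capacity p n m \<epsilon>) + 16"
    and ?D = "n * (budget p n m \<epsilon> + 1)\<^sup>2 * 2 ^ levels n m \<epsilon> + 1" and ?k = "key_length n m \<epsilon>"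
  let ?V = "(?B + 1)\<^sup>2 * ?D ^ ?e" and ?NR = "guesses p n m \<epsilon> * reps p n m \<epsilon>"
  have log_V: "log 2 (real ((c + 1)\<^sup>2 * d ^ e)) = 2 * log 2 (real c + 1) + real e * log 2 (real d)"
    if "0 < d" for c d e :: nat
  proof -
    have "log 2 (real ((c + 1)\<^sup>2 * d ^ e)) = log 2 ((real c + 1)\<^sup>2 * real d ^ e)" by (simp add: add.commute)
    also have "\<dots> = log 2 ((real c + 1)\<^sup>2) + log 2 (real d ^ e)" using that by (subst log_mult) auto
    also have "\<dots> = 2 * log 2 (real c + 1) + real e * log 2 (real d)" using that by (simp add: log_nat_power)
    finally show ?thesis .
  qed
  have G: "1 \<le> ?G" by (rule grid_facts(1)[OF reg])
  have D1: "1 \<le> ?D" by simp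
  have V1: "0 < ?V" by simp
  define y where "y = ?G ^ Suc ?k * ?V ^ ?NR"
  have y1: "1 \<le> y" unfolding y_def using G V1 by (simp add: Suc_le_eq del: power_Suc)
  have Q: "1 \<le> ?Q"
    using mult_mono[OF dim_factor_ge_1[OF r(1)] one_le_power[OF r(6), of 8]] dim_factor_ge_1[OF r(1)] by simp
  have lD: "log 2 (real ?D) = entry_bits n m \<epsilon>" by (simp add: entry_bits_def add.commute)
  have lD0: "0 \<le> entry_bits n m \<epsilon>" by (rule polylog_nonneg[OF polylog_entry_bits reg])
  have "log 2 (real (1 + y)) \<le> log 2 (real (2 * y))" using y1 by (intro log_mono) auto
  also have "\<dots> = 1 + log 2 (real y)" using y1 by (simp add: log_mult)
  also have "log 2 (real y) = real (Suc ?k) * log 2 (real ?G) + real ?NR * log 2 (real ?V)"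
    unfolding y_def using G V1 by (simp add: log_mult log_nat_power del: power_Suc of_nat_Suc of_nat_add)
  also have "log 2 (real ?V) = 2 * log 2 (real ?B + 1) + real ?e * log 2 (real ?D)"
    by (rule log_V) simp
  finally have main: "log 2 (real (1 + y)) \<le> 1 + (real (Suc ?k) * log 2 (real ?G) + real ?NR * (2 * log 2 (real ?B + 1) + real ?e * entry_bits n m \<epsilon>))"
    unfolding lD .
  have k: "real (Suc ?k) \<le> lg_mn m n + 2" 
  proof -
    have "real ?k \<le> lg_mn m n + 1" unfolding key_length_def by (rule nat_ceiling_le) (use r(7) in linarith)
    then show ?thesis by simp
  qed
  have lG: "0 \<le> log 2 (real ?G)" "log 2 (real ?G) \<le> log 2 (1 + real ?G)" using G by auto
  have t1: "real (Suc ?k) * log 2 (real ?G) \<le> (lg_mn m n + 2) * log 2 (1 + real ?G)"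
    using k lG r(7) by (intro mult_mono) auto
  have lB: "0 \<le> log 2 (real ?B + 1)" by simp
  have e: "real ?e \<le> (real (scales p n m \<epsilon>) * (real (levels n m \<epsilon>) * capacity_factor n m \<epsilon>) + 16) * ?Q"
  proof -
    have "real (scales p n m \<epsilon>) * (real (levels n m \<epsilon>) * real (capacity p n m \<epsilon>)) \<le>
      real (scales p n m \<epsilon>) * (real (levels n m \<epsilon>) * (capacity_factor n m \<epsilon> * ?Q))"
      using capacity_le[OF reg] by (intro mult_left_mono) auto
    then show ?thesis using Q by (simp add: distrib_right mult.assoc)
  qed
  have t2: "real ?NR * (2 * log 2 (real ?B + 1) + real ?e * entry_bits n m \<epsilon>) \<le>
    real (guesses p n m \<epsilon>) * real (reps p n m \<epsilon>) * ((2 * log 2 (1 + real ?B) +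
       (real (scales p n m \<epsilon>) * (real (levels n m \<epsilon>) * capacity_factor n m \<epsilon>) + 16) * entry_bits n m \<epsilon>) * ?Q)"
  proof -
    have "2 * log 2 (real ?B + 1) * 1 \<le> 2 * log 2 (1 + real ?B) * ?Q"
      using lB Q by (intro mult_mono) (auto simp: add.commute)
    moreover have "real ?e * entry_bits n m \<epsilon> \<le>
      ((real (scales p n m \<epsilon>) * (real (levels n m \<epsilon>) * capacity_factor n m \<epsilon>) + 16) * ?Q) * entry_bits n m \<epsilon>"
      using e lD0 by (rule mult_right_mono)
    ultimately have "2 * log 2 (real ?B + 1) + real ?e * entry_bits n m \<epsilon> \<le> 2 * log 2 (1 + real ?B) * ?Q +
      ((real (scales p n m \<epsilon>) * (real (levels n m \<epsilon>) * capacity_factor n m \<epsilon>) + 16) * ?Q) * entry_bits n m \<epsilon>"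
      by linarith
    also have "\<dots> = (2 * log 2 (1 + real ?B) +
       (real (scales p n m \<epsilon>) * (real (levels n m \<epsilon>) * capacity_factor n m \<epsilon>) + 16) * entry_bits n m \<epsilon>) * ?Q"
    proof -
      have "x * q + (s * q) * d = (x + s * d) * q" for x q s d :: real by (simp add: algebra_simps)
      then show ?thesis .
    qed
    finally show ?thesis unfolding of_nat_mult by (rule mult_left_mono) simp
  qed
  have l0: "0 \<le> log 2 (real (1 + y))" by simp
  have t3: "(2 + (lg_mn m n + 2) * log 2 (1 + real ?G)) * 1 \<le> (2 + (lg_mn m n + 2) * log 2 (1 + real ?G)) * ?Q"
    using Q r(7) lG by (intro mult_left_mono add_nonneg_nonneg mult_nonneg_nonneg) auto
  have "real (bits n m \<epsilon>) \<le> log 2 (real (1 + y)) + 1"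
    unfolding bits_def using nat_ceiling_le[OF l0] unfolding y_def .
  also have "\<dots> \<le> (2 + (lg_mn m n + 2) * log 2 (1 + real ?G)) * 1 +
    real ?NR * (2 * log 2 (real ?B + 1) + real ?e * entry_bits n m \<epsilon>)"
  proof -
    have "x + 1 \<le> (2 + u) * 1 + w" if "x \<le> 1 + (t + w)" "t \<le> u" for x t u w :: real using that by simp
    then show ?thesis using main t1 .
  qed
  also have "\<dots> \<le> bits_factor n m \<epsilon> * ?Q"
  proof -
    have distr: "x * q + w * (h * q) = (x + w * h) * q" for x w h q :: real by (simp add: algebra_simps)
    show ?thesis unfolding bits_factor_def
      by (rule order_trans[OF add_mono[OF t3 t2] eq_refl[OF distr]])
  qed
  finally show ?thesis .
qed

definition changes_factor :: "nat \<Rightarrow> nat \<Rightarrow> real \<Rightarrow> real" where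
  "changes_factor n m \<epsilon> = 1 + real (guesses p n m \<epsilon>) * real (reps p n m \<epsilon>) * ((real (levels n m \<epsilon>) + 3) *
     (16 * sample_factor p n m \<epsilon> * mass_factor p n m \<epsilon> + 2))"

lemma polylog_changes_factor: "polylog changes_factor"
proof -
  have "polylog (\<lambda>n m \<epsilon>. changes_factor n m \<epsilon>)"
    unfolding changes_factor_def
    by (intro polylog_add polylog_mult polylog_const polylog_guesses polylog_reps polylog_levels
        polylog_sample_factor polylog_mass_factor) auto
  then show ?thesis by simp
qed

lemma changes_le:
  assumes reg: "regular n m \<epsilon>"
  shows "1 + real (guesses p n m \<epsilon> * reps p n m \<epsilon>) * ((real (levels n m \<epsilon>) + 3) * real (budget p n m \<epsilon>)) \<le>
    changes_factor n m \<epsilon> * (real n powr (1 - 1 / p) * (1 / \<epsilon>) ^ 4)"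
proof -
  note r = regular_facts[OF reg]
  let ?Q = "real n powr (1 - 1 / p) * (1 / \<epsilon>) ^ 4"
  let ?c = "16 * sample_factor p n m \<epsilon> * mass_factor p n m \<epsilon> + 2"
  have Q: "1 * 1 \<le> ?Q"
    using r p by (intro mult_mono one_le_power ge_one_powr_ge_zero) auto
  have "real (guesses p n m \<epsilon> * reps p n m \<epsilon>) * ((real (levels n m \<epsilon>) + 3) * real (budget p n m \<epsilon>)) \<le>
    real (guesses p n m \<epsilon> * reps p n m \<epsilon>) * ((real (levels n m \<epsilon>) + 3) * (?c * ?Q))"
    using budget_le[OF reg] by (intro mult_left_mono) auto
  then show ?thesis using Q by (simp add: changes_factor_def distrib_right mult.assoc)
qed

end

section \<open>Assembling the two algorithms\<close>

lemma regular_branch_parameters: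
  assumes p: "1 \<le> p" and reg: "regular n m \<epsilon>"
  shows "\<exists>A. (\<forall>us \<sigma>s. set us \<subseteq> {1..n} \<longrightarrow> \<sigma>s \<in> set_pmf (run_pmf A us) \<longrightarrow>
      real (state_changes \<sigma>s) \<le> changes_factor p n m \<epsilon> * (real n powr (1 - 1 / p) * (1 / \<epsilon>) ^ 4)) \<and>
    (\<forall>us \<sigma>s \<sigma>. set us \<subseteq> {1..n} \<longrightarrow> \<sigma>s \<in> set_pmf (run_pmf A us) \<longrightarrow> \<sigma> \<in> set \<sigma>s \<longrightarrow>
      real (length \<sigma>) \<le> bits_factor p n m \<epsilon> * (dim_factor p n * (1 / \<epsilon>) ^ 8)) \<and>
    (\<forall>us. set us \<subseteq> {1..n} \<longrightarrow> length us \<le> m \<longrightarrow>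
      2/3 \<le> measure_pmf.prob (output_pmf A us) {x. \<bar>x - freq_moment p n us\<bar> \<le> \<epsilon> * freq_moment p n us})"
proof -
  note r = regular_facts[OF reg]
  \<comment> \<open>The \<open>p\<close>-th power turns the count errors \<open>2 * \<eta>\<close>
    and \<open>3 * \<eta>\<close> into about \<open>\<epsilon> / 8\<close> and
    \<open>3 * \<epsilon> / 16\<close>; both stay within the \<open>\<epsilon> / 4\<close> reserved
    for them.\<close>
  define \<eta> where "\<eta> = \<epsilon> / (16 * p)"
  define Ng where "Ng = guesses p n m \<epsilon>"
  define R where "R = reps p n m \<epsilon>"
  define L where "L = oversampling p n m \<epsilon>"
  define M where "M = grid n m \<epsilon>"
  define \<theta> where "\<theta> = 2 ^ 18 * (real Ng)\<^sup>2 / \<epsilon>\<^sup>2"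
  define W where "W = mass_factor p n m \<epsilon> * (1 / \<epsilon>) ^ 2"
  define B where "B = budget p n m \<epsilon>"
  define Z where "Z = scales p n m \<epsilon>"
  define \<rho> where "\<rho> = flag_factor p n m \<epsilon>"
  define Lf where "Lf = levels n m \<epsilon>"
  define \<kappa> where "\<kappa> = capacity p n m \<epsilon>"
  define K where "K = key_length n m \<epsilon>"
  define v where "v s = 2 ^ s / (2 * \<theta>)" for s :: nat
  have Ng1: "1 \<le> real Ng" by (simp add: Ng_def guesses_def)
  have R1: "1 \<le> real R" by (simp add: R_def reps_def)
  have M1: "1 \<le> M" unfolding M_def by (rule grid_facts(1)[OF reg])
  have \<eta>: "0 < \<eta>" "\<eta> \<le> 1/16" "2 * \<eta> * p = \<epsilon> / 8" "3 * \<eta> * p = 3 * \<epsilon> / 16"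
    using r p by (auto simp: \<eta>_def field_simps)
  have B1: "1 \<le> real B" by (simp add: B_def budget_def)
  have Z: "B < 2 ^ Z"
  proof -
    have "real B < 2 ^ Z" unfolding Z_def scales_def B_def[symmetric] by (rule less_two_power_floor_log(1)[OF B1])
    then show ?thesis by (metis of_nat_less_iff of_nat_numeral of_nat_power)
  qed
  have \<theta>0: "0 < \<theta>" using Ng1 r by (simp add: \<theta>_def)
  have lge: "0 \<le> log 2 (1 + y)" if "0 \<le> y" for y :: real
    using that by simp
  have L3: "3 \<le> L"
    using lge[of "32 * real Ng * real R * real n"] by (simp add: L_def oversampling_def Ng_def R_def)
  have \<rho>0: "0 < \<rho>"
    using lge[of "16 * real Z * real m"] by (simp add: \<rho>_def flag_factor_def Z_def)
  interpret S: moment_sketch p \<eta> L \<rho> n K M Ng R B \<kappa> Lf v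
    by unfold_locales (use p \<eta> L3 \<rho>0 M1 R1 B1 \<theta>0 in \<open>auto simp: v_def \<kappa>_def capacity_def\<close>)
  have key: "n < 2 ^ K"
  proof -
    have "1 * real n \<le> real m * real n" using r by (intro mult_right_mono) auto
    then have "real n < 2 powr lg_mn m n" unfolding lg_mn_def by (subst powr_log_cancel) auto
    also have "\<dots> \<le> 2 powr real K"
      by (rule powr_mono) (use r(7) in \<open>simp_all add: K_def key_length_def of_nat_ceiling\<close>)
    also have "\<dots> = 2 ^ K" by (simp add: powr_realpow)
    finally show ?thesis by (metis of_nat_less_iff of_nat_numeral of_nat_power)
  qed
  have bits: "1 + M ^ Suc K * ((B + 1)\<^sup>2 * (n * (B + 1)\<^sup>2 * 2 ^ Lf + 1) ^ (Z * (Lf * \<kappa>) + 16)) ^ (Ng * R) \<le> 2 ^ bits p n m \<epsilon>"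
    (is "?T \<le> _")
  proof -
    have T: "0 < real ?T" unfolding of_nat_0_less_iff by (rule trans_less_add1) (rule zero_less_one)
    have "bits p n m \<epsilon> = nat \<lceil>log 2 (real ?T)\<rceil>"
      unfolding bits_def[OF p] M_def K_def B_def Lf_def Z_def \<kappa>_def Ng_def R_def ..
    then have "log 2 (real ?T) \<le> real (bits p n m \<epsilon>)" by (simp only: of_nat_ceiling)
    then have "real ?T \<le> 2 powr real (bits p n m \<epsilon>)" using T by (subst (asm) log_le_iff) auto
    also have "\<dots> = real (2 ^ bits p n m \<epsilon>)" by (simp add: powr_realpow)
    finally show ?thesis by (simp only: of_nat_le_iff)
  qed
  obtain A where A: "\<And>us \<sigma>s. set us \<subseteq> {1..n} \<Longrightarrow> \<sigma>s \<in> set_pmf (run_pmf A us) \<Longrightarrow>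
      real (state_changes \<sigma>s) \<le> 1 + real (Ng * R) * ((real Lf + 3) * real B)"
    "\<And>us \<sigma>s \<sigma>. set us \<subseteq> {1..n} \<Longrightarrow> \<sigma>s \<in> set_pmf (run_pmf A us) \<Longrightarrow> \<sigma> \<in> set \<sigma>s \<Longrightarrow> length \<sigma> \<le> bits p n m \<epsilon>"
    "\<And>us. set us \<subseteq> {1..n} \<Longrightarrow> output_pmf A us = map_pmf S.readout (fold_pmf S.sketch None us)"
    using S.sketch_realization[OF Z bits] by blast
  have L\<eta>: "L / \<eta>\<^sup>2 = sample_factor p n m \<epsilon> * (1 / \<epsilon>) ^ 2"
    using p r(3) by (simp add: sample_factor_def L_def \<eta>_def power2_eq_square field_simps)
  have acc: "2/3 \<le> measure_pmf.prob (output_pmf A us) {x. \<bar>x - freq_moment p n us\<bar> \<le> \<epsilon> * freq_moment p n us}"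
    if us: "set us \<subseteq> {1..n}" "length us \<le> m" for us
    unfolding A(3)[OF us(1)]
  proof (rule S.sketch_correct[OF us key r(3,4) v_def \<theta>_def _ _ _ _ Z])
    show "real m powr p < 2 ^ Ng"
    proof -
      have "p * log 2 (real m) < real Ng" unfolding Ng_def guesses_def by linarith
      then have "2 powr (p * log 2 (real m)) < 2 powr real Ng" by simp
      moreover have "2 powr (p * log 2 (real m)) = real m powr p"
        using r(2) by (simp add: powr_powr[symmetric] mult.commute[of p])
      ultimately show ?thesis by (simp add: powr_realpow)
    qed
    show "(1 + 2 * \<eta>) powr p \<le> 1 + \<epsilon> / 4"
    proof -
      have "(1 + 2 * \<eta>) powr p \<le> exp (2 * \<eta>) powr p"
        using \<eta> p exp_ge_add_one_self[of "2 * \<eta>"] by (intro powr_mono2) auto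
      also have "\<dots> = exp (\<epsilon> / 8)" using \<eta>(3) by (simp add: powr_def mult.commute)
      also have "\<dots> \<le> 1 + \<epsilon> / 8 + (\<epsilon> / 8)\<^sup>2" using r by (intro exp_bound) auto
      also have "(\<epsilon> / 8)\<^sup>2 \<le> \<epsilon> / 8 * 1" unfolding power2_eq_square using r by (intro mult_left_mono) auto
      finally show ?thesis by simp
    qed
    show "1 - \<epsilon> / 4 \<le> (1 - 3 * \<eta>) powr p"
    proof -
      have "1 + p * ((1 - 3 * \<eta>) - 1) \<le> (1 - 3 * \<eta>) powr p"
        using \<eta> p by (intro powr_ge_tangent) auto
      then have "1 - 3 * \<eta> * p \<le> (1 - 3 * \<eta>) powr p" by (simp add: algebra_simps)
      then show ?thesis unfolding \<eta>(4) using r(3) by linarith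
    qed
    show "8 * real n \<le> \<epsilon> * real M" unfolding M_def by (rule grid_facts(2)[OF reg])
    show "real m * real M < 2 ^ Lf"
    proof -
      have "1 * 1 \<le> real m * real M" using r(2) M1 by (intro mult_mono) auto
      then show ?thesis unfolding Lf_def levels_def M_def[symmetric] by (intro less_two_power_floor_log(1)) simp
    qed
    show "real Z * (real m * exp (- \<rho>)) \<le> 1/16"
    proof -
      let ?y = "16 * real Z * real m"
      have "ln (1 + ?y) \<le> \<rho>" using ln_le_log2[of "1 + ?y"] by (simp add: \<rho>_def flag_factor_def Z_def)
      then have "exp (- \<rho>) \<le> exp (- ln (1 + ?y))" by simp
      also have "\<dots> = 1 / (1 + ?y)" by (simp add: exp_minus inverse_eq_divide add_pos_nonneg)
      finally have "?y * exp (- \<rho>) \<le> ?y * (1 / (1 + ?y))" by (intro mult_left_mono) auto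
      also have "\<dots> \<le> 1" by (simp add: divide_le_eq add_pos_nonneg)
      finally show ?thesis by simp
    qed
    show "W = 128 * \<theta> * harm M"
      using r(3) by (simp add: W_def mass_factor_def \<theta>_def Ng_def M_def power_divide)
    show "1 \<le> W"
    proof -
      have h: "1 \<le> (harm M :: real)"
      proof -
        have "harm 1 \<le> (harm M :: real)" unfolding harm_def using M1 by (intro sum_mono2) auto
        then show ?thesis by (simp add: harm_def)
      qed
      have "1 * 1 * 1 * 1 \<le> 2 ^ 25 * (real Ng)\<^sup>2 * harm M * (1 / \<epsilon>) ^ 2"
        using Ng1 h r(6) by (intro mult_mono one_le_power) auto
      then show ?thesis by (simp add: W_def mass_factor_def Ng_def M_def)
    qed
    show "16 * (L / \<eta>\<^sup>2) * real n powr (1 - 1 / p) * W \<le> B"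
      unfolding L\<eta> W_def B_def budget_def by linarith
    show "32 * real Z * \<rho> * harm m * (L / \<eta>\<^sup>2)\<^sup>2 * (if p \<le> 2 then 1 else real n powr (1 - 2 / p)) * W\<^sup>2 \<le> \<kappa>"
      unfolding L\<eta> W_def \<kappa>_def capacity_def dim_factor_def Z_def \<rho>_def by linarith
    show "real Ng * real R * real n * exp (- L / 8) + real Ng * real n * (1/2) ^ R \<le> 1/16"
    proof -
      let ?y = "32 * real Ng * real R * real n"
      have "ln (1 + ?y) \<le> L / 8" using ln_le_log2[of "1 + ?y"] by (simp add: L_def oversampling_def Ng_def R_def)
      then have "exp (- L / 8) \<le> exp (- ln (1 + ?y))" by simp
      also have "\<dots> = 1 / (1 + ?y)" by (simp add: exp_minus inverse_eq_divide add_pos_nonneg)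
      finally have "?y * exp (- L / 8) \<le> ?y * (1 / (1 + ?y))" by (intro mult_left_mono) auto
      also have "\<dots> \<le> 1" by (simp add: divide_le_eq add_pos_nonneg)
      finally have 1: "real Ng * real R * real n * exp (- L / 8) \<le> 1/32" by simp
      let ?z = "32 * real Ng * real n"
      have z: "0 < 1 + ?z" by (simp add: add_pos_nonneg)
      have "log 2 (1 + ?z) \<le> real R" unfolding R_def reps_def Ng_def[symmetric] by linarith
      then have "1 + ?z \<le> 2 ^ R" using z by (subst (asm) log_le_iff) (auto simp: powr_realpow)
      then have "?z * (1/2) ^ R \<le> 1" by (simp add: power_one_over field_simps)
      then show ?thesis using 1 by simp
    qed
  qed
  have ch: "real (state_changes \<sigma>s) \<le> changes_factor p n m \<epsilon> * (real n powr (1 - 1 / p) * (1 / \<epsilon>) ^ 4)"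
    if "set us \<subseteq> {1..n}" "\<sigma>s \<in> set_pmf (run_pmf A us)" for us \<sigma>s
    using A(1)[OF that] changes_le[OF p reg] unfolding Ng_def R_def Lf_def B_def by linarith
  have sp: "real (length \<sigma>) \<le> bits_factor p n m \<epsilon> * (dim_factor p n * (1 / \<epsilon>) ^ 8)"
    if "set us \<subseteq> {1..n}" "\<sigma>s \<in> set_pmf (run_pmf A us)" "\<sigma> \<in> set \<sigma>s" for us \<sigma>s \<sigma>
    using A(2)[OF that] bits_le[OF p reg] by linarith
  show ?thesis using acc ch sp by (intro exI[of _ A]) auto
qed

lemma fold_pmf_append_element:
  "length xs + length us \<le> m \<Longrightarrow>
    fold_pmf (\<lambda>xs u. return_pmf (if length xs < m then xs @ [u] else xs)) xs us = return_pmf (xs @ us)"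
  by (induction us arbitrary: xs) (simp_all add: bind_return_pmf)

text \<open>The state is the stream itself and the potential its length. The guard on the length
  keeps the state set finite on streams that exceed \<open>m\<close>.\<close>

lemma exact_branch:
  assumes n: "1 \<le> n" and m: "1 \<le> m"
  shows "\<exists>A. (\<forall>us \<sigma>s. set us \<subseteq> {1..n} \<longrightarrow> \<sigma>s \<in> set_pmf (run_pmf A us) \<longrightarrow> real (state_changes \<sigma>s) \<le> real m) \<and>
    (\<forall>us \<sigma>s \<sigma>. set us \<subseteq> {1..n} \<longrightarrow> \<sigma>s \<in> set_pmf (run_pmf A us) \<longrightarrow> \<sigma> \<in> set \<sigma>s \<longrightarrow>
      real (length \<sigma>) \<le> 3 * real m * lg_mn m n) \<and>
    (\<forall>us. set us \<subseteq> {1..n} \<longrightarrow> length us \<le> m \<longrightarrow> output_pmf A us = return_pmf (freq_moment p n us))"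
proof -
  let ?X = "{us::nat list. set us \<subseteq> {1..n} \<and> length us \<le> m}"
  let ?K = "\<lambda>xs u::nat. return_pmf (if length xs < m then xs @ [u] else xs)"
  define b where "b = nat \<lceil>log 2 (real (card ?X))\<rceil>"
  have fin: "finite ?X" by (rule finite_lists_length_le) simp
  have ne: "[] \<in> ?X" by simp
  then have c0: "0 < card ?X" using fin card_gt_0_iff by blast
  have card: "card ?X \<le> (m + 1) * n ^ m"
  proof -
    have "card ?X = (\<Sum>i\<le>m. n ^ i)" by (subst card_lists_length_le) auto
    also have "\<dots> \<le> (\<Sum>i\<le>m. n ^ m)" using n by (intro sum_mono power_increasing) auto
    finally show ?thesis by simp
  qed
  have cb: "card ?X \<le> 2 ^ b"
  proof -
    have "log 2 (real (card ?X)) \<le> real b" unfolding b_def by (rule of_nat_ceiling)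
    then have "real (card ?X) \<le> 2 powr real b" using c0 by (subst (asm) log_le_iff) auto
    also have "\<dots> = real (2 ^ b)" by (simp add: powr_realpow)
    finally show ?thesis by (simp only: of_nat_le_iff)
  qed
  have l1: "1 \<le> lg_mn m n" by (rule lg_mn_ge_1[OF n m])
  have bb: "real b \<le> 3 * real m * lg_mn m n"
  proof -
    have "0 \<le> log 2 (real (card ?X))" using c0 by (simp add: Suc_le_eq)
    from nat_ceiling_le[OF this] have "real b \<le> log 2 (real (card ?X)) + 1" by (simp only: b_def)
    also have "log 2 (real (card ?X)) \<le> log 2 (real ((m + 1) * n ^ m))"
    proof (rule log_mono)
      show "real (card ?X) \<le> real ((m + 1) * n ^ m)" using card by (simp only: of_nat_le_iff)
      show "0 < real (card ?X)" using c0 by (simp only: of_nat_0_less_iff)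
    qed simp
    also have "\<dots> = log 2 (real m + 1) + real m * log 2 (real n)"
    proof -
      have "real ((m + 1) * n ^ m) = (real m + 1) * real n ^ m" by (simp add: algebra_simps)
      then have "log 2 (real ((m + 1) * n ^ m)) = log 2 (real m + 1) + log 2 (real n ^ m)"
        using n by (simp only:) (subst log_mult, auto)
      then show ?thesis using n by (simp add: log_nat_power)
    qed
    also have "\<dots> \<le> lg_mn m n + real m * lg_mn m n"
    proof (intro add_mono mult_left_mono)
      have mn: "real m \<le> real m * real n" "real n \<le> real m * real n" "0 < real n"
        using mult_left_mono[of 1 "real n" "real m"] mult_right_mono[of 1 "real m" "real n"] n m by auto
      show "log 2 (real m + 1) \<le> lg_mn m n" "log 2 (real n) \<le> lg_mn m n"
        unfolding lg_mn_def by (rule log_mono; use mn in linarith)+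
    qed simp
    finally have "real b \<le> 1 + 1 * lg_mn m n + real m * lg_mn m n" by simp
    also have "\<dots> \<le> 3 * real m * lg_mn m n"
    proof -
      have "1 * 1 \<le> real m * lg_mn m n" "1 * lg_mn m n \<le> real m * lg_mn m n"
        using m l1 by (intro mult_mono mult_right_mono; simp)+
      then show ?thesis by simp
    qed
    finally show ?thesis .
  qed
  obtain A where A:
    "\<And>us \<sigma>s. set us \<subseteq> {1..n} \<Longrightarrow> \<sigma>s \<in> set_pmf (run_pmf A us) \<Longrightarrow> real (state_changes \<sigma>s) \<le> real m"
    "\<And>us \<sigma>s \<sigma>. set us \<subseteq> {1..n} \<Longrightarrow> \<sigma>s \<in> set_pmf (run_pmf A us) \<Longrightarrow> \<sigma> \<in> set \<sigma>s \<Longrightarrow> length \<sigma> \<le> b"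
    "\<And>us. set us \<subseteq> {1..n} \<Longrightarrow> output_pmf A us = map_pmf (freq_moment p n) (fold_pmf ?K [] us)"
    by (rule finite_state_realization[OF fin ne cb, where V = "{1..n}" and K = ?K and D = "real m" and
          \<mu> = "\<lambda>us. real (length us)" and est = "freq_moment p n"])
      (auto split: if_splits)
  have "real (length \<sigma>) \<le> 3 * real m * lg_mn m n"
    if "set us \<subseteq> {1..n}" "\<sigma>s \<in> set_pmf (run_pmf A us)" "\<sigma> \<in> set \<sigma>s" for us \<sigma>s \<sigma>
    using A(2)[OF that] bb by linarith
  moreover have "output_pmf A us = return_pmf (freq_moment p n us)" if "set us \<subseteq> {1..n}" "length us \<le> m" for us
    using A(3)[OF that(1)] fold_pmf_append_element[of "[]" us m] that(2) by simp
  ultimately show ?thesis using A(1) by (intro exI[of _ A]) auto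
qed

theorem theorem1p3:
  fixes p :: real
  assumes "p \<ge> 1"
  shows "\<exists>(C::real) (a::nat) (k::nat). C > 0 \<and>
    (\<forall>(n::nat) (m::nat) (\<epsilon>::real). n \<ge> 1 \<longrightarrow> m \<ge> 1 \<longrightarrow> 0 < \<epsilon> \<longrightarrow> \<epsilon> < 1 \<longrightarrow>
      (\<exists>A::streaming_alg.
        state_changes_bounded A (streams_upto n m)
          (C * real n powr (1 - 1 / p) * (1 / \<epsilon>) ^ a * lg_mn m n ^ k) \<and>
        (\<forall>us\<in>streams_upto n m.
          measure_pmf.prob (output_pmf A us)
            {x. \<bar>x - freq_moment p n us\<bar> \<le> \<epsilon> * freq_moment p n us} \<ge> 2 / 3) \<and>
        (p \<le> 2 \<longrightarrow> space_bounded A (streams_upto n m)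
          (C * (1 / \<epsilon>) powr (4 + 4 * p) * lg_mn m n ^ k)) \<and>
        (p > 2 \<longrightarrow> space_bounded A (streams_upto n m)
          (C * (1 / \<epsilon>) powr (4 + 4 * p) * real n powr (1 - 2 / p) * lg_mn m n ^ k))))"
proof -
  obtain C1 k1 where c1: "0 \<le> C1" "\<And>n m \<epsilon>. regular n m \<epsilon> \<Longrightarrow> changes_factor p n m \<epsilon> \<le> C1 * lg_mn m n ^ k1"
    using polylog_changes_factor[OF assms] unfolding polylog_def by blast
  obtain C2 k2 where c2: "0 \<le> C2" "\<And>n m \<epsilon>. regular n m \<epsilon> \<Longrightarrow> bits_factor p n m \<epsilon> \<le> C2 * lg_mn m n ^ k2"
    using polylog_bits_factor[OF assms] unfolding polylog_def by blast
  define C where "C = C1 + C2 + 3"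
  \<comment> \<open>The successor provides the one logarithm in the space bound of
    \<open>exact_branch\<close>.\<close>
  define k where "k = Suc (k1 + k2)"
  have C: "0 < C" "C1 \<le> C" "C2 \<le> C" "3 \<le> C" using c1(1) c2(1) by (auto simp: C_def)
  have core: "\<exists>A. (\<forall>us\<in>streams_upto n m. \<forall>\<sigma>s\<in>set_pmf (run_pmf A us).
        real (state_changes \<sigma>s) \<le> C * real n powr (1 - 1 / p) * (1 / \<epsilon>) ^ 4 * lg_mn m n ^ k \<and>
        (\<forall>\<sigma>\<in>set \<sigma>s. real (length \<sigma>) \<le> C * (1 / \<epsilon>) powr (4 + 4 * p) * dim_factor p n * lg_mn m n ^ k)) \<and>
      (\<forall>us\<in>streams_upto n m. measure_pmf.prob (output_pmf A us)
            {x. \<bar>x - freq_moment p n us\<bar> \<le> \<epsilon> * freq_moment p n us} \<ge> 2 / 3)"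
    if n: "1 \<le> n" and m: "1 \<le> m" and \<epsilon>: "0 < \<epsilon>" "\<epsilon> < 1" for n m :: nat and \<epsilon> :: real
  proof -
    have lg: "1 \<le> lg_mn m n" by (rule lg_mn_ge_1[OF n m])
    have e1: "1 \<le> 1 / \<epsilon>" using \<epsilon> by simp
    have np: "1 \<le> real n powr (1 - 1 / p)" using n assms by (intro ge_one_powr_ge_zero) auto
    have df: "1 \<le> dim_factor p n" by (rule dim_factor_ge_1[OF assms n])
    have lk: "lg_mn m n ^ j \<le> lg_mn m n ^ k" if "j \<le> k" for j using lg that by (rule power_increasing[rotated])
    \<comment> \<open>Here the exponent 8 of the capacity meets the claim:
      \<open>8 \<le> 4 + 4 * p\<close> because \<open>1 \<le> p\<close>.\<close>
    have e8: "(1 / \<epsilon>) ^ 8 \<le> (1 / \<epsilon>) powr (4 + 4 * p)"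
    proof -
      have "(1 / \<epsilon>) ^ 8 = (1 / \<epsilon>) powr real 8" using \<epsilon> by (subst powr_realpow) auto
      also have "\<dots> \<le> (1 / \<epsilon>) powr (4 + 4 * p)" using e1 assms by (intro powr_mono) auto
      finally show ?thesis .
    qed
    show ?thesis
    proof (cases "regular n m \<epsilon>")
      case True
      have b1: "changes_factor p n m \<epsilon> * (real n powr (1 - 1 / p) * (1 / \<epsilon>) ^ 4) \<le>
        C * real n powr (1 - 1 / p) * (1 / \<epsilon>) ^ 4 * lg_mn m n ^ k"
      proof -
        have "changes_factor p n m \<epsilon> \<le> C1 * lg_mn m n ^ k1" by (rule c1(2)[OF True])
        also have "\<dots> \<le> C * lg_mn m n ^ k" using C lg c1(1) by (intro mult_mono lk) (auto simp: k_def)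
        finally have "changes_factor p n m \<epsilon> * (real n powr (1 - 1 / p) * (1 / \<epsilon>) ^ 4) \<le>
          (C * lg_mn m n ^ k) * (real n powr (1 - 1 / p) * (1 / \<epsilon>) ^ 4)"
          using np e1 by (intro mult_right_mono) auto
        then show ?thesis by (simp only: mult_ac)
      qed
      have b2: "bits_factor p n m \<epsilon> * (dim_factor p n * (1 / \<epsilon>) ^ 8) \<le>
        C * (1 / \<epsilon>) powr (4 + 4 * p) * dim_factor p n * lg_mn m n ^ k"
      proof -
        have "bits_factor p n m \<epsilon> \<le> C2 * lg_mn m n ^ k2" by (rule c2(2)[OF True])
        also have "\<dots> \<le> C * lg_mn m n ^ k" using C lg c2(1) by (intro mult_mono lk) (auto simp: k_def)
        finally have "bits_factor p n m \<epsilon> * (dim_factor p n * (1 / \<epsilon>) ^ 8) \<le>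
          (C * lg_mn m n ^ k) * (dim_factor p n * (1 / \<epsilon>) powr (4 + 4 * p))"
          using df e1 e8 C lg by (intro mult_mono) auto
        then show ?thesis by (simp only: mult_ac)
      qed
      obtain A where A: "\<forall>us \<sigma>s. set us \<subseteq> {1..n} \<longrightarrow> \<sigma>s \<in> set_pmf (run_pmf A us) \<longrightarrow>
          real (state_changes \<sigma>s) \<le> changes_factor p n m \<epsilon> * (real n powr (1 - 1 / p) * (1 / \<epsilon>) ^ 4)"
        "\<forall>us \<sigma>s \<sigma>. set us \<subseteq> {1..n} \<longrightarrow> \<sigma>s \<in> set_pmf (run_pmf A us) \<longrightarrow> \<sigma> \<in> set \<sigma>s \<longrightarrow>
          real (length \<sigma>) \<le> bits_factor p n m \<epsilon> * (dim_factor p n * (1 / \<epsilon>) ^ 8)"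
        "\<forall>us. set us \<subseteq> {1..n} \<longrightarrow> length us \<le> m \<longrightarrow>
          2/3 \<le> measure_pmf.prob (output_pmf A us) {x. \<bar>x - freq_moment p n us\<bar> \<le> \<epsilon> * freq_moment p n us}"
        using regular_branch_parameters[OF assms True] by (elim exE conjE)
      show ?thesis
        unfolding streams_upto_def mem_Collect_eq
        by (intro exI[of _ A] conjI ballI order_trans[OF _ b1] order_trans[OF _ b2]; use A in blast)
    next
      case False
      \<comment> \<open>Outside the regular range the stream length is at most
        \<open>1 / \<epsilon>\<close>, so the powers of \<open>1 / \<epsilon>\<close> in both bounds
        pay for storing everything.\<close>
      then have "real m * real n \<le> 1 / \<epsilon>" using n m \<epsilon> by (auto simp: regular_def field_simps not_less)
      moreover have "real m * 1 \<le> real m * real n" using n by (intro mult_left_mono) auto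
      ultimately have me: "real m \<le> 1 / \<epsilon>" by simp
      have ei: "1 / \<epsilon> \<le> (1 / \<epsilon>) ^ j" if "0 < j" for j
        using power_increasing[of 1 j "1 / \<epsilon>"] e1 that by simp
      have b1: "real m \<le> C * real n powr (1 - 1 / p) * (1 / \<epsilon>) ^ 4 * lg_mn m n ^ k"
      proof -
        have "1 * 1 * real m * 1 \<le> C * real n powr (1 - 1 / p) * (1 / \<epsilon>) ^ 4 * lg_mn m n ^ k"
          using C np lg e1 me ei[of 4] by (intro mult_mono one_le_power) auto
        then show ?thesis by simp
      qed
      have b2: "3 * real m * lg_mn m n \<le> C * (1 / \<epsilon>) powr (4 + 4 * p) * dim_factor p n * lg_mn m n ^ k"
      proof -
        have "3 * real m * 1 * lg_mn m n ^ 1 \<le> C * (1 / \<epsilon>) powr (4 + 4 * p) * dim_factor p n * lg_mn m n ^ k"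
          using C df lg e1 me ei[of 8] e8 by (intro mult_mono lk) (auto simp: k_def)
        then show ?thesis by simp
      qed
      obtain A where A: "\<forall>us \<sigma>s. set us \<subseteq> {1..n} \<longrightarrow> \<sigma>s \<in> set_pmf (run_pmf A us) \<longrightarrow> real (state_changes \<sigma>s) \<le> real m"
        "\<forall>us \<sigma>s \<sigma>. set us \<subseteq> {1..n} \<longrightarrow> \<sigma>s \<in> set_pmf (run_pmf A us) \<longrightarrow> \<sigma> \<in> set \<sigma>s \<longrightarrow>
          real (length \<sigma>) \<le> 3 * real m * lg_mn m n"
        "\<forall>us. set us \<subseteq> {1..n} \<longrightarrow> length us \<le> m \<longrightarrow> output_pmf A us = return_pmf (freq_moment p n us)"
        using exact_branch[OF n m, of p] by (elim exE conjE)
      have pr: "2/3 \<le> measure_pmf.prob (output_pmf A us) {x. \<bar>x - freq_moment p n us\<bar> \<le> \<epsilon> * freq_moment p n us}"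
        if "set us \<subseteq> {1..n}" "length us \<le> m" for us
      proof -
        have "0 \<le> freq_moment p n us" by (auto simp: freq_moment_def intro: sum_nonneg)
        then show ?thesis using A(3) that \<epsilon> by simp
      qed
      show ?thesis
        unfolding streams_upto_def mem_Collect_eq
        by (intro exI[of _ A] conjI ballI order_trans[OF _ b1] order_trans[OF _ b2]; use A pr in blast)
    qed
  qed
  show ?thesis
  proof (rule exI[of _ C], rule exI[of _ 4], rule exI[of _ k], intro conjI allI impI)
    show "0 < C" by (rule C(1))
    fix n m :: nat and \<epsilon> :: real assume "1 \<le> n" "1 \<le> m" "0 < \<epsilon>" "\<epsilon> < 1"
    from core[OF this] obtain A where A: "\<forall>us\<in>streams_upto n m. \<forall>\<sigma>s\<in>set_pmf (run_pmf A us).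
        real (state_changes \<sigma>s) \<le> C * real n powr (1 - 1 / p) * (1 / \<epsilon>) ^ 4 * lg_mn m n ^ k \<and>
        (\<forall>\<sigma>\<in>set \<sigma>s. real (length \<sigma>) \<le> C * (1 / \<epsilon>) powr (4 + 4 * p) * dim_factor p n * lg_mn m n ^ k)"
      "\<forall>us\<in>streams_upto n m. measure_pmf.prob (output_pmf A us)
            {x. \<bar>x - freq_moment p n us\<bar> \<le> \<epsilon> * freq_moment p n us} \<ge> 2 / 3" by (elim exE conjE)
    show "\<exists>A::streaming_alg.
        state_changes_bounded A (streams_upto n m)
          (C * real n powr (1 - 1 / p) * (1 / \<epsilon>) ^ 4 * lg_mn m n ^ k) \<and>
        (\<forall>us\<in>streams_upto n m.
          measure_pmf.prob (output_pmf A us)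
            {x. \<bar>x - freq_moment p n us\<bar> \<le> \<epsilon> * freq_moment p n us} \<ge> 2 / 3) \<and>
        (p \<le> 2 \<longrightarrow> space_bounded A (streams_upto n m)
          (C * (1 / \<epsilon>) powr (4 + 4 * p) * lg_mn m n ^ k)) \<and>
        (p > 2 \<longrightarrow> space_bounded A (streams_upto n m)
          (C * (1 / \<epsilon>) powr (4 + 4 * p) * real n powr (1 - 2 / p) * lg_mn m n ^ k))"
    proof (intro exI[of _ A] conjI impI)
      show "state_changes_bounded A (streams_upto n m)
          (C * real n powr (1 - 1 / p) * (1 / \<epsilon>) ^ 4 * lg_mn m n ^ k)"
        unfolding state_changes_bounded_def using A(1) by blast
      show "\<forall>us\<in>streams_upto n m. measure_pmf.prob (output_pmf A us)
            {x. \<bar>x - freq_moment p n us\<bar> \<le> \<epsilon> * freq_moment p n us} \<ge> 2 / 3" by (rule A(2))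
      have sp: "space_bounded A (streams_upto n m) (C * (1 / \<epsilon>) powr (4 + 4 * p) * dim_factor p n * lg_mn m n ^ k)"
        unfolding space_bounded_def using A(1) by blast
      show "space_bounded A (streams_upto n m) (C * (1 / \<epsilon>) powr (4 + 4 * p) * lg_mn m n ^ k)" if "p \<le> 2"
        using sp that by (simp add: dim_factor_def)
      show "space_bounded A (streams_upto n m)
          (C * (1 / \<epsilon>) powr (4 + 4 * p) * real n powr (1 - 2 / p) * lg_mn m n ^ k)" if "2 < p"
        using sp that by (simp add: dim_factor_def)
    qed
  qed
qed

end
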